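(* For all sufficiently small $c'>0$, the measures $$\mu_N=\frac1N\sum_{\beta:\ |\beta-1|\le c',\ Z_{\beta,N}=0}\delta_\beta$$ converge to $\mu$ as $N\to\infty$ in the weak topology for positive measures on $\mathbb{C}$, where $\mu$ is the finite positive measure supported on $\Gamma_{c'}=\Gamma\cap\{|\beta-1|\le c'\}$ defined as follows: for a segment $I$ of $\Gamma$ connecting $a_j=1+\epsilon_j+iR_0(\epsilon_j)\in\Gamma_{c'}$, $j=1,2$, with $\epsilon_2>\epsilon_1\ge0$, $$\mu(I)=\frac1{2\pi}\bigl|\operatorname{Im}h_{a_2}(u_{a_2})-\operatorname{Im}h_{a_1}(u_{a_1})\bigr| ,$$ and $\mu$ is extended to the lower half plane by symmetry (under complex conjugation).
   Context: For an integer $N\ge1$ and $\beta\in\mathbb{C}$, the Curie–Weiss partition function is $$Z_{\beta,N}=\frac1{2^N}\sum_{\sigma\in\{-1,+1\}^N}\exp(-\beta H_N(\sigma)),\qquad H_N(\sigma)=-\frac1{2N}\sum_{i,j=1}^N\sigma_i\sigma_j .$$ For $\beta\ne0$ let $h_\beta(u)=\frac{u^2}{2\beta}-\log\cosh u$, an even function analytic on $\mathbb{C}\setminus\bigl((-i\infty,-i\pi/2]\cup[i\pi/2,+i\infty)\bigr)$, with $\log\cosh0=0$. Fix a sufficiently small $c_0>0$ such that for $0<|\beta-1|\le c_0$ the function $h_\beta'(u)=\frac u\beta-\tanh u$ has exactly three zeros in $|u|\le10\sqrt{c_0}$, denoted $0,\pm u_\beta$ (the choice of sign is irrelevant); for $\beta=1$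 put $u_1=0$, so $h_1(u_1)=0$. Critical curve: there exist $c,C>0$ and a smooth function $R_0$ on $[-c,c]$ with $|R_0(\epsilon)-\epsilon|\le C\epsilon^2$ such that, for $\beta=1+\epsilon+iR$ with $|\epsilon|\le c$ in a small punctured neighbourhood of $1$, $\operatorname{Re}h_\beta(\pm u_\beta)$ is negative, zero, or positive according to whether $|R|<|R_0(\epsilon)|$, $|R|=|R_0(\epsilon)|$, or $|R|>|R_0(\epsilon)|$. Fix such $c$ and $R_0$ and set $\Gamma=\{\beta=1+\epsilon+iR:\ 0\le\epsilon\le c,\ R=\pm R_0(\epsilon)\}$. $\delta_\beta$ denotes the unit point mass at $\beta$. *)

theory Defs
  imports "HOL-Complex_Analysis.Complex_Analysis" "HOL-Probability.Probability"
begin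

definition hamiltonian :: "nat \<Rightarrow> (nat \<Rightarrow> real) \<Rightarrow> real" where
  "hamiltonian N \<sigma> = - (1 / (2 * real N)) * (\<Sum>i\<in>{1..N}. \<Sum>j\<in>{1..N}. \<sigma> i * \<sigma> j)"

definition partition_function :: "complex \<Rightarrow> nat \<Rightarrow> complex" where
  "partition_function \<beta> N =
     1 / 2 ^ N * (\<Sum>\<sigma>\<in>({1..N} \<rightarrow>\<^sub>E {-1, 1}). exp (- \<beta> * of_real (hamiltonian N \<sigma>)))"

definition slit_plane :: "complex set" where
  "slit_plane = - {z. Re z = 0 \<and> (Im z \<le> - pi / 2 \<or> pi / 2 \<le> Im z)}"

lemma open_slit_plane: "open slit_plane"
proof -
  have "closed ({z. Re z = 0} \<inter> ({z. Im z \<le> - pi / 2} \<union> {z. pi / 2 \<le> Im z}))"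
    by (intro closed_Int closed_Un closed_Collect_eq closed_Collect_le continuous_intros)
  moreover have "slit_plane = - ({z. Re z = 0} \<inter> ({z. Im z \<le> - pi / 2} \<union> {z. pi / 2 \<le> Im z}))"
    by (auto simp: slit_plane_def)
  ultimately show ?thesis
    by (metis open_Compl)
qed

lemma zero_in_slit_plane: "0 \<in> slit_plane"
  using pi_gt_zero by (simp add: slit_plane_def not_le)

lemma uminus_in_slit_plane: "z \<in> slit_plane \<Longrightarrow> - z \<in> slit_plane"
  by (auto simp: slit_plane_def)

lemma starlike_slit_plane: "starlike slit_plane"
  unfolding starlike_def
proof (intro bexI[OF _ zero_in_slit_plane] ballI subsetI)
  fix x w assume x: "x \<in> slit_plane" and w: "w \<in> closed_segment 0 x"
  then obtain t where t: "0 \<le> t" "t \<le> 1" "w = of_real t * x"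
    by (auto simp: in_segment scaleR_conv_of_real)
  show "w \<in> slit_plane"
  proof (cases "Re x = 0")
    case True
    then have "\<bar>Im x\<bar> < pi / 2"
      using x by (auto simp: slit_plane_def)
    moreover have "\<bar>Im w\<bar> \<le> \<bar>Im x\<bar>"
      using t by (simp add: abs_mult mult_left_le_one_le)
    ultimately show ?thesis
      by (auto simp: slit_plane_def)
  next
    case False
    then show ?thesis
      using t pi_gt_zero by (cases "t = 0") (auto simp: slit_plane_def not_le)
  qed
qed

lemma cosh_nonzero_on_slit_plane:
  assumes "z \<in> slit_plane"
  shows "cosh z \<noteq> 0"
proof
  assume "cosh z = 0"
  then obtain n :: int where n: "\<i> * z = complex_of_real (n * pi) + of_real pi / 2"
    by (auto simp: cosh_conv_cos cos_eq_0)
  have "Re z = 0"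
    using arg_cong[OF n, of Im] by simp
  moreover have im: "- Im z = n * pi + pi / 2"
    using arg_cong[OF n, of Re] by simp
  moreover have "pi / 2 \<le> \<bar>Im z\<bar>"
  proof (cases "n \<ge> 0")
    case True
    then have "0 \<le> n * pi" by simp
    then show ?thesis using im by linarith
  next
    case False
    then have "n * pi \<le> -1 * pi"
      by (intro mult_right_mono) auto
    then show ?thesis using im by linarith
  qed
  ultimately show False
    using assms by (auto simp: slit_plane_def)
qed

(* The choice is unique on the slit plane; see log_cosh_spec and log_cosh_unique below. *)
definition log_cosh :: "complex \<Rightarrow> complex" where
  "log_cosh = (SOME L. L holomorphic_on slit_plane \<and> L 0 = 0 \<and> (\<forall>z\<in>slit_plane. exp (L z) = cosh z))"

lemma log_cosh_spec:
  "log_cosh holomorphic_on slit_plane" "log_cosh 0 = 0"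
  "z \<in> slit_plane \<Longrightarrow> exp (log_cosh z) = cosh z"
proof -
  have "cosh holomorphic_on slit_plane"
    by (auto simp: holomorphic_on_def field_differentiable_def
        intro: DERIV_subset[OF has_field_derivative_cosh[OF DERIV_ident]])
  then obtain g where g: "g holomorphic_on slit_plane" "\<And>z. z \<in> slit_plane \<Longrightarrow> cosh z = exp (g z)"
    using contractible_imp_holomorphic_log[OF _ starlike_imp_contractible[OF starlike_slit_plane]]
      cosh_nonzero_on_slit_plane by blast
  have "exp (g 0) = 1"
    using g(2)[OF zero_in_slit_plane] by simp
  then have "\<exists>L. L holomorphic_on slit_plane \<and> L 0 = 0 \<and> (\<forall>z\<in>slit_plane. exp (L z) = cosh z)"
    using g by (intro exI[of _ "\<lambda>z. g z - g 0"]) (auto intro!: holomorphic_intros simp: exp_diff)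
  from someI_ex[OF this] show
    "log_cosh holomorphic_on slit_plane" "log_cosh 0 = 0"
    "z \<in> slit_plane \<Longrightarrow> exp (log_cosh z) = cosh z"
    unfolding log_cosh_def by blast+
qed

lemma has_field_derivative_log_of_cosh:
  assumes L: "L holomorphic_on slit_plane" "\<And>z. z \<in> slit_plane \<Longrightarrow> exp (L z) = cosh z"
    and z: "z \<in> slit_plane"
  shows "(L has_field_derivative tanh z) (at z)"
proof -
  have d: "(L has_field_derivative deriv L z) (at z)"
    using L(1) z open_slit_plane by (simp add: holomorphic_derivI)
  then have "((\<lambda>w. exp (L w)) has_field_derivative exp (L z) * deriv L z) (at z)"
    by (auto intro!: derivative_eq_intros)
  then have "(cosh has_field_derivative exp (L z) * deriv L z) (at z)"
    using open_slit_plane z L(2) by (rule has_field_derivative_transform_within_open)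
  then have "exp (L z) * deriv L z = sinh z"
    by (rule DERIV_unique) (auto intro!: derivative_eq_intros)
  then have "deriv L z = tanh z"
    using L(2)[OF z] cosh_nonzero_on_slit_plane[OF z] by (simp add: tanh_def field_simps)
  then show ?thesis
    using d by simp
qed

lemma log_cosh_unique:
  assumes L: "L holomorphic_on slit_plane" "L 0 = 0" "\<And>z. z \<in> slit_plane \<Longrightarrow> exp (L z) = cosh z"
    and z: "z \<in> slit_plane"
  shows "L z = log_cosh z"
proof -
  have "((\<lambda>w. L w - log_cosh w) has_field_derivative 0) (at w)" if "w \<in> slit_plane" for w
    using DERIV_diff[OF has_field_derivative_log_of_cosh[OF L(1,3) that]
        has_field_derivative_log_of_cosh[OF log_cosh_spec(1,3) that]] by simp
  then obtain k where k: "\<And>w. w \<in> slit_plane \<Longrightarrow> L w - log_cosh w = k"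
    using DERIV_zero_connected_constant[OF starlike_imp_connected[OF starlike_slit_plane] open_slit_plane
        finite.emptyI, of "\<lambda>w. L w - log_cosh w"] L(1) log_cosh_spec(1)
    by (metis Diff_empty holomorphic_on_diff holomorphic_on_imp_continuous_on)
  from k[OF zero_in_slit_plane] k[OF z] L(2) log_cosh_spec(2) show ?thesis
    by simp
qed

lemma log_cosh_minus:
  assumes "z \<in> slit_plane"
  shows "log_cosh (- z) = log_cosh z"
proof -
  have "log_cosh \<circ> uminus holomorphic_on slit_plane"
    by (rule holomorphic_on_compose_gen[OF _ log_cosh_spec(1)])
      (auto intro!: holomorphic_intros simp: uminus_in_slit_plane)
  from log_cosh_unique[OF this _ _ assms] show ?thesis
    by (simp add: log_cosh_spec uminus_in_slit_plane)
qed

definition h :: "complex \<Rightarrow> complex \<Rightarrow> complex" where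
  "h \<beta> z = z\<^sup>2 / (2 * \<beta>) - log_cosh z"

lemma has_field_derivative_h:
  assumes "\<beta> \<noteq> 0" "z \<in> slit_plane"
  shows "(h \<beta> has_field_derivative (z / \<beta> - tanh z)) (at z)"
  unfolding h_def using assms
  by (auto intro!: derivative_eq_intros
        has_field_derivative_log_of_cosh[OF log_cosh_spec(1,3)])

lemma h_minus: "z \<in> slit_plane \<Longrightarrow> h \<beta> (- z) = h \<beta> z"
  by (simp add: h_def log_cosh_minus)

(* Here z / \<beta> - tanh z is the derivative of h \<beta>; see has_field_derivative_h below. *)
definition saddle_points :: "real \<Rightarrow> (complex \<Rightarrow> complex) \<Rightarrow> bool" where
  "saddle_points c0 u \<longleftrightarrow>
     (\<forall>\<beta>. 0 < cmod (\<beta> - 1) \<and> cmod (\<beta> - 1) \<le> c0 \<longrightarrow>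
        u \<beta> \<noteq> 0 \<and> {z. cmod z \<le> 10 * sqrt c0 \<and> z / \<beta> - tanh z = 0} = {0, u \<beta>, - u \<beta>}) \<and>
     u 1 = 0"

(* One-sided derivatives at the end points. *)
definition smooth_on_interval :: "real \<Rightarrow> real \<Rightarrow> (real \<Rightarrow> real) \<Rightarrow> bool" where
  "smooth_on_interval a b f \<longleftrightarrow>
     (\<exists>D :: nat \<Rightarrow> real \<Rightarrow> real. (\<forall>x\<in>{a..b}. D 0 x = f x) \<and>
        (\<forall>n. \<forall>x\<in>{a..b}. (D n has_real_derivative D (Suc n) x) (at x within {a..b})))"

(* With \<beta> = 1 + \<epsilon> + i R, the real coordinates are \<epsilon> = Re \<beta> - 1 and R = Im \<beta>. *)
definition critical_curve :: "(complex \<Rightarrow> complex) \<Rightarrow> real \<Rightarrow> (real \<Rightarrow> real) \<Rightarrow> bool" where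
  "critical_curve u c R0 \<longleftrightarrow>
     smooth_on_interval (- c) c R0 \<and>
     (\<exists>C>0. \<forall>\<epsilon>\<in>{-c..c}. \<bar>R0 \<epsilon> - \<epsilon>\<bar> \<le> C * \<epsilon>\<^sup>2) \<and>
     (\<forall>\<^sub>F \<beta> in at 1. \<bar>Re \<beta> - 1\<bar> \<le> c \<longrightarrow>
        (\<forall>z\<in>{u \<beta>, - u \<beta>}.
          (\<bar>Im \<beta>\<bar> < \<bar>R0 (Re \<beta> - 1)\<bar> \<longrightarrow> Re (h \<beta> z) < 0) \<and>
          (\<bar>Im \<beta>\<bar> = \<bar>R0 (Re \<beta> - 1)\<bar> \<longrightarrow> Re (h \<beta> z) = 0) \<and>
          (\<bar>Im \<beta>\<bar> > \<bar>R0 (Re \<beta> - 1)\<bar> \<longrightarrow> Re (h \<beta> z) > 0)))"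

definition Gamma_curve :: "real \<Rightarrow> (real \<Rightarrow> real) \<Rightarrow> complex set" where
  "Gamma_curve c R0 = {Complex (1 + \<epsilon>) R |\<epsilon> R. 0 \<le> \<epsilon> \<and> \<epsilon> \<le> c \<and> (R = R0 \<epsilon> \<or> R = - R0 \<epsilon>)}"

definition Gamma_near :: "real \<Rightarrow> (real \<Rightarrow> real) \<Rightarrow> real \<Rightarrow> complex set" where
  "Gamma_near c R0 c' = Gamma_curve c R0 \<inter> {\<beta>. cmod (\<beta> - 1) \<le> c'}"

definition upper_arc :: "(real \<Rightarrow> real) \<Rightarrow> real \<Rightarrow> complex" where
  "upper_arc R0 \<epsilon> = Complex (1 + \<epsilon>) (R0 \<epsilon>)"

(* The last conjunct is the extension to the lower half plane by symmetry. *)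
definition is_zero_limit ::
    "(complex \<Rightarrow> complex) \<Rightarrow> real \<Rightarrow> (real \<Rightarrow> real) \<Rightarrow> real \<Rightarrow> complex measure \<Rightarrow> bool" where
  "is_zero_limit u c R0 c' \<mu> \<longleftrightarrow>
     sets \<mu> = sets borel \<and> finite_measure \<mu> \<and>
     emeasure \<mu> (- Gamma_near c R0 c') = 0 \<and>
     (\<forall>\<epsilon>1 \<epsilon>2. 0 \<le> \<epsilon>1 \<and> \<epsilon>1 < \<epsilon>2 \<and>
        upper_arc R0 \<epsilon>1 \<in> Gamma_near c R0 c' \<and> upper_arc R0 \<epsilon>2 \<in> Gamma_near c R0 c' \<longrightarrow>
        measure \<mu> (upper_arc R0 ` {\<epsilon>1..\<epsilon>2}) =
          1 / (2 * pi) *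
          \<bar>Im (h (upper_arc R0 \<epsilon>2) (u (upper_arc R0 \<epsilon>2))) -
           Im (h (upper_arc R0 \<epsilon>1) (u (upper_arc R0 \<epsilon>1)))\<bar>) \<and>
     distr \<mu> borel cnj = \<mu>"

definition zeros_near :: "real \<Rightarrow> nat \<Rightarrow> complex set" where
  "zeros_near c' N = {\<beta>. cmod (\<beta> - 1) \<le> c' \<and> partition_function \<beta> N = 0}"

(* The sum of Dirac measures over S is the image of the counting measure on S; see
   emeasure_zero_measure below. The sum ranges over the set of zeros, so each zero counts once. *)
definition zero_measure :: "real \<Rightarrow> nat \<Rightarrow> complex measure" where
  "zero_measure c' N =
     scale_measure (ennreal (1 / real N)) (distr (count_space (zeros_near c' N)) borel (\<lambda>\<beta>. \<beta>))"

lemma emeasure_zero_measure: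
  assumes "finite (zeros_near c' N)" "A \<in> sets borel"
  shows "emeasure (zero_measure c' N) A =
           ennreal (1 / real N) * (\<Sum>\<beta>\<in>zeros_near c' N. emeasure (return borel \<beta>) A)"
proof -
  have "emeasure (distr (count_space (zeros_near c' N)) borel (\<lambda>\<beta>. \<beta>)) A =
          emeasure (count_space (zeros_near c' N)) (A \<inter> zeros_near c' N)"
    using assms by (subst emeasure_distr) auto
  also have "\<dots> = (\<Sum>\<beta>\<in>zeros_near c' N. indicator A \<beta>)"
    using assms by (subst emeasure_count_space_finite)
      (auto simp: indicator_def sum.If_cases Int_commute)
  finally show ?thesis
    using assms by (simp add: zero_measure_def)
qed

definition weakly_converges :: "(nat \<Rightarrow> complex measure) \<Rightarrow> complex measure \<Rightarrow> bool" where
  "weakly_converges M \<mu> \<longleftrightarrow>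
     (\<forall>f :: complex \<Rightarrow> real. continuous_on UNIV f \<and> bounded (range f) \<longrightarrow>
        (\<lambda>N. integral\<^sup>L (M N) f) \<longlonglongrightarrow> integral\<^sup>L \<mu> f)"

end

theory Submission
  imports Defs "HOL-Real_Asymp.Real_Asymp"
begin

text \<open>
  By the Hubbard--Stratonovich identity, \<open>Z\<close> is up to a nonvanishing factor the integral of
  \<open>exp (- N h)\<close> over the half line. In terms of the square \<open>p\<close> of the saddle point both \<open>\<beta>\<close> and
  the saddle value are holomorphic near \<open>p = 0\<close>, and the saddle value is about \<open>- p\<^sup>2 / 12\<close>.
  In the sector around \<open>arg p = \<pi> / 4\<close> the contour splits at the valley point with square \<open>\<i> * p\<close>,
  so that \<open>Z = 0\<close> reads \<open>A + B * exp (- N * saddle value) = 0\<close> with \<open>A\<close> and \<open>B\<close> nonvanishing and,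
  after multiplication by \<open>sqrt N\<close>, bounded above and below. Hence the zeros there are in
  bijection with the odd multiples of \<open>\<i> * \<pi> / N\<close>, up to \<open>O(1 / N)\<close>, under minus the saddle value;
  in particular they are distinct. In the other sectors one saddle point dominates and there are no zeros.
  Jensen's inequality bounds the number of zeros in a disc of radius \<open>r\<close> around \<open>\<beta> = 1\<close>
  by \<open>3 * r * N\<close>, so no mass concentrates at \<open>1\<close>.
\<close>

section \<open>Complex Gaussian integrals\<close>

text \<open>The Laplace asymptotics degenerate at \<open>p = 0\<close>, where the saddle points
  \<open>u\<close> and \<open>- u\<close> merge with the origin, so they are proved only on compact
  sets that avoid \<open>p = 0\<close>; the disc left out is handled by counting alone. No error
  terms are tracked. Each limit is taken along arbitrary sequences \<open>N n\<close> and
  \<open>p n\<close>, and compactness turns it into uniform two-sided bounds. These suffice: a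
  factor bounded above and below changes the exponent by \<open>O(1)\<close>, which is of lower
  order than \<open>N\<close> times the saddle value. The square \<open>p\<close> is used because
  the saddle point is a two-valued function of \<open>\<beta>\<close>, while \<open>p\<close> is
  single valued and about \<open>3 * (\<beta> - 1)\<close>. The direction
  \<open>arg p = \<pi> / 4\<close> is critical because there the real part of
  \<open>- p^2 / 12\<close> vanishes, so that the origin, where \<open>h = 0\<close>, and the saddle
  point balance. Contours are moved by means of an antiderivative: for fixed \<open>\<beta>\<close>
  the integrand has an explicit entire one, a finite sum of shifted error functions. A contour
  integral is then a difference of two values, and only the ray to infinity requires a
  limit.\<close>

definition gauss_prim :: "complex \<Rightarrow> complex" where
  "gauss_prim = (SOME F. (\<forall>z. (F has_field_derivative exp (- z\<^sup>2)) (at z)) \<and> F 0 = 0)"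

lemma gauss_prim_deriv: "(gauss_prim has_field_derivative exp (- z\<^sup>2)) (at z)"
  and gauss_prim_0 [simp]: "gauss_prim 0 = 0"
proof -
  have "(\<lambda>z::complex. exp (- z\<^sup>2)) holomorphic_on UNIV"
    by (intro holomorphic_intros)
  then obtain F where F: "\<And>z::complex. (F has_field_derivative exp (- z\<^sup>2)) (at z)"
    using holomorphic_convex_primitive'[OF convex_UNIV open_UNIV] by (metis UNIV_I)
  have "\<exists>F. (\<forall>z::complex. (F has_field_derivative exp (- z\<^sup>2)) (at z)) \<and> F 0 = (0::complex)"
    by (rule exI[of _ "\<lambda>z. F z - F 0"]) (auto intro!: derivative_eq_intros F)
  from someI_ex[OF this]
  show "(gauss_prim has_field_derivative exp (- z\<^sup>2)) (at z)" "gauss_prim 0 = 0"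
    unfolding gauss_prim_def by blast+
qed

lemma gauss_prim_chain [derivative_intros]:
  "(g has_field_derivative g') (at z within S) \<Longrightarrow>
     ((\<lambda>z. gauss_prim (g z)) has_field_derivative exp (- (g z)\<^sup>2) * g') (at z within S)"
  by (rule DERIV_chain2[OF gauss_prim_deriv])

lemma gauss_prim_minus [simp]: "gauss_prim (- z) = - gauss_prim z"
proof -
  have "((\<lambda>z. gauss_prim z + gauss_prim (- z)) has_field_derivative 0) (at z within UNIV)" for z
    by (auto intro!: derivative_eq_intros)
  then obtain c where "\<And>z. gauss_prim z + gauss_prim (- z) = c"
    using has_field_derivative_zero_constant[OF convex_UNIV] by (metis UNIV_I)
  from this[of 0] this[of z] show ?thesis by (simp add: eq_neg_iff_add_eq_0 add.commute)
qed

lemma gauss_prim_holomorphic [holomorphic_intros]: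
  "f holomorphic_on S \<Longrightarrow> (\<lambda>z. gauss_prim (f z)) holomorphic_on S"
proof -
  have "gauss_prim holomorphic_on UNIV"
    using gauss_prim_deriv by (auto simp: holomorphic_on_def field_differentiable_def)
  then show "f holomorphic_on S \<Longrightarrow> (\<lambda>z. gauss_prim (f z)) holomorphic_on S"
    using holomorphic_on_compose_gen[of f S gauss_prim UNIV] by (simp add: o_def)
qed

lemma gauss_prim_real_limit:
  "((\<lambda>x. gauss_prim (of_real x)) \<longlongrightarrow> of_real (sqrt pi / 2)) at_top"
proof -
  let ?g = "\<lambda>x::real. indicator {0..} x *\<^sub>R exp (- x\<^sup>2)"
  have int: "integrable lborel ?g" and val: "(\<integral>x. ?g x \<partial>lborel) = sqrt pi / 2"
    using gaussian_moment_0 unfolding has_bochner_integral_iff by blast+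
  have "((\<lambda>y. \<integral>x. indicator {..y} x *\<^sub>R ?g x \<partial>lborel) \<longlongrightarrow> sqrt pi / 2) at_top"
    unfolding val[symmetric] by (rule tendsto_integral_at_top[OF _ int]) simp
  moreover have "gauss_prim (of_real y) = of_real (\<integral>x. indicator {..y} x *\<^sub>R ?g x \<partial>lborel)" if "y > 0" for y
  proof -
    have "((\<lambda>x. gauss_prim (of_real x)) has_vector_derivative of_real (exp (- x\<^sup>2))) (at x within S)" for x S
    proof -
      have "((\<lambda>x. gauss_prim (of_real x)) has_vector_derivative exp (- (of_real x)\<^sup>2)) (at x within S)"
        by (rule has_vector_derivative_real_field[OF gauss_prim_deriv])
      then show ?thesis by (simp add: exp_of_real[symmetric])
    qed
    then have "(\<integral>x. indicator {0..y} x *\<^sub>R complex_of_real (exp (- x\<^sup>2)) \<partial>lborel)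
        = gauss_prim (of_real y) - gauss_prim (of_real 0)"
      using that by (intro integral_FTC_atLeastAtMost) (auto intro!: continuous_intros)
    also have "(\<integral>x. indicator {0..y} x *\<^sub>R complex_of_real (exp (- x\<^sup>2)) \<partial>lborel)
      = (\<integral>x. complex_of_real (indicator {..y} x *\<^sub>R ?g x) \<partial>lborel)"
      by (intro Bochner_Integration.integral_cong) (auto simp: indicator_def)
    also have "\<dots> = of_real (\<integral>x. indicator {..y} x *\<^sub>R ?g x \<partial>lborel)"
      by (rule integral_complex_of_real)
    finally show ?thesis by simp
  qed
  ultimately show ?thesis
    by (intro Lim_transform_eventually[OF tendsto_of_real])
      (auto intro!: eventually_mono[OF eventually_gt_at_top[of 0]])
qed

text \<open>\<open>Re (z^2)\<close> factors as \<open>(Re z - |Im z|) * (Re z + |Im z|)\<close>, and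
  both factors are at least \<open>d\<close>, the depth of \<open>z\<close> in the cone of
  half-angle \<open>pi / 4\<close>.\<close>

lemma norm_exp_minus_square_le:
  assumes "\<bar>Im z\<bar> + d \<le> Re z" "0 \<le> d"
  shows "norm (exp (- z\<^sup>2)) \<le> exp (- d\<^sup>2)"
proof -
  have "d * d \<le> (Re z - \<bar>Im z\<bar>) * (Re z + \<bar>Im z\<bar>)"
    using assms by (intro mult_mono) auto
  then have "d\<^sup>2 \<le> Re (z\<^sup>2)"
    by (simp add: power2_eq_square algebra_simps)
  then show ?thesis by simp
qed

text \<open>The error function has the same limit along every ray in the open cone: the segment from
  \<open>x\<close> to \<open>r * x - b\<close> has length linear in \<open>x\<close>, but the
  derivative on it is Gaussian small.\<close>

lemma gauss_prim_limit:
  assumes r: "0 < Re r" "\<bar>Im r\<bar> < Re r"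
  shows "((\<lambda>x. gauss_prim (r * of_real x - b)) \<longlongrightarrow> of_real (sqrt pi / 2)) at_top"
proof -
  \<comment> \<open>Points of the segment from \<open>x\<close> to \<open>r * x\<close> are mixtures
    of \<open>x\<close>, of depth \<open>x\<close> in the cone, and \<open>r * x\<close>, of depth
    \<open>(Re r - |Im r|) * x\<close>; \<open>m * x\<close> is below both. The shift by
    \<open>b\<close> costs at most \<open>2 * norm b\<close>.\<close>
  define m where "m = min 1 (Re r - \<bar>Im r\<bar>)"
  have m: "m > 0" "m \<le> 1" "m \<le> Re r - \<bar>Im r\<bar>" using r by (auto simp: m_def)
  define e where "e = (\<lambda>x::real. norm ((r - 1) * of_real x - b) * exp (- (m * x - 2 * norm b)\<^sup>2))"
  have est: "norm (gauss_prim (r * of_real x - b) - gauss_prim (of_real x)) \<le> e x"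
    if x: "x \<ge> 2 * norm b / m" "x > 0" for x
  proof -
    have d: "0 \<le> m * x - 2 * norm b" using x m by (simp add: field_simps)
    have "norm (gauss_prim (r * of_real x - b) - gauss_prim (of_real x))
        \<le> exp (- (m * x - 2 * norm b)\<^sup>2) * norm ((r * of_real x - b) - of_real x)"
    proof (rule field_differentiable_bound[of "closed_segment (of_real x) (r * of_real x - b)" gauss_prim "\<lambda>z. exp (- z\<^sup>2)"])
      fix z assume "z \<in> closed_segment (complex_of_real x) (r * of_real x - b)"
      then obtain t where t: "0 \<le> t" "t \<le> 1" "z = of_real x + of_real t * (r * of_real x - b - of_real x)"
        by (auto simp: in_segment scaleR_conv_of_real algebra_simps)
      have b: "\<bar>Re b\<bar> \<le> norm b" "\<bar>Im b\<bar> \<le> norm b"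
        by (auto simp: abs_Re_le_cmod abs_Im_le_cmod)
      have "\<bar>t * Re b\<bar> \<le> norm b" "\<bar>t * Im b\<bar> \<le> norm b"
        using t b by (auto simp: abs_mult intro: order_trans[OF mult_left_le_one_le])
      moreover have "Re z = x * (1 - t) + x * t * Re r - t * Re b"
        unfolding t(3) by (simp add: algebra_simps)
      moreover have "Im z = x * t * Im r - t * Im b"
        unfolding t(3) by (simp add: algebra_simps)
      moreover have "m * x \<le> x * (1 - t) + x * t * Re r - \<bar>x * t * Im r\<bar>"
      proof -
        have "m * (x * (1 - t)) \<le> 1 * (x * (1 - t))" "m * (x * t) \<le> (Re r - \<bar>Im r\<bar>) * (x * t)"
          using m x t by (intro mult_right_mono; simp)+
        then show ?thesis using x t by (simp add: abs_mult algebra_simps)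
      qed
      ultimately have "\<bar>Im z\<bar> + (m * x - 2 * norm b) \<le> Re z"
        by linarith
      then show "norm (exp (- z\<^sup>2)) \<le> exp (- (m * x - 2 * norm b)\<^sup>2)"
        using d by (rule norm_exp_minus_square_le)
    qed (auto intro: has_field_derivative_at_within gauss_prim_deriv)
    then show ?thesis by (simp add: e_def algebra_simps)
  qed
  have "(e \<longlongrightarrow> 0) at_top"
  proof (rule Lim_null_comparison[of _ "\<lambda>x. (norm (r - 1) * x + norm b) * exp (- (m * x - 2 * norm b)\<^sup>2)"])
    show "\<forall>\<^sub>F x in at_top. norm (e x) \<le> (norm (r - 1) * x + norm b) * exp (- (m * x - 2 * norm b)\<^sup>2)"
    proof (intro eventually_mono[OF eventually_gt_at_top[of 0]])
      fix x :: real assume "0 < x"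
      then have "norm ((r - 1) * of_real x - b) \<le> norm (r - 1) * x + norm b"
        by (intro order_trans[OF norm_triangle_ineq4]) (simp add: norm_mult)
      then show "norm (e x) \<le> (norm (r - 1) * x + norm b) * exp (- (m * x - 2 * norm b)\<^sup>2)"
        by (auto simp: e_def intro!: mult_right_mono)
    qed
    define q where "q = norm b" define k where "k = norm (r - 1)"
    have "k \<ge> 0" by (simp add: k_def)
    show "((\<lambda>x. (norm (r - 1) * x + norm b) * exp (- (m * x - 2 * norm b)\<^sup>2)) \<longlongrightarrow> 0) at_top"
      using m(1) unfolding q_def[symmetric] k_def[symmetric] by real_asymp
  qed
  moreover have "\<forall>\<^sub>F x in at_top. norm (gauss_prim (r * of_real x - b) - gauss_prim (of_real x)) \<le> e x"
    by (rule eventually_mono[OF eventually_conj[OF eventually_ge_at_top[of "2 * norm b / m"] eventually_gt_at_top[of 0]]])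
      (use est in auto)
  ultimately have "((\<lambda>x. gauss_prim (r * of_real x - b) - gauss_prim (of_real x)) \<longlongrightarrow> 0) at_top"
    by (rule Lim_null_comparison[rotated])
  from tendsto_add[OF this gauss_prim_real_limit] show ?thesis by simp
qed

text \<open>The parameter is the root \<open>r\<close> and not its square, so that
  \<open>0 < Re r\<close> selects the branch in the value. Truncated integrals are values of
  \<open>gauss_prim (r * y) / r\<close>, whose limit is known in the cone.\<close>

lemma complex_half_gaussian_integral:
  assumes "0 < Re r" "0 < Re (r\<^sup>2)"
  shows "(\<integral>s. indicator {0..} s *\<^sub>R exp (- r\<^sup>2 * (of_real s)\<^sup>2) \<partial>lborel) = of_real (sqrt pi) / (2 * r)"
proof -
  have r: "\<bar>Im r\<bar> < Re r" "r \<noteq> 0"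
  proof -
    have "\<bar>Im r\<bar>\<^sup>2 < (Re r)\<^sup>2" using assms(2) by (simp add: power2_eq_square)
    then show "\<bar>Im r\<bar> < Re r" using assms(1) by (intro power_less_imp_less_base[of "\<bar>Im r\<bar>" 2]) auto
    show "r \<noteq> 0" using assms by auto
  qed
  let ?g = "\<lambda>s. indicator {0..} s *\<^sub>R exp (- r\<^sup>2 * (of_real s)\<^sup>2)"
  have int: "integrable lborel ?g"
  proof (rule Bochner_Integration.integrable_bound)
    define c where "c = sqrt (Re (r\<^sup>2))"
    have c: "c > 0" "c\<^sup>2 = Re (r\<^sup>2)" using assms by (auto simp: c_def)
    have "integrable lborel (\<lambda>x::real. indicator {0..} (0 + c * x) *\<^sub>R exp (- (0 + c * x)\<^sup>2))"
      using gaussian_moment_0 c(1) by (intro lborel_integrable_real_affine) (auto simp: has_bochner_integral_iff)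
    then show "integrable lborel (\<lambda>x::real. indicator {0..} x *\<^sub>R exp (- Re (r\<^sup>2) * x\<^sup>2))"
      by (rule Bochner_Integration.integrable_cong[THEN iffD1, rotated -1])
        (use c in \<open>auto simp: indicator_def power_mult_distrib zero_le_mult_iff\<close>)
    show "?g \<in> borel_measurable lborel" by measurable
    show "AE s in lborel. norm (?g s) \<le> norm (indicator {0..} s *\<^sub>R exp (- Re (r\<^sup>2) * s\<^sup>2))"
      by (auto simp: indicator_def simp flip: of_real_power)
  qed
  have "((\<lambda>y. \<integral>s. indicator {..y} s *\<^sub>R ?g s \<partial>lborel) \<longlongrightarrow> (\<integral>s. ?g s \<partial>lborel)) at_top"
    by (rule tendsto_integral_at_top[OF _ int]) simp
  moreover have "((\<lambda>y. \<integral>s. indicator {..y} s *\<^sub>R ?g s \<partial>lborel) \<longlongrightarrow> of_real (sqrt pi / 2) / r) at_top"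
  proof (rule Lim_transform_eventually)
    show "((\<lambda>y. gauss_prim (r * of_real y - 0) / r) \<longlongrightarrow> of_real (sqrt pi / 2) / r) at_top"
      by (intro tendsto_divide gauss_prim_limit assms r tendsto_const)
    have "(\<integral>s. indicator {..y} s *\<^sub>R ?g s \<partial>lborel) = gauss_prim (r * of_real y) / r" if "y > 0" for y
    proof -
      have "((\<lambda>x. gauss_prim (r * of_real x) / r) has_vector_derivative exp (- r\<^sup>2 * (of_real x)\<^sup>2)) (at x within S)" for x S
      proof -
        have "((\<lambda>z. gauss_prim (r * z) / r) has_field_derivative exp (- (r * of_real x)\<^sup>2)) (at (of_real x))"
          using r by (auto intro!: derivative_eq_intros)
        then have "((\<lambda>x. gauss_prim (r * of_real x) / r) has_vector_derivative exp (- (r * of_real x)\<^sup>2)) (at x within S)"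
          by (rule has_vector_derivative_real_field)
        then show ?thesis by (simp add: power_mult_distrib)
      qed
      then have "(\<integral>x. indicator {0..y} x *\<^sub>R exp (- r\<^sup>2 * (of_real x)\<^sup>2) \<partial>lborel)
          = gauss_prim (r * of_real y) / r - gauss_prim (r * of_real 0) / r"
        using that by (intro integral_FTC_atLeastAtMost) (auto intro!: continuous_intros)
      also have "(\<integral>x. indicator {0..y} x *\<^sub>R exp (- r\<^sup>2 * (of_real x)\<^sup>2) \<partial>lborel)
        = (\<integral>s. indicator {..y} s *\<^sub>R ?g s \<partial>lborel)"
        by (intro Bochner_Integration.integral_cong) (auto simp: indicator_def)
      finally show ?thesis by simp
    qed
    then show "\<forall>\<^sub>F y in at_top. gauss_prim (r * of_real y - 0) / r = (\<integral>s. indicator {..y} s *\<^sub>R ?g s \<partial>lborel)"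
      by (intro eventually_mono[OF eventually_gt_at_top[of 0]]) auto
  qed
  ultimately have "(\<integral>s. ?g s \<partial>lborel) = of_real (sqrt pi / 2) / r"
    by (rule tendsto_unique[rotated]) simp
  then show ?thesis by simp
qed

section \<open>Partition function as a contour integral\<close>

abbreviation spins :: "nat \<Rightarrow> (nat \<Rightarrow> real) set" where
  "spins N \<equiv> {1..N} \<rightarrow>\<^sub>E {-1, 1}"

definition magnetization :: "nat \<Rightarrow> (nat \<Rightarrow> real) \<Rightarrow> real" where
  "magnetization N \<sigma> = (\<Sum>i\<in>{1..N}. \<sigma> i)"

lemma hamiltonian_eq: "hamiltonian N \<sigma> = - (magnetization N \<sigma>)\<^sup>2 / (2 * real N)"
  by (simp add: hamiltonian_def magnetization_def power2_eq_square sum_product)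

lemma partition_function_eq:
  "partition_function \<beta> N =
     1 / 2 ^ N * (\<Sum>\<sigma>\<in>spins N. exp (\<beta> * of_real ((magnetization N \<sigma>)\<^sup>2 / (2 * real N))))"
  by (simp add: partition_function_def hamiltonian_eq)

lemma finite_spins [simp]: "finite (spins N)"
  by (intro finite_PiE) auto

lemma sum_exp_magnetization:
  fixes u :: complex
  shows "(\<Sum>\<sigma>\<in>spins N. exp (u * of_real (magnetization N \<sigma>))) = (2 * cosh u) ^ N"
proof -
  have "(2 * cosh u) ^ N = (\<Prod>i\<in>{1..N}. \<Sum>s\<in>{-1, 1::real}. exp (u * of_real s))"
  proof -
    have "2 * cosh u = exp u + exp (- u)" by (simp add: cosh_field_def)
    then show ?thesis by (simp add: add.commute)
  qed
  also have "\<dots> = (\<Sum>\<sigma>\<in>spins N. \<Prod>i\<in>{1..N}. exp (u * of_real (\<sigma> i)))"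
    by (rule prod_sum_PiE) auto
  also have "\<dots> = (\<Sum>\<sigma>\<in>spins N. exp (u * of_real (magnetization N \<sigma>)))"
    by (simp add: magnetization_def sum_distrib_left exp_sum)
  finally show ?thesis by simp
qed

text \<open>This is \<open>exp (- N * h \<beta> u)\<close> on the slit plane; written with a power
  of \<open>cosh\<close> it is entire in \<open>u\<close> and involves no branch of the
  logarithm.\<close>

definition boltzmann :: "nat \<Rightarrow> complex \<Rightarrow> complex \<Rightarrow> complex" where
  "boltzmann N \<beta> u = exp (- of_nat N * u\<^sup>2 / (2 * \<beta>)) * cosh u ^ N"

definition gauss_rate :: "nat \<Rightarrow> complex \<Rightarrow> complex" where
  "gauss_rate N \<beta> = csqrt (of_nat N / (2 * \<beta>))"

text \<open>Expanding \<open>cosh u ^ N\<close> over the spins leaves Gaussians, whose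
  antiderivatives are shifted error functions. Both signs of \<open>m\<close> occur so that the sum
  is odd in \<open>u\<close> and vanishes at \<open>0\<close>.\<close>

definition boltzmann_prim :: "nat \<Rightarrow> complex \<Rightarrow> complex \<Rightarrow> complex" where
  "boltzmann_prim N \<beta> u = 1 / 2 ^ N * (\<Sum>\<sigma>\<in>spins N.
     let r = gauss_rate N \<beta>; m = of_real (magnetization N \<sigma>) in
     exp (\<beta> * m\<^sup>2 / (2 * of_nat N)) / (2 * r) * (gauss_prim (r * u - m / (2 * r)) + gauss_prim (r * u + m / (2 * r))))"

text \<open>The integral of \<open>boltzmann\<close> over the positive half line, in the closed form
  that \<open>boltzmann_prim_limit\<close> justifies. The prefactor does not vanish, so its zeros
  are those of the partition function.\<close>

definition boltzmann_total :: "nat \<Rightarrow> complex \<Rightarrow> complex" where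
  "boltzmann_total N \<beta> = of_real (sqrt pi) / (2 * gauss_rate N \<beta>) * partition_function \<beta> N"

lemma gauss_rate_nz: "\<beta> \<noteq> 0 \<Longrightarrow> N > 0 \<Longrightarrow> gauss_rate N \<beta> \<noteq> 0"
  by (simp add: gauss_rate_def)

lemma gauss_rate_square: "(gauss_rate N \<beta>)\<^sup>2 = of_nat N / (2 * \<beta>)"
  by (simp add: gauss_rate_def)

lemma Re_inverse_pos: "0 < Re z \<Longrightarrow> 0 < Re (1 / z)" for z :: complex
  by (auto simp: Re_divide complex_eq_iff power2_eq_square intro!: divide_pos_pos add_pos_nonneg)

lemma Re_of_nat_divide_pos:
  assumes "0 < Re \<beta>" "N > 0"
  shows "0 < Re (of_nat N / (2 * \<beta>))"
proof -
  have "of_nat N / (2 * \<beta>) = of_real (real N / 2) * (1 / \<beta>)" by simp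
  then have e: "Re (of_nat N / (2 * \<beta>)) = real N / 2 * Re (1 / \<beta>)"
    by (simp only: Re_complex_of_real Im_complex_of_real times_complex.simps)
  show ?thesis unfolding e using Re_inverse_pos[OF assms(1)] assms(2) by simp
qed

text \<open>The principal root of a number in the right half plane has argument below
  \<open>pi / 4\<close> in absolute value; this is the cone required by
  \<open>gauss_prim_limit\<close>.\<close>

lemma gauss_rate_cone:
  assumes "0 < Re \<beta>" "N > 0"
  shows "0 < Re (gauss_rate N \<beta>)" "\<bar>Im (gauss_rate N \<beta>)\<bar> < Re (gauss_rate N \<beta>)"
proof -
  have p: "0 < Re ((gauss_rate N \<beta>)\<^sup>2)"
    using Re_of_nat_divide_pos[OF assms] by (simp add: gauss_rate_square)
  then have sq: "\<bar>Im (gauss_rate N \<beta>)\<bar>\<^sup>2 < (Re (gauss_rate N \<beta>))\<^sup>2"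
    by (simp add: power2_eq_square)
  have "0 \<le> Re (gauss_rate N \<beta>)"
    using csqrt_principal[of "of_nat N / (2 * \<beta>)"] by (auto simp: gauss_rate_def)
  moreover from this show "\<bar>Im (gauss_rate N \<beta>)\<bar> < Re (gauss_rate N \<beta>)"
    using sq by (rule power_less_imp_less_base[rotated])
  ultimately show "0 < Re (gauss_rate N \<beta>)" by linarith
qed

lemma boltzmann_total_eq_0_iff:
  assumes "\<beta> \<noteq> 0" "N > 0"
  shows "boltzmann_total N \<beta> = 0 \<longleftrightarrow> partition_function \<beta> N = 0"
  using assms by (simp add: boltzmann_total_def gauss_rate_nz)

text \<open>Completing the square in each Gaussian isolates a factor \<open>exp (u * m)\<close>,
  whose sum over the spins is \<open>(2 * cosh u) ^ N\<close>; the other sign of \<open>m\<close>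
  gives the same sum at \<open>- u\<close>.\<close>

lemma boltzmann_prim_deriv:
  assumes "\<beta> \<noteq> 0" "N > 0"
  shows "(boltzmann_prim N \<beta> has_field_derivative boltzmann N \<beta> u) (at u within S)"
proof -
  define r where "r = gauss_rate N \<beta>"
  have r: "r \<noteq> 0" "r\<^sup>2 = of_nat N / (2 * \<beta>)"
    using assms by (simp_all add: r_def gauss_rate_nz gauss_rate_square)
  have sq: "exp (\<beta> * m\<^sup>2 / (2 * of_nat N)) * exp (- (r * u - m / (2 * r))\<^sup>2) = exp (- of_nat N * u\<^sup>2 / (2 * \<beta>)) * exp (u * m)"
    for m :: complex
  proof -
    have e1: "(m / (2 * r))\<^sup>2 = \<beta> * m\<^sup>2 / (2 * of_nat N)"
      using assms by (simp add: power_divide power_mult_distrib r(2))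
    have e2: "2 * (r * u) * (m / (2 * r)) = u * m"
      using r(1) by simp
    have "(r * u - m / (2 * r))\<^sup>2 = of_nat N * u\<^sup>2 / (2 * \<beta>) + \<beta> * m\<^sup>2 / (2 * of_nat N) - u * m"
      unfolding power2_diff e1 e2 power_mult_distrib r(2) by simp
    then show ?thesis unfolding exp_add[symmetric] by (simp only:) (simp add: algebra_simps)
  qed
  have sq': "exp (\<beta> * m\<^sup>2 / (2 * of_nat N)) * exp (- (r * u + m / (2 * r))\<^sup>2) = exp (- of_nat N * u\<^sup>2 / (2 * \<beta>)) * exp ((- u) * m)"
    for m :: complex
    using sq[of "- m"] by simp
  have pull: "X / (2 * r) * (A * r + B * r) = (X * A + X * B) / 2" for X A B
    using r(1) by (simp add: field_simps)
  have "(boltzmann_prim N \<beta> has_field_derivative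
     1 / 2 ^ N * (\<Sum>\<sigma>\<in>spins N. let m = of_real (magnetization N \<sigma>) in
        exp (\<beta> * m\<^sup>2 / (2 * of_nat N)) / (2 * r) * (exp (- (r * u - m / (2 * r))\<^sup>2) * r + exp (- (r * u + m / (2 * r))\<^sup>2) * r))) (at u within S)"
    unfolding boltzmann_prim_def r_def[symmetric] Let_def
    by (intro derivative_intros DERIV_cmult DERIV_sum) (auto intro!: derivative_eq_intros)
  also have "1 / 2 ^ N * (\<Sum>\<sigma>\<in>spins N. let m = of_real (magnetization N \<sigma>) in
        exp (\<beta> * m\<^sup>2 / (2 * of_nat N)) / (2 * r) * (exp (- (r * u - m / (2 * r))\<^sup>2) * r + exp (- (r * u + m / (2 * r))\<^sup>2) * r))
    = 1 / 2 ^ N * (\<Sum>\<sigma>\<in>spins N. let m = of_real (magnetization N \<sigma>) in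
        exp (- of_nat N * u\<^sup>2 / (2 * \<beta>)) / 2 * (exp (u * m) + exp ((- u) * m)))"
    unfolding Let_def pull sq sq' by (simp add: distrib_left add_divide_distrib)
  also have "\<dots> = 1 / 2 ^ N * (exp (- of_nat N * u\<^sup>2 / (2 * \<beta>)) / 2 * ((2 * cosh u) ^ N + (2 * cosh (- u)) ^ N))"
    unfolding Let_def sum_distrib_left[symmetric] sum.distrib sum_exp_magnetization ..
  also have "\<dots> = boltzmann N \<beta> u"
    by (simp add: boltzmann_def power_mult_distrib)
  finally show ?thesis .
qed

lemma boltzmann_prim_0 [simp]: "boltzmann_prim N \<beta> 0 = 0"
  by (simp add: boltzmann_prim_def Let_def)

text \<open>Every error function tends to the same value whatever its shift, so the remaining sum
  over the spins is the partition function. This is the Hubbard--Stratonovich identity for complex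
  \<open>\<beta>\<close> in the right half plane.\<close>

lemma boltzmann_prim_limit:
  assumes "0 < Re \<beta>" "N > 0"
  shows "((\<lambda>x. boltzmann_prim N \<beta> (of_real x)) \<longlongrightarrow> boltzmann_total N \<beta>) at_top"
proof -
  define r where "r = gauss_rate N \<beta>"
  note r = gauss_rate_cone[OF assms, folded r_def]
  have "((\<lambda>x. boltzmann_prim N \<beta> (of_real x)) \<longlongrightarrow>
     1 / 2 ^ N * (\<Sum>\<sigma>\<in>spins N. let m = of_real (magnetization N \<sigma>) in
        exp (\<beta> * m\<^sup>2 / (2 * of_nat N)) / (2 * r) * (of_real (sqrt pi / 2) + of_real (sqrt pi / 2)))) at_top"
    unfolding boltzmann_prim_def Let_def r_def[symmetric]
    using gauss_prim_limit[OF r] gauss_prim_limit[OF r, of "- _"]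
    by (intro tendsto_intros) (simp_all add: )
  also have "1 / 2 ^ N * (\<Sum>\<sigma>\<in>spins N. let m = of_real (magnetization N \<sigma>) in
        exp (\<beta> * m\<^sup>2 / (2 * of_nat N)) / (2 * r) * (of_real (sqrt pi / 2) + of_real (sqrt pi / 2)))
     = boltzmann_total N \<beta>"
    unfolding Let_def sum_distrib_right[symmetric] sum_divide_distrib[symmetric] boltzmann_total_def partition_function_eq r_def
    by (simp add: field_simps)
  finally show ?thesis .
qed

lemma boltzmann_prim_holomorphic:
  assumes "b holomorphic_on S" "g holomorphic_on S" "\<And>z. z \<in> S \<Longrightarrow> 0 < Re (b z)" "N > 0"
  shows "(\<lambda>z. boltzmann_prim N (b z) (g z)) holomorphic_on S"
    and "(\<lambda>z. boltzmann_total N (b z)) holomorphic_on S"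
proof -
  have nz: "b z \<noteq> 0" "gauss_rate N (b z) \<noteq> 0" if "z \<in> S" for z
    using assms(3)[OF that] assms(4) by (auto simp: gauss_rate_def)
  have pos: "of_nat N / (2 * b z) \<notin> \<real>\<^sub>\<le>\<^sub>0" if "z \<in> S" for z
    using Re_of_nat_divide_pos[OF assms(3)[OF that] assms(4)] unfolding complex_nonpos_Reals_iff by linarith
  have r: "(\<lambda>z. gauss_rate N (b z)) holomorphic_on S"
    unfolding gauss_rate_def using nz pos by (intro holomorphic_intros assms) auto
  show "(\<lambda>z. boltzmann_prim N (b z) (g z)) holomorphic_on S"
    unfolding boltzmann_prim_def Let_def using nz assms(4) by (intro holomorphic_intros assms r) auto
  show "(\<lambda>z. boltzmann_total N (b z)) holomorphic_on S"
    unfolding boltzmann_total_def partition_function_eq using nz by (intro holomorphic_intros assms r) auto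
qed

section \<open>Holomorphy, positivity, symmetry and growth of the partition function\<close>

lemma partition_function_holomorphic: "(\<lambda>\<beta>. partition_function \<beta> N) holomorphic_on S"
  unfolding partition_function_eq by (intro holomorphic_intros)

lemma partition_function_real_pos:
  assumes "Im \<beta> = 0"
  shows "partition_function \<beta> N \<noteq> 0"
proof -
  have b: "\<beta> = of_real (Re \<beta>)" using assms by (simp add: complex_eq_iff)
  have "spins N \<noteq> {}" by (simp add: PiE_eq_empty_iff)
  then have "0 < (\<Sum>\<sigma>\<in>spins N. exp (Re \<beta> * ((magnetization N \<sigma>)\<^sup>2 / (2 * real N))))"
    by (intro sum_pos finite_spins) auto
  moreover have "(\<Sum>\<sigma>\<in>spins N. exp (\<beta> * of_real ((magnetization N \<sigma>)\<^sup>2 / (2 * real N))))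
    = of_real (\<Sum>\<sigma>\<in>spins N. exp (Re \<beta> * ((magnetization N \<sigma>)\<^sup>2 / (2 * real N))))"
    by (subst b) (simp flip: exp_of_real)
  ultimately show ?thesis unfolding partition_function_eq by (simp del: of_real_sum)
qed

lemma partition_function_cnj: "partition_function (cnj \<beta>) N = cnj (partition_function \<beta> N)"
  unfolding partition_function_eq by (simp add: exp_cnj)

lemma magnetization_bound: "\<sigma> \<in> spins N \<Longrightarrow> (magnetization N \<sigma>)\<^sup>2 \<le> (real N)\<^sup>2"
proof -
  assume "\<sigma> \<in> spins N"
  then have "\<bar>\<sigma> i\<bar> \<le> 1" if "i \<in> {1..N}" for i
    using that by (auto dest: PiE_mem)
  then have "\<bar>magnetization N \<sigma>\<bar> \<le> (\<Sum>i\<in>{1..N}. 1)"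
    unfolding magnetization_def by (intro order_trans[OF sum_abs] sum_mono) auto
  then show ?thesis using abs_le_square_iff[of "magnetization N \<sigma>" "real N"] by simp
qed

text \<open>Moving \<open>\<beta>\<close> by \<open>d\<close> raises the real part of each exponent
  by at most \<open>d * N / 2\<close>, because the energy is at least \<open>- N / 2\<close>. At
  \<open>\<beta> = 1\<close> all terms are positive, so the sum of their norms is the norm of the
  sum. This is the growth rate in Jensen's inequality.\<close>

lemma norm_partition_function_le:
  assumes "norm (\<beta> - 1) \<le> d" "0 \<le> d"
  shows "norm (partition_function \<beta> N) \<le> exp (d * real N / 2) * norm (partition_function 1 N)"
proof -
  let ?e = "\<lambda>\<sigma>. (magnetization N \<sigma>)\<^sup>2 / (2 * real N)"
  have le: "?e \<sigma> \<le> real N / 2" if "\<sigma> \<in> spins N" for \<sigma>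
    using magnetization_bound[OF that] by (cases "N = 0") (auto simp: field_simps power2_eq_square)
  have "norm (\<Sum>\<sigma>\<in>spins N. exp (\<beta> * of_real (?e \<sigma>))) \<le> (\<Sum>\<sigma>\<in>spins N. exp (d * real N / 2) * exp (?e \<sigma>))"
  proof (intro sum_norm_le)
    fix \<sigma> assume s: "\<sigma> \<in> spins N"
    have "Re \<beta> \<le> 1 + d"
      using assms complex_Re_le_cmod[of "\<beta> - 1"] by simp
    then have "Re \<beta> * ?e \<sigma> \<le> (1 + d) * ?e \<sigma>" by (intro mult_right_mono) auto
    also have "\<dots> \<le> ?e \<sigma> + d * (real N / 2)"
      using mult_left_mono[OF le[OF s] assms(2)] distrib_right[of 1 d "?e \<sigma>"] by linarith
    finally show "norm (exp (\<beta> * of_real (?e \<sigma>))) \<le> exp (d * real N / 2) * exp (?e \<sigma>)"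
      by (simp add: exp_add[symmetric])
  qed
  also have "\<dots> = exp (d * real N / 2) * norm (\<Sum>\<sigma>\<in>spins N. exp (1 * complex_of_real (?e \<sigma>)))"
  proof -
    have "(\<Sum>\<sigma>\<in>spins N. exp (1 * complex_of_real (?e \<sigma>))) = of_real (\<Sum>\<sigma>\<in>spins N. exp (?e \<sigma>))"
      by (simp flip: exp_of_real)
    then show ?thesis by (simp add: sum_distrib_left sum_nonneg del: of_real_sum)
  qed
  finally show ?thesis
    unfolding partition_function_eq by (simp add: norm_mult norm_divide norm_power divide_right_mono)
qed

section \<open>Saddle point coordinate\<close>

definition cosh_sqrt_coeff :: "nat \<Rightarrow> complex" where
  "cosh_sqrt_coeff n = 1 / fact (2 * n)"

text \<open>The entire function \<open>cosh (sqrt z)\<close>; a power series in \<open>z\<close>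
  avoids choosing a branch of the root.\<close>

definition cosh_sqrt :: "complex \<Rightarrow> complex" where
  "cosh_sqrt z = (\<Sum>n. cosh_sqrt_coeff n * z ^ n)"

definition cosh_sqrt' :: "complex \<Rightarrow> complex" where
  "cosh_sqrt' z = (\<Sum>n. diffs cosh_sqrt_coeff n * z ^ n)"

definition cosh_sqrt'' :: "complex \<Rightarrow> complex" where
  "cosh_sqrt'' z = (\<Sum>n. diffs (diffs cosh_sqrt_coeff) n * z ^ n)"

lemma summable_cosh_sqrt: "summable (\<lambda>n. cosh_sqrt_coeff n * z ^ n)"
proof (rule summable_comparison_test)
  show "summable (\<lambda>n. norm z ^ n /\<^sub>R fact n)" by (rule summable_exp_generic)
  show "\<exists>N. \<forall>n\<ge>N. norm (cosh_sqrt_coeff n * z ^ n) \<le> norm z ^ n /\<^sub>R fact n"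
  proof (intro exI allI impI)
    fix n :: nat
    have "(fact n :: real) \<le> fact (2 * n)" by (rule fact_mono) auto
    then show "norm (cosh_sqrt_coeff n * z ^ n) \<le> norm z ^ n /\<^sub>R fact n"
      using mult_right_mono[of "fact n" "fact (2 * n) :: real" "norm z ^ n"]
      by (simp add: cosh_sqrt_coeff_def norm_mult norm_divide norm_power field_simps)
  qed
qed

lemma cosh_sqrt_deriv: "(cosh_sqrt has_field_derivative cosh_sqrt' z) (at z)"
  unfolding cosh_sqrt_def[abs_def] cosh_sqrt'_def
  by (rule termdiffs_strong_converges_everywhere[OF summable_cosh_sqrt])

lemma cosh_sqrt'_deriv: "(cosh_sqrt' has_field_derivative cosh_sqrt'' z) (at z)"
  unfolding cosh_sqrt'_def[abs_def] cosh_sqrt''_def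
  by (rule termdiffs_strong_converges_everywhere[OF termdiff_converges_all[OF summable_cosh_sqrt]])

lemma cosh_sqrt''_holomorphic: "cosh_sqrt'' holomorphic_on S"
proof -
  have "cosh_sqrt'' field_differentiable at z" for z
    unfolding cosh_sqrt''_def[abs_def] field_differentiable_def
    using termdiffs_strong_converges_everywhere[OF termdiff_converges_all[OF termdiff_converges_all[OF summable_cosh_sqrt]]]
    by blast
  then show ?thesis by (auto simp: holomorphic_on_def intro: field_differentiable_at_within)
qed

lemma cosh_sqrt_at_0: "cosh_sqrt 0 = 1" "cosh_sqrt' 0 = 1 / 2" "cosh_sqrt'' 0 = 1 / 12"
  unfolding cosh_sqrt_def cosh_sqrt'_def cosh_sqrt''_def powser_zero
  by (simp_all add: diffs_def cosh_sqrt_coeff_def fact_numeral)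

lemma cosh_sqrt_square: "cosh_sqrt (u\<^sup>2) = cosh u"
proof -
  have "(\<lambda>n. (if even n then u ^ n /\<^sub>R fact n else 0)) sums cosh u"
    by (rule cosh_converges)
  then have "(\<lambda>n. (\<lambda>n. (if even n then u ^ n /\<^sub>R fact n else 0)) (2 * n)) sums cosh u"
    by (subst sums_mono_reindex) (auto simp: strict_mono_def elim!: evenE)
  then have "(\<lambda>n. cosh_sqrt_coeff n * (u\<^sup>2) ^ n) sums cosh u"
    by (simp add: cosh_sqrt_coeff_def power_mult scaleR_conv_of_real divide_simps)
  then show ?thesis
    by (simp add: cosh_sqrt_def sums_iff)
qed

lemma cosh_sqrt'_square: "2 * u * cosh_sqrt' (u\<^sup>2) = sinh u"
proof -
  have "((\<lambda>u. cosh_sqrt (u\<^sup>2)) has_field_derivative cosh_sqrt' (u\<^sup>2) * (2 * u)) (at u)"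
    by (rule DERIV_chain2[OF cosh_sqrt_deriv]) (auto intro!: derivative_eq_intros)
  moreover have "((\<lambda>u. cosh_sqrt (u\<^sup>2)) has_field_derivative sinh u) (at u)"
    unfolding cosh_sqrt_square by (auto intro!: derivative_eq_intros)
  ultimately show ?thesis by (metis DERIV_unique mult.commute mult.left_commute)
qed

section \<open>The logarithm of \<open>cosh (sqrt z)\<close> and its Taylor bounds\<close>

definition lcs :: "complex \<Rightarrow> complex" where "lcs z = Ln (cosh_sqrt z)"
definition lcs' :: "complex \<Rightarrow> complex" where "lcs' z = cosh_sqrt' z / cosh_sqrt z"
definition lcs'' :: "complex \<Rightarrow> complex" where
  "lcs'' z = cosh_sqrt'' z / cosh_sqrt z - (cosh_sqrt' z / cosh_sqrt z)\<^sup>2"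

lemma lcs_at_0: "lcs 0 = 0" "lcs' 0 = 1 / 2" "lcs'' 0 = - 1 / 6"
  by (simp_all add: lcs_def lcs'_def lcs''_def cosh_sqrt_at_0 power2_eq_square)

text \<open>On such a disc the principal logarithm of \<open>cosh_sqrt\<close> is available, and its
  second derivative is so close to \<open>- 1 / 6\<close> that quadratic models with the constant
  coefficient \<open>1 / 12\<close> hold up to a small relative error. \<open>K\<close> bounds the
  third derivative, for cubic remainders.\<close>

definition good_radius :: "real \<Rightarrow> real \<Rightarrow> bool" where
  "good_radius \<rho> K \<longleftrightarrow> 0 < \<rho> \<and> \<rho> \<le> 1 / 100 \<and> 0 < K \<and>
     (\<forall>z\<in>ball 0 \<rho>. cosh_sqrt z \<notin> \<real>\<^sub>\<le>\<^sub>0 \<and> norm (lcs'' z + 1 / 6) \<le> 1 / 1000 \<and>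
        lcs'' field_differentiable at z \<and> norm (deriv lcs'' z) \<le> K)"

lemma good_radius_exists: "\<exists>\<rho> K. good_radius \<rho> K"
proof -
  have cont: "continuous_on UNIV cosh_sqrt"
    using cosh_sqrt_deriv by (meson DERIV_continuous_on DERIV_subset subset_UNIV)
  have hol: "cosh_sqrt holomorphic_on S" "cosh_sqrt' holomorphic_on S" for S
    using cosh_sqrt_deriv cosh_sqrt'_deriv
    by (auto simp: holomorphic_on_def field_differentiable_def intro: has_field_derivative_at_within)
  have "open {z. norm (cosh_sqrt z - 1) < 1}"
    by (intro open_Collect_less continuous_intros continuous_on_subset[OF cont]) auto
  then obtain r1 where r1: "r1 > 0" "ball 0 r1 \<subseteq> {z. norm (cosh_sqrt z - 1) < 1}"
    by (rule openE[where x = 0]) (simp add: cosh_sqrt_at_0)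
  have slit: "cosh_sqrt z \<notin> \<real>\<^sub>\<le>\<^sub>0" if "z \<in> ball 0 r1" for z
  proof -
    have "norm (cosh_sqrt z - 1) < 1" using r1 that by auto
    then have "\<bar>Re (cosh_sqrt z - 1)\<bar> < 1" using abs_Re_le_cmod order_le_less_trans by blast
    then show ?thesis by (auto simp: complex_nonpos_Reals_iff)
  qed
  then have nz: "cosh_sqrt z \<noteq> 0" if "z \<in> ball 0 r1" for z
    using slit[OF that] by auto
  have h2: "lcs'' holomorphic_on ball 0 r1"
    unfolding lcs''_def using nz by (intro holomorphic_intros hol cosh_sqrt''_holomorphic) auto
  then have "continuous_on (ball 0 r1) lcs''" by (rule holomorphic_on_imp_continuous_on)
  then have "isCont lcs'' 0" using r1 by (simp add: continuous_on_eq_continuous_at)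
  then obtain r2 where r2: "r2 > 0" "\<And>z. dist z 0 < r2 \<Longrightarrow> dist (lcs'' z) (lcs'' 0) < 1 / 1000"
    unfolding continuous_at_eps_delta by (metis divide_pos_pos zero_less_numeral zero_less_one)
  define \<rho> where "\<rho> = min (r1 / 2) (min r2 (1 / 100))"
  have \<rho>: "0 < \<rho>" "\<rho> \<le> 1 / 100" "\<rho> < r1" "\<rho> \<le> r2" using r1(1) r2(1) by (auto simp: \<rho>_def)
  have "deriv lcs'' holomorphic_on ball 0 r1" using h2 by (rule holomorphic_deriv) simp
  then have "continuous_on (cball 0 \<rho>) (deriv lcs'')"
    using \<rho> by (intro holomorphic_on_imp_continuous_on) (auto elim: holomorphic_on_subset)
  then have "bounded (deriv lcs'' ` cball 0 \<rho>)"
    by (intro compact_imp_bounded compact_continuous_image) auto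
  then obtain K where K: "K > 0" "\<And>z. z \<in> cball 0 \<rho> \<Longrightarrow> norm (deriv lcs'' z) \<le> K"
    unfolding bounded_pos by auto
  have "good_radius \<rho> K"
    unfolding good_radius_def
  proof (intro conjI ballI)
    fix z assume z: "z \<in> ball (0::complex) \<rho>"
    show "cosh_sqrt z \<notin> \<real>\<^sub>\<le>\<^sub>0" using z \<rho> by (intro slit) auto
    show "norm (lcs'' z + 1 / 6) \<le> 1 / 1000"
      using r2(2)[of z] z \<rho> by (auto simp: dist_norm lcs_at_0)
    show "lcs'' field_differentiable at z"
      using h2 z \<rho> by (intro holomorphic_on_imp_differentiable_at) auto
    show "norm (deriv lcs'' z) \<le> K" using K(2) z by auto
  qed (use \<rho> K in auto)
  then show ?thesis by blast
qed

definition rad :: real where "rad = (SOME \<rho>. \<exists>K. good_radius \<rho> K)"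
definition curv :: real where "curv = (SOME K. good_radius rad K)"

lemma good_radius: "good_radius rad curv"
proof -
  have "\<exists>K. good_radius rad K" unfolding rad_def by (rule someI_ex[OF good_radius_exists])
  then show ?thesis unfolding curv_def by (rule someI_ex)
qed

lemma rad: "0 < rad" "rad \<le> 1 / 100" and curv: "0 < curv"
  using good_radius by (auto simp: good_radius_def)

lemma cosh_sqrt_slit: "norm z < rad \<Longrightarrow> cosh_sqrt z \<notin> \<real>\<^sub>\<le>\<^sub>0"
  and cosh_sqrt_nz: "norm z < rad \<Longrightarrow> cosh_sqrt z \<noteq> 0"
  and lcs''_near: "norm z < rad \<Longrightarrow> norm (lcs'' z + 1 / 6) \<le> 1 / 1000"
proof -
  show *: "cosh_sqrt z \<notin> \<real>\<^sub>\<le>\<^sub>0" if "norm z < rad"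
    using good_radius that by (auto simp: good_radius_def)
  show "cosh_sqrt z \<noteq> 0" if "norm z < rad"
    using *[OF that] by auto
  show "norm (lcs'' z + 1 / 6) \<le> 1 / 1000" if "norm z < rad"
    using good_radius that by (auto simp: good_radius_def)
qed

lemma lcs_deriv: "norm z < rad \<Longrightarrow> (lcs has_field_derivative lcs' z) (at z)"
  unfolding lcs_def[abs_def] lcs'_def
  using cosh_sqrt_slit[of z]
  by (auto intro!: derivative_eq_intros cosh_sqrt_deriv simp: field_simps)

lemma lcs'_deriv: "norm z < rad \<Longrightarrow> (lcs' has_field_derivative lcs'' z) (at z)"
  unfolding lcs'_def[abs_def] lcs''_def
  using cosh_sqrt_nz[of z]
  by (auto intro!: derivative_eq_intros cosh_sqrt_deriv cosh_sqrt'_deriv simp: power2_eq_square field_simps)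

lemma lcs''_deriv: "norm z < rad \<Longrightarrow> (lcs'' has_field_derivative deriv lcs'' z) (at z)"
  and norm_deriv_lcs''_le: "norm z < rad \<Longrightarrow> norm (deriv lcs'' z) \<le> curv"
  using good_radius by (auto simp: good_radius_def DERIV_deriv_iff_field_differentiable)

lemma cosh_eq_exp_lcs: "norm (u\<^sup>2) < rad \<Longrightarrow> cosh u = exp (lcs (u\<^sup>2))"
  using cosh_sqrt_nz[of "u\<^sup>2"] by (simp add: lcs_def cosh_sqrt_square)

lemma tanh_eq_lcs': "norm (u\<^sup>2) < rad \<Longrightarrow> tanh u = 2 * u * lcs' (u\<^sup>2)"
  by (simp add: lcs'_def tanh_def cosh_sqrt_square flip: cosh_sqrt'_square)

lemma lcs'_approx:
  assumes "norm z < rad" "norm w < rad"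
  shows "norm (lcs' z - lcs' w + (z - w) / 6) \<le> norm (z - w) / 1000"
proof -
  have "norm ((\<lambda>z. lcs' z + z / 6) z - (\<lambda>z. lcs' z + z / 6) w) \<le> 1 / 1000 * norm (z - w)"
    by (rule field_differentiable_bound[of "ball 0 rad" _ "\<lambda>z. lcs'' z + 1 / 6"])
      (use assms lcs''_near in \<open>auto intro!: derivative_eq_intros has_field_derivative_at_within[OF lcs'_deriv]\<close>)
  then show ?thesis by (simp add: algebra_simps diff_divide_distrib)
qed

text \<open>Taylor's theorem is applied to \<open>lcs z + z^2 / 12\<close>, whose second derivative
  is at most \<open>1 / 1000\<close>; hence the quadratic coefficient is the same at every base
  point. This form yields lower bounds for real parts along contours.\<close>

lemma lcs_approx:
  assumes "norm z < rad" "norm w < rad"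
  shows "norm (lcs z - lcs w - lcs' w * (z - w) + (z - w)\<^sup>2 / 12) \<le> norm (z - w) ^ 2 / 1000"
proof -
  define f where "f = (\<lambda>i::nat. case i of 0 \<Rightarrow> (\<lambda>z. lcs z + z\<^sup>2 / 12) | Suc j \<Rightarrow>
     (case j of 0 \<Rightarrow> (\<lambda>z. lcs' z + z / 6) | Suc _ \<Rightarrow> (\<lambda>z. lcs'' z + 1 / 6)))"
  have "norm (f 0 z - (\<Sum>i\<le>1. f i w * (z - w) ^ i / fact i)) \<le> 1 / 1000 * norm (z - w) ^ Suc 1 / fact 1"
  proof (rule complex_Taylor[of "ball 0 rad"])
    fix i x assume "x \<in> ball (0::complex) rad" "i \<le> (1::nat)"
    then show "(f i has_field_derivative f (Suc i) x) (at x within ball 0 rad)"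
      by (cases i) (auto simp: f_def intro!: derivative_eq_intros
          has_field_derivative_at_within[OF lcs'_deriv] has_field_derivative_at_within[OF lcs_deriv])
  qed (use assms lcs''_near in \<open>auto simp: f_def\<close>)
  moreover have "f 0 z - (\<Sum>i\<le>1. f i w * (z - w) ^ i / fact i) = lcs z - lcs w - lcs' w * (z - w) + (z - w)\<^sup>2 / 12"
    by (simp add: f_def power2_eq_square field_simps)
  ultimately show ?thesis by (simp add: power2_eq_square)
qed

text \<open>Here the quadratic coefficient is exact and the error cubic: the constant of the
  Gaussian limit at a saddle point depends on \<open>lcs'' w\<close>, which
  \<open>lcs_approx\<close> does not resolve.\<close>

lemma lcs_approx3:
  assumes "norm z < rad" "norm w < rad"
  shows "norm (lcs z - lcs w - lcs' w * (z - w) - lcs'' w * (z - w)\<^sup>2 / 2) \<le> curv * norm (z - w) ^ 3"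
proof -
  define f where "f = (\<lambda>i::nat. case i of 0 \<Rightarrow> lcs | Suc j \<Rightarrow>
     (case j of 0 \<Rightarrow> lcs' | Suc k \<Rightarrow> (case k of 0 \<Rightarrow> lcs'' | Suc _ \<Rightarrow> deriv lcs'')))"
  have "norm (f 0 z - (\<Sum>i\<le>2. f i w * (z - w) ^ i / fact i)) \<le> curv * norm (z - w) ^ Suc 2 / fact 2"
  proof (rule complex_Taylor[of "ball 0 rad"])
    fix i x assume "x \<in> ball (0::complex) rad" "i \<le> (2::nat)"
    moreover from this have "i = 0 \<or> i = 1 \<or> i = 2" by auto
    ultimately show "(f i has_field_derivative f (Suc i) x) (at x within ball 0 rad)"
      by (auto simp: f_def numeral_2_eq_2 intro!: has_field_derivative_at_within[OF lcs'_deriv]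
          has_field_derivative_at_within[OF lcs_deriv] has_field_derivative_at_within[OF lcs''_deriv])
  qed (use assms norm_deriv_lcs''_le in \<open>auto simp: f_def numeral_2_eq_2\<close>)
  moreover have "f 0 z - (\<Sum>i\<le>2. f i w * (z - w) ^ i / fact i) = lcs z - lcs w - lcs' w * (z - w) - lcs'' w * (z - w)\<^sup>2 / 2"
    by (simp add: f_def numeral_2_eq_2)
  moreover have "curv * norm (z - w) ^ Suc 2 / fact 2 \<le> curv * norm (z - w) ^ 3"
    using curv by (simp add: numeral_3_eq_3 numeral_2_eq_2)
  ultimately show ?thesis by simp
qed

text \<open>The saddle point is parametrised by its square \<open>p\<close>: the critical equation
  \<open>u / \<beta> = tanh u\<close> reads \<open>\<beta> = 1 / (2 lcs' (u\<^sup>2))\<close>, and \<open>h_rel p q\<close> is \<open>h\<close> at a point with square \<open>q\<close>.\<close>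

definition beta_of :: "complex \<Rightarrow> complex" where "beta_of p = 1 / (2 * lcs' p)"
definition h_rel :: "complex \<Rightarrow> complex \<Rightarrow> complex" where "h_rel p q = q * lcs' p - lcs q"
definition h_saddle :: "complex \<Rightarrow> complex" where "h_saddle p = h_rel p p"

lemma h_rel_0 [simp]: "h_rel p 0 = 0" by (simp add: h_rel_def lcs_at_0)

lemma h_rel_saddle:
  assumes "norm p < rad" "norm q < rad"
  shows "norm (h_rel p q - h_saddle p - (q - p)\<^sup>2 / 12) \<le> norm (q - p) ^ 2 / 1000"
proof -
  have "h_rel p q - h_saddle p - (q - p)\<^sup>2 / 12 = - (lcs q - lcs p - lcs' p * (q - p) + (q - p)\<^sup>2 / 12)"
    by (simp add: h_rel_def h_saddle_def algebra_simps)
  then show ?thesis using lcs_approx[OF assms(2,1)] by (simp only: norm_minus_cancel)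
qed

lemma h_rel_saddle3:
  assumes "norm p < rad" "norm q < rad"
  shows "norm (h_rel p q - h_saddle p + lcs'' p * (q - p)\<^sup>2 / 2) \<le> curv * norm (q - p) ^ 3"
proof -
  have "h_rel p q - h_saddle p + lcs'' p * (q - p)\<^sup>2 / 2
      = - (lcs q - lcs p - lcs' p * (q - p) - lcs'' p * (q - p)\<^sup>2 / 2)"
    by (simp add: h_rel_def h_saddle_def algebra_simps)
  then show ?thesis using lcs_approx3[OF assms(2,1)] by (simp only: norm_minus_cancel)
qed

text \<open>This is \<open>h_rel_saddle\<close> at \<open>q = 0\<close>, where \<open>h_rel\<close>
  vanishes.\<close>

lemma h_saddle_approx: "norm p < rad \<Longrightarrow> norm (h_saddle p + p\<^sup>2 / 12) \<le> norm p ^ 2 / 1000"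
  using h_rel_saddle[of p 0] rad by (simp add: norm_minus_commute[of _ "p\<^sup>2 / 12"] del: norm_minus_cancel)
    (metis add.commute minus_add_distrib norm_minus_cancel uminus_add_conv_diff)

lemma lcs'_near: "norm p < rad \<Longrightarrow> norm (lcs' p - 1 / 2 + p / 6) \<le> norm p / 1000"
  using lcs'_approx[of p 0] rad by (simp add: lcs_at_0)

text \<open>The terms \<open>- p * q / 6\<close> and \<open>q^2 / 12\<close> are the quadratic and
  quartic terms of \<open>h\<close> in \<open>u\<close>. The error is relative to their sizes, so
  the sign of the real part on rays from the origin can be read off these two terms.\<close>

lemma h_rel_near_0:
  assumes "norm p < rad" "norm q < rad"
  shows "norm (h_rel p q - (q\<^sup>2 / 12 - p * q / 6)) \<le> (norm p * norm q + norm q ^ 2) / 1000"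
proof -
  have "h_rel p q - (q\<^sup>2 / 12 - p * q / 6) = q * (lcs' p - 1 / 2 + p / 6) - (lcs q - lcs 0 - lcs' 0 * (q - 0) + (q - 0)\<^sup>2 / 12)"
    by (simp add: h_rel_def lcs_at_0 algebra_simps)
  also have "norm \<dots> \<le> norm q * (norm p / 1000) + norm (q - 0) ^ 2 / 1000"
    unfolding norm_mult[symmetric]
    by (intro order_trans[OF norm_triangle_ineq4] add_mono lcs_approx order_trans[OF norm_mult_ineq] mult_left_mono lcs'_near)
      (use assms rad in auto)
  finally show ?thesis by (simp add: algebra_simps add_divide_distrib)
qed

lemma h_saddle_deriv:
  assumes "norm p < rad"
  shows "(h_saddle has_field_derivative p * lcs'' p) (at p)"
proof -
  have "((\<lambda>p. p * lcs' p - lcs p) has_field_derivative p * lcs'' p) (at p)"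
    using assms by (auto intro!: derivative_eq_intros lcs_deriv lcs'_deriv)
  then show ?thesis by (simp add: h_saddle_def[abs_def] h_rel_def)
qed

lemma lcs'_nz: "norm p < rad \<Longrightarrow> lcs' p \<noteq> 0"
proof
  assume p: "norm p < rad" and "lcs' p = 0"
  then have "norm (1 / 2 - p / 6) \<le> norm p / 1000"
    using lcs'_near[OF p] by (simp add: norm_minus_commute)
  moreover have "norm (1 / 2 :: complex) - norm (p / 6) \<le> norm (1 / 2 - p / 6)"
    by (rule norm_triangle_ineq2)
  ultimately show False using p rad by (simp add: norm_divide)
qed

lemma inverse_beta_of: "norm p < rad \<Longrightarrow> 1 / beta_of p = 2 * lcs' p"
  by (simp add: beta_of_def)

lemma beta_of_nz: "norm p < rad \<Longrightarrow> beta_of p \<noteq> 0"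
  using lcs'_nz by (simp add: beta_of_def)

lemma beta_of_0 [simp]: "beta_of 0 = 1"
  by (simp add: beta_of_def lcs_at_0)

lemma norm_inverse_beta_of: "norm p < rad \<Longrightarrow> norm (1 / beta_of p - 1) \<le> norm p / 2"
proof -
  assume p: "norm p < rad"
  have "1 / beta_of p - 1 = 2 * (lcs' p - 1 / 2 + p / 6) - p / 3"
    by (simp add: inverse_beta_of[OF p] field_simps)
  also have "norm \<dots> \<le> 2 * (norm p / 1000) + norm p / 3"
    using lcs'_near[OF p] by (intro order_trans[OF norm_triangle_ineq4] add_mono) (simp_all only: norm_mult norm_divide, simp_all)
  finally show ?thesis using norm_ge_zero[of p] by linarith
qed

lemma beta_of_approx: "norm p < rad \<Longrightarrow> norm (beta_of p - 1 - p / 3) \<le> norm p / 100"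
proof -
  assume p: "norm p < rad"
  define e where "e = 2 * (lcs' p - 1 / 2 + p / 6)"
  have e: "norm e \<le> norm p / 500" using lcs'_near[OF p] unfolding e_def norm_mult by simp
  have d: "2 * lcs' p = 1 - p / 3 + e" by (simp add: e_def field_simps)
  have p1: "norm p \<le> 1 / 100" using p rad by simp
  have nz: "2 * lcs' p \<noteq> 0" using lcs'_nz[OF p] by simp
  \<comment> \<open>With \<open>2 * lcs' p = 1 - p / 3 + e\<close> the first order cancels in the
    numerator; \<open>e\<close> and a second order term remain.\<close>
  have "beta_of p - 1 - p / 3 = (- e + (p / 3) * (p / 3 - e)) / (2 * lcs' p)"
  proof -
    have "1 - 2 * lcs' p * (1 + p / 3) = - e + (p / 3) * (p / 3 - e)"
      unfolding d by (simp add: algebra_simps)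
    moreover have "1 / X - 1 - p / 3 = (1 - X * (1 + p / 3)) / X" if "X \<noteq> 0" for X
      using that by (simp add: field_simps)
    ultimately show ?thesis unfolding beta_of_def using nz by simp
  qed
  moreover have "norm (- e + (p / 3) * (p / 3 - e)) \<le> norm p / 500 + (norm p / 3) * (norm p / 3 + norm p / 500)"
    using e by (intro order_trans[OF norm_triangle_ineq] add_mono order_trans[OF norm_mult_ineq] mult_mono
        order_trans[OF norm_triangle_ineq4]) (auto simp: norm_divide)
  moreover have "norm p / 500 + (norm p / 3) * (norm p / 3 + norm p / 500) \<le> norm p * (4 / 1000)"
  proof -
    have "norm p * norm p \<le> norm p * (1 / 100)" using p1 by (intro mult_left_mono) auto
    moreover have eq: "(norm p / 3) * (norm p / 3 + norm p / 500) = norm p * norm p * (503 / 4500)" by (simp add: field_simps)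
    moreover have "x / 500 + y * (503 / 4500) \<le> x * (4 / 1000)" if "y \<le> x * (1 / 100)" "0 \<le> x" for x y :: real
      using that by simp
    ultimately show ?thesis unfolding eq using norm_ge_zero[of p] by blast
  qed
  moreover have "1 / 2 \<le> norm (2 * lcs' p)"
  proof -
    have "norm (1::complex) - norm (p / 3 - e) \<le> norm (1 - (p / 3 - e))" by (rule norm_triangle_ineq2)
    moreover have "norm (p / 3 - e) \<le> norm p / 3 + norm p / 500"
      using e by (intro order_trans[OF norm_triangle_ineq4]) (auto simp: norm_divide)
    ultimately show ?thesis using p1 unfolding d by (simp add: algebra_simps)
  qed
  ultimately have "norm (beta_of p - 1 - p / 3) \<le> norm p * (4 / 1000) / (1 / 2)"
    unfolding \<open>beta_of p - 1 - p / 3 = _\<close> norm_divide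
    by (intro frac_le) auto
  also have "\<dots> \<le> norm p / 100" by simp
  finally show ?thesis .
qed

lemma Re_beta_of: "norm p < rad \<Longrightarrow> 1 / 2 < Re (beta_of p)"
proof -
  assume p: "norm p < rad"
  have "norm (beta_of p - 1) \<le> norm (beta_of p - 1 - p / 3) + norm (p / 3)"
    by (metis diff_add_cancel norm_triangle_ineq)
  also have "\<dots> \<le> norm p / 100 + norm p / 3" using beta_of_approx[OF p] by (simp add: norm_divide)
  finally have "norm (beta_of p - 1) < 1 / 2" using p rad by simp
  then show ?thesis using abs_Re_le_cmod[of "beta_of p - 1"] by simp
qed

lemma beta_of_holomorphic: "beta_of holomorphic_on ball 0 rad"
  unfolding beta_of_def[abs_def]
proof (intro holomorphic_intros)
  show "lcs' holomorphic_on ball 0 rad"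
    unfolding holomorphic_on_open[OF open_ball] using lcs'_deriv by (metis mem_ball_0)
qed (use lcs'_nz in auto)

lemma h_saddle_holomorphic: "h_saddle holomorphic_on ball 0 rad"
  unfolding holomorphic_on_open[OF open_ball] using h_saddle_deriv by (metis mem_ball_0)

text \<open>Only \<open>u^2\<close> enters on the right, so contours can be laid out in the plane of
  \<open>q = u^2\<close> and pulled back by \<open>csqrt\<close>.\<close>

lemma boltzmann_eq:
  assumes "norm p < rad" "norm (u\<^sup>2) < rad"
  shows "boltzmann N (beta_of p) u = exp (- of_nat N * h_rel p (u\<^sup>2))"
proof -
  have "- of_nat N * u\<^sup>2 / (2 * beta_of p) = - of_nat N * (u\<^sup>2 * lcs' p)"
    using inverse_beta_of[OF assms(1)] by (simp add: beta_of_def)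
  then show ?thesis
    by (simp add: boltzmann_def cosh_eq_exp_lcs[OF assms(2)] h_rel_def exp_of_nat_mult[symmetric] exp_add[symmetric] algebra_simps)
qed

text \<open>Both sides vanish at \<open>0\<close> and have derivative \<open>tanh\<close> on a disc
  inside the slit plane. This connects \<open>h\<close> with the functions of
  \<open>p\<close>.\<close>

lemma log_cosh_eq_lcs:
  assumes "norm (u\<^sup>2) < rad"
  shows "log_cosh u = lcs (u\<^sup>2)"
proof -
  define S where "S = ball (0::complex) (sqrt rad)"
  have S: "norm (z\<^sup>2) < rad" "z \<in> slit_plane" if "z \<in> S" for z
  proof -
    have "norm z < sqrt rad" using that by (simp add: S_def)
    then have "norm z ^ 2 < sqrt rad ^ 2" by (intro power_strict_mono) auto
    then show "norm (z\<^sup>2) < rad" using rad by (simp add: norm_power)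
    then have "norm z ^ 2 < 1 ^ 2" using rad by (simp add: norm_power)
    then have "norm z < 1" by (rule power_less_imp_less_base) simp
    then have "\<bar>Im z\<bar> < 1" using abs_Im_le_cmod order_le_less_trans by blast
    then show "z \<in> slit_plane" using pi_gt3 by (auto simp: slit_plane_def)
  qed
  have u: "u \<in> S"
    using assms real_sqrt_less_mono[of "norm (u\<^sup>2)" rad] by (simp add: S_def norm_power)
  have d: "((\<lambda>z. log_cosh z - lcs (z\<^sup>2)) has_field_derivative 0) (at z within S)" if "z \<in> S" for z
  proof -
    have "((\<lambda>z. log_cosh z - lcs (z\<^sup>2)) has_field_derivative tanh z - lcs' (z\<^sup>2) * (2 * z)) (at z)"
      by (intro DERIV_diff has_field_derivative_log_of_cosh[OF log_cosh_spec(1,3)] DERIV_chain2[OF lcs_deriv])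
        (use S[OF that] in \<open>auto intro!: derivative_eq_intros\<close>)
    then show ?thesis using tanh_eq_lcs'[OF S(1)[OF that]]
      by (simp add: has_field_derivative_at_within mult_ac)
  qed
  have "convex S" by (simp add: S_def)
  then obtain c where c: "\<And>z. z \<in> S \<Longrightarrow> log_cosh z - lcs (z\<^sup>2) = c"
    using has_field_derivative_zero_constant[OF _ d] by blast
  from c[of 0] c[OF u] rad show ?thesis by (simp add: S_def log_cosh_spec(2) lcs_at_0)
qed

lemma h_at_saddle:
  assumes "norm (u\<^sup>2) < rad"
  shows "h (beta_of (u\<^sup>2)) u = h_saddle (u\<^sup>2)" "u / beta_of (u\<^sup>2) - tanh u = 0"
proof -
  have "u / beta_of (u\<^sup>2) = u * (2 * lcs' (u\<^sup>2))"
    unfolding inverse_beta_of[OF assms, symmetric] by simp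
  then show "u / beta_of (u\<^sup>2) - tanh u = 0"
    by (simp add: tanh_eq_lcs'[OF assms])
  show "h (beta_of (u\<^sup>2)) u = h_saddle (u\<^sup>2)"
    using lcs'_nz[OF assms] by (simp add: h_def log_cosh_eq_lcs[OF assms] h_saddle_def h_rel_def beta_of_def)
qed

section \<open>Laplace asymptotics\<close>

text \<open>The substitution \<open>t = s / sqrt N\<close> produces the Gaussian majorant
  \<open>C * exp (- \<kappa> * s^2)\<close>, so dominated convergence applies. Exponent and
  amplitude may depend on \<open>n\<close>, which lets the parameter \<open>p\<close> move along
  with \<open>N\<close>.\<close>

lemma laplace_half_line:
  fixes f g :: "nat \<Rightarrow> real \<Rightarrow> complex" and N :: "nat \<Rightarrow> nat"
  assumes N: "filterlim N at_top sequentially" "\<And>n. 0 < N n" and \<kappa>: "0 < \<kappa>"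
    and cont: "\<And>n. continuous_on {0..1} (f n)" "\<And>n. continuous_on {0..1} (g n)"
    and lower: "\<And>n t. 0 \<le> t \<Longrightarrow> t \<le> 1 \<Longrightarrow> \<kappa> * t\<^sup>2 \<le> Re (f n t)"
    and bound: "\<And>n t. 0 \<le> t \<Longrightarrow> t \<le> 1 \<Longrightarrow> norm (g n t) \<le> C"
    and limf: "\<And>s. 0 \<le> s \<Longrightarrow> (\<lambda>n. of_nat (N n) * f n (s / sqrt (N n))) \<longlonglongrightarrow> r\<^sup>2 * of_real s ^ 2"
    and limg: "\<And>s. 0 \<le> s \<Longrightarrow> (\<lambda>n. g n (s / sqrt (N n))) \<longlonglongrightarrow> g0"
    and r: "0 < Re r" "0 < Re (r\<^sup>2)"
  shows "(\<lambda>n. of_real (sqrt (N n)) * (\<integral>t. indicator {0..1} t *\<^sub>R (g n t * exp (- of_nat (N n) * f n t)) \<partial>lborel))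
           \<longlonglongrightarrow> g0 * (of_real (sqrt pi) / (2 * r))"
proof -
  define \<phi> where "\<phi> = (\<lambda>n t. indicator {0..1} t *\<^sub>R (g n t * exp (- of_nat (N n) * f n t)))"
  have meas: "\<phi> n \<in> borel_measurable borel" for n
    unfolding \<phi>_def by (intro borel_measurable_continuous_on_indicator continuous_intros cont) auto
  have C: "0 \<le> C" using bound[of 0 0] norm_ge_zero order_trans by (metis order_refl zero_le_one)
  have scale: "of_real (sqrt (N n)) * (\<integral>t. \<phi> n t \<partial>lborel) = (\<integral>s. \<phi> n (s / sqrt (N n)) \<partial>lborel)" for n
  proof -
    have "(\<integral>t. \<phi> n t \<partial>lborel) = \<bar>1 / sqrt (N n)\<bar> *\<^sub>R (\<integral>s. \<phi> n (0 + (1 / sqrt (N n)) * s) \<partial>lborel)"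
      using N(2)[of n] by (intro lborel_integral_real_affine) auto
    then show ?thesis using N(2)[of n] by (simp add: scaleR_conv_of_real)
  qed
  have sq: "real (N n) * (s / sqrt (N n))\<^sup>2 = s\<^sup>2" for n s
    using N(2)[of n] by (simp add: power_divide)
  have "(\<lambda>n. \<integral>s. \<phi> n (s / sqrt (N n)) \<partial>lborel) \<longlonglongrightarrow>
     (\<integral>s. indicator {0..} s *\<^sub>R (g0 * exp (- r\<^sup>2 * of_real s ^ 2)) \<partial>lborel)"
  proof (rule integral_dominated_convergence)
    show "(\<lambda>s. indicator {0..} s *\<^sub>R (g0 * exp (- r\<^sup>2 * (of_real s)\<^sup>2))) \<in> borel_measurable lborel"
      by measurable
    show "(\<lambda>s. \<phi> n (s / sqrt (N n))) \<in> borel_measurable lborel" for n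
      by (rule measurable_compose[OF _ meas]) simp
    show "integrable lborel (\<lambda>s::real. C * (indicator {0..} s *\<^sub>R exp (- \<kappa> * s\<^sup>2)))"
    proof -
      have "integrable lborel (\<lambda>x::real. indicator {0..} (0 + sqrt \<kappa> * x) *\<^sub>R exp (- (0 + sqrt \<kappa> * x)\<^sup>2))"
        using gaussian_moment_0 \<kappa> by (intro lborel_integrable_real_affine) (auto simp: has_bochner_integral_iff)
      then have "integrable lborel (\<lambda>x::real. indicator {0..} x *\<^sub>R exp (- \<kappa> * x\<^sup>2))"
        by (rule Bochner_Integration.integrable_cong[THEN iffD1, rotated -1])
          (use \<kappa> in \<open>auto simp: indicator_def power_mult_distrib zero_le_mult_iff\<close>)
      then show ?thesis by (rule integrable_mult_right)
    qed
    show "AE s in lborel. (\<lambda>n. \<phi> n (s / sqrt (N n))) \<longlonglongrightarrow> indicator {0..} s *\<^sub>R (g0 * exp (- r\<^sup>2 * of_real s ^ 2))"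
    proof (rule AE_I2)
      fix s :: real
      show "(\<lambda>n. \<phi> n (s / sqrt (N n))) \<longlonglongrightarrow> indicator {0..} s *\<^sub>R (g0 * exp (- r\<^sup>2 * of_real s ^ 2))"
      proof (cases "0 \<le> s")
        case True
        have "filterlim (\<lambda>n. sqrt (real (N n))) at_top sequentially"
          by (intro filterlim_compose[OF sqrt_at_top] filterlim_compose[OF filterlim_real_sequentially] N)
        then have "\<forall>\<^sub>F n in sequentially. s \<le> sqrt (N n)"
          by (simp add: filterlim_at_top)
        then have ev: "\<forall>\<^sub>F n in sequentially. g n (s / sqrt (N n)) * exp (- (of_nat (N n) * f n (s / sqrt (N n)))) = \<phi> n (s / sqrt (N n))"
          using True N(2) by (auto elim!: eventually_mono simp: \<phi>_def field_simps)
        have "(\<lambda>n. g n (s / sqrt (N n)) * exp (- (of_nat (N n) * f n (s / sqrt (N n))))) \<longlonglongrightarrow> g0 * exp (- (r\<^sup>2 * of_real s ^ 2))"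
          using True by (intro tendsto_intros limf limg)
        from Lim_transform_eventually[OF this ev] show ?thesis using True by simp
      next
        case False
        then have "s / sqrt (N n) \<notin> {0..1}" for n using N(2)[of n] by (simp add: zero_le_divide_iff)
        then have "\<phi> n (s / sqrt (N n)) = 0" for n by (simp add: \<phi>_def del: atLeastAtMost_iff)
        then show ?thesis using False by simp
      qed
    qed
    show "AE s in lborel. norm (\<phi> n (s / sqrt (N n))) \<le> C * (indicator {0..} s *\<^sub>R exp (- \<kappa> * s\<^sup>2))" for n
    proof (rule AE_I2)
      fix s :: real
      show "norm (\<phi> n (s / sqrt (N n))) \<le> C * (indicator {0..} s *\<^sub>R exp (- \<kappa> * s\<^sup>2))"
      proof (cases "s / sqrt (N n) \<in> {0..1}")
        case True
        then have t: "0 \<le> s / sqrt (N n)" "s / sqrt (N n) \<le> 1" by auto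
        then have s: "0 \<le> s" using N(2)[of n] by (simp add: zero_le_divide_iff)
        have "real (N n) * (\<kappa> * (s / sqrt (N n))\<^sup>2) \<le> real (N n) * Re (f n (s / sqrt (N n)))"
          by (intro mult_left_mono lower t) auto
        then have "\<kappa> * s\<^sup>2 \<le> real (N n) * Re (f n (s / sqrt (N n)))"
          using sq[of n s] by (metis mult.left_commute)
        then have "norm (g n (s / sqrt (N n))) * exp (- (real (N n) * Re (f n (s / sqrt (N n))))) \<le> C * exp (- \<kappa> * s\<^sup>2)"
          using bound[OF t] C by (intro mult_mono) auto
        then show ?thesis using True s by (simp add: \<phi>_def norm_mult)
      next
        case False
        then show ?thesis using C by (auto simp: \<phi>_def indicator_def)
      qed
    qed
  qed
  moreover have "(\<integral>s. indicator {0..} s *\<^sub>R (g0 * exp (- r\<^sup>2 * of_real s ^ 2)) \<partial>lborel) = g0 * (of_real (sqrt pi) / (2 * r))"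
    using complex_half_gaussian_integral[OF r] by (simp add: mult_scaleR_right[symmetric] del: mult_scaleR_right)
  ultimately show ?thesis unfolding scale[symmetric] by (simp add: \<phi>_def)
qed

lemma boltzmann_continuous [continuous_intros]:
  "\<beta> \<noteq> 0 \<Longrightarrow> continuous_on S f \<Longrightarrow> continuous_on S (\<lambda>t. boltzmann N \<beta> (f t))"
  unfolding boltzmann_def cosh_field_def by (intro continuous_intros) auto

lemma boltzmann_prim_ray:
  assumes "\<beta> \<noteq> 0" "N > 0"
  shows "boltzmann_prim N \<beta> m = (\<integral>t. indicator {0..1} t *\<^sub>R (m * boltzmann N \<beta> (of_real t * m)) \<partial>lborel)"
proof -
  have "((\<lambda>t. boltzmann_prim N \<beta> (of_real t * m)) has_vector_derivative m * boltzmann N \<beta> (of_real t * m)) (at t within {0..1})" for t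
  proof (rule has_vector_derivative_real_field)
    have "((\<lambda>t. t * m) has_field_derivative m) (at (of_real t))"
      by (auto intro!: derivative_eq_intros)
    from DERIV_chain2[OF boltzmann_prim_deriv[OF assms] this]
    show "((\<lambda>t. boltzmann_prim N \<beta> (t * m)) has_field_derivative m * boltzmann N \<beta> (of_real t * m)) (at (of_real t))"
      by (simp add: mult.commute)
  qed
  from integral_FTC_atLeastAtMost[OF _ this] show ?thesis
    using assms by (simp add: continuous_intros)
qed

lemma boltzmann_prim_csqrt_deriv:
  assumes "\<beta> \<noteq> 0" "N > 0" "z \<notin> \<real>\<^sub>\<le>\<^sub>0"
  shows "((\<lambda>z. boltzmann_prim N \<beta> (csqrt z)) has_field_derivative boltzmann N \<beta> (csqrt z) / (2 * csqrt z)) (at z within S)"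
  using DERIV_chain2[OF boltzmann_prim_deriv[OF assms(1,2)] has_field_derivative_at_within[OF has_field_derivative_csqrt[OF assms(3)]]]
  by (simp only: divide_inverse)

text \<open>The fundamental theorem of calculus on a segment in the plane of \<open>q = u^2\<close>:
  the factor \<open>1 / (2 * csqrt q)\<close> is \<open>du / dq\<close>, and the segment has to
  avoid the cut of \<open>csqrt\<close>.\<close>

lemma boltzmann_prim_segment:
  assumes "\<beta> \<noteq> 0" "N > 0" and seg: "\<And>t. 0 \<le> t \<Longrightarrow> t \<le> 1 \<Longrightarrow> p + of_real t * d \<notin> \<real>\<^sub>\<le>\<^sub>0"
  shows "boltzmann_prim N \<beta> (csqrt (p + d)) - boltzmann_prim N \<beta> (csqrt p) =
    (\<integral>t. indicator {0..1} t *\<^sub>R (d / (2 * csqrt (p + of_real t * d)) * boltzmann N \<beta> (csqrt (p + of_real t * d))) \<partial>lborel)"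
proof -
  have "((\<lambda>t. boltzmann_prim N \<beta> (csqrt (p + of_real t * d))) has_vector_derivative
     d / (2 * csqrt (p + of_real t * d)) * boltzmann N \<beta> (csqrt (p + of_real t * d))) (at t within {0..1})" if "0 \<le> t" "t \<le> 1" for t
  proof (rule has_vector_derivative_real_field)
    have "((\<lambda>t. p + t * d) has_field_derivative d) (at (of_real t))"
      by (auto intro!: derivative_eq_intros)
    from DERIV_chain2[OF boltzmann_prim_csqrt_deriv[OF assms(1,2) seg[OF that]] this]
    show "((\<lambda>t. boltzmann_prim N \<beta> (csqrt (p + t * d))) has_field_derivative
        d / (2 * csqrt (p + of_real t * d)) * boltzmann N \<beta> (csqrt (p + of_real t * d))) (at (of_real t))"
      by (simp add: mult.commute)
  qed
  moreover have "continuous_on {0..1} (\<lambda>t. d / (2 * csqrt (p + of_real t * d)) * boltzmann N \<beta> (csqrt (p + of_real t * d)))"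
  proof -
    have c: "continuous_on {0..1} (\<lambda>t. csqrt (p + of_real t * d))"
      using seg by (intro continuous_on_compose2[OF continuous_on_csqrt] continuous_intros) auto
    have "csqrt (p + of_real t * d) \<noteq> 0" if "0 \<le> t" "t \<le> 1" for t
      using seg[OF that] by auto
    then show ?thesis using assms c by (intro continuous_intros c) auto
  qed
  ultimately have "(\<integral>t. indicator {0..1} t *\<^sub>R (d / (2 * csqrt (p + of_real t * d)) * boltzmann N \<beta> (csqrt (p + of_real t * d))) \<partial>lborel)
     = boltzmann_prim N \<beta> (csqrt (p + of_real 1 * d)) - boltzmann_prim N \<beta> (csqrt (p + of_real 0 * d))"
    by (intro integral_FTC_atLeastAtMost) auto
  then show ?thesis by simp
qed

section \<open>Decay of the integrand on the real axis\<close>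

lemma sinh_ge_self: "0 \<le> x \<Longrightarrow> x \<le> sinh x" for x :: real
proof -
  assume "0 \<le> x"
  have "(\<lambda>x. sinh x - x) 0 \<le> (\<lambda>x. sinh x - x) x"
    by (rule DERIV_nonneg_imp_nondecreasing[OF \<open>0 \<le> x\<close>])
      (auto intro!: derivative_eq_intros exI cosh_real_ge_1)
  then show ?thesis by simp
qed

text \<open>The constant is a crude bound for \<open>cosh\<close> on the interval:
  \<open>cosh x <= exp 4 <= 3 ^ 4 = 81\<close>.\<close>

lemma tanh_ge_linear:
  assumes "0 \<le> x" "x \<le> (4::real)"
  shows "x / 81 \<le> tanh x"
proof -
  have "cosh x \<le> exp x" using assms by (simp add: cosh_field_def)
  also have "\<dots> \<le> exp 4" using assms by simp
  also have "exp (4::real) = exp 1 ^ 4" by (simp add: exp_of_nat_mult[symmetric])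
  also have "\<dots> \<le> 3 ^ 4" by (intro power_mono exp_le) auto
  finally have "cosh x \<le> 81" by simp
  then have "x / 81 \<le> sinh x / cosh x"
    using sinh_ge_self[OF assms(1)] assms by (intro frac_le) auto
  then show ?thesis by (simp add: tanh_def)
qed

text \<open>Integrate \<open>(tanh x)^2 >= (x / 81)^2\<close> twice: with
  \<open>3 * 81^2 = 19683\<close> first for \<open>x - tanh x\<close>, then with
  \<open>4 * 19683 = 78732\<close> for \<open>x^2 / 2 - ln (cosh x)\<close>. The explicit quartic
  gain is what matters.\<close>

lemma ln_cosh_le:
  assumes "0 \<le> x" "x \<le> (4::real)"
  shows "ln (cosh x) \<le> x\<^sup>2 / 2 - x ^ 4 / 78732"
proof -
  have g: "0 \<le> y - y ^ 3 / 19683 - tanh y" if "0 \<le> y" "y \<le> 4" for y :: real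
  proof -
    have "(\<lambda>y. y - y ^ 3 / 19683 - tanh y) 0 \<le> (\<lambda>y. y - y ^ 3 / 19683 - tanh y) y"
    proof (rule DERIV_nonneg_imp_nondecreasing[OF that(1)])
      fix z assume z: "0 \<le> z" "z \<le> y"
      have "(z / 81)\<^sup>2 \<le> (tanh z)\<^sup>2"
        using tanh_ge_linear[of z] z that by (intro power_mono) auto
      then show "\<exists>D. ((\<lambda>y. y - y ^ 3 / 19683 - tanh y) has_real_derivative D) (at z) \<and> 0 \<le> D"
        by (intro exI[of _ "(tanh z)\<^sup>2 - (z / 81)\<^sup>2"] conjI)
          (auto intro!: derivative_eq_intros simp: power2_eq_square)
    qed
    then show ?thesis by simp
  qed
  have "(\<lambda>y. y\<^sup>2 / 2 - y ^ 4 / 78732 - ln (cosh y)) 0 \<le> (\<lambda>y. y\<^sup>2 / 2 - y ^ 4 / 78732 - ln (cosh y)) x"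
  proof (rule DERIV_nonneg_imp_nondecreasing[OF assms(1)])
    fix y assume y: "0 \<le> y" "y \<le> x"
    show "\<exists>D. ((\<lambda>y. y\<^sup>2 / 2 - y ^ 4 / 78732 - ln (cosh y)) has_real_derivative D) (at y) \<and> 0 \<le> D"
      using g[of y] y assms
      by (intro exI[of _ "y - y ^ 3 / 19683 - tanh y"] conjI)
        (auto intro!: derivative_eq_intros simp: tanh_def)
  qed
  then show ?thesis by simp
qed

text \<open>Replacing \<open>1 / \<beta>\<close> by \<open>1\<close> costs at most
  \<open>norm p * x^2 / 4\<close> per unit of \<open>N\<close>. The gain \<open>x^4 / 78732\<close>
  is at least \<open>5 / 4 * norm p * x^2\<close> once \<open>x^2 >= 100000 * norm p\<close>, and
  the difference is the claimed rate. Beyond \<open>x = 4\<close> the linear bound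
  \<open>ln (cosh x) <= x\<close> suffices.\<close>

lemma boltzmann_real_le:
  assumes p: "norm p < rad" and x: "0 \<le> x" "100000 * norm p \<le> x\<^sup>2"
  shows "norm (boltzmann N (beta_of p) (of_real x)) \<le> exp (- real N * norm p * x\<^sup>2)"
proof -
  have Re: "1 - norm p / 2 \<le> Re (1 / beta_of p)"
    using norm_inverse_beta_of[OF p] abs_Re_le_cmod[of "1 / beta_of p - 1"] by simp
  have lc: "ln (cosh x) \<le> x\<^sup>2 / 2 - 5 / 4 * norm p * x\<^sup>2"
  proof (cases "x \<le> 4")
    case True
    have "100000 * norm p * x\<^sup>2 \<le> x\<^sup>2 * x\<^sup>2" using x by (intro mult_right_mono) auto
    moreover have "x ^ 4 = x\<^sup>2 * x\<^sup>2" by (simp flip: power_add)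
    moreover have "0 \<le> norm p * x\<^sup>2" by simp
    ultimately have "5 / 4 * norm p * x\<^sup>2 \<le> x ^ 4 / 78732" by linarith
    then show ?thesis using ln_cosh_le[OF x(1) True] by linarith
  next
    case False
    have "cosh x \<le> exp x" using x by (simp add: cosh_field_def)
    then have "ln (cosh x) \<le> x" by (metis cosh_real_pos ln_exp ln_mono exp_gt_zero)
    also have "x \<le> x\<^sup>2 / 4" using False by (simp add: power2_eq_square)
    also have "\<dots> \<le> x\<^sup>2 / 2 - 5 / 4 * norm p * x\<^sup>2"
    proof -
      have "norm p * x\<^sup>2 \<le> 1 / 100 * x\<^sup>2" using p rad by (intro mult_right_mono) auto
      moreover have "0 \<le> norm p * x\<^sup>2" by simp
      ultimately show ?thesis by linarith
    qed
    finally show ?thesis .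
  qed
  have ec: "norm (cosh (complex_of_real x)) = exp (ln (cosh x))"
  proof -
    have "cosh (complex_of_real x) = of_real (cosh x)"
      by (simp add: cosh_field_def flip: exp_of_real)
    then show ?thesis by simp
  qed
  have "Re (- of_nat N * (of_real x)\<^sup>2 / (2 * beta_of p)) = Re (of_real (- (real N * x\<^sup>2 / 2)) * (1 / beta_of p))"
    by simp
  then have e: "Re (- of_nat N * (of_real x)\<^sup>2 / (2 * beta_of p)) = - (real N * x\<^sup>2 / 2) * Re (1 / beta_of p)"
    by (simp only: Re_complex_of_real Im_complex_of_real times_complex.simps)
  have "real N * x\<^sup>2 / 2 * (1 - norm p / 2) \<le> real N * x\<^sup>2 / 2 * Re (1 / beta_of p)"
    using Re by (intro mult_left_mono) auto
  moreover have "real N * ln (cosh x) \<le> real N * (x\<^sup>2 / 2 - 5 / 4 * norm p * x\<^sup>2)"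
    using lc by (intro mult_left_mono) auto
  ultimately have "- (real N * x\<^sup>2 / 2) * Re (1 / beta_of p) + real N * ln (cosh x) \<le> - real N * norm p * x\<^sup>2"
    by (simp add: algebra_simps)
  moreover have "norm (boltzmann N (beta_of p) (of_real x)) = exp (- (real N * x\<^sup>2 / 2) * Re (1 / beta_of p) + real N * ln (cosh x))"
    unfolding boltzmann_def norm_mult norm_power norm_exp_eq_Re e ec exp_add
    by (subst exp_of_nat_mult) (rule refl)
  ultimately show ?thesis by simp
qed

text \<open>From \<open>x\<close> on, \<open>y^2 >= x * y\<close> weakens the Gaussian bound to
  \<open>exp (- c * y)\<close> with \<open>c = N * norm p * x\<close>, which integrates explicitly;
  the estimate on \<open>{x..L}\<close> then passes to the limit.\<close>

lemma boltzmann_tail: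
  assumes p: "norm p < rad" "p \<noteq> 0" and N: "N > 0" and x: "0 < x" "100000 * norm p \<le> x\<^sup>2"
  shows "norm (boltzmann_total N (beta_of p) - boltzmann_prim N (beta_of p) (of_real x))
           \<le> exp (- real N * norm p * x\<^sup>2) / (real N * norm p * x)"
proof -
  define c where "c = real N * norm p * x"
  have c: "c > 0" using p N x by (simp add: c_def)
  have b: "0 < Re (beta_of p)" "beta_of p \<noteq> 0" using Re_beta_of[OF p(1)] beta_of_nz[OF p(1)] by auto
  have "norm (boltzmann_prim N (beta_of p) (of_real L) - boltzmann_prim N (beta_of p) (of_real x)) \<le> exp (- c * x) / c"
    if L: "L > x" for L :: real
  proof -
    have "norm (boltzmann_prim N (beta_of p) (of_real L) - boltzmann_prim N (beta_of p) (of_real x))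
       \<le> (\<lambda>y. - exp (- c * y) / c) L - (\<lambda>y. - exp (- c * y) / c) x"
    proof (rule differentiable_bound_general[OF L])
      fix y assume y: "x < y" "y < L"
      show "((\<lambda>x. boltzmann_prim N (beta_of p) (of_real x)) has_vector_derivative boltzmann N (beta_of p) (of_real y)) (at y)"
        by (intro has_vector_derivative_real_field boltzmann_prim_deriv b N)
      show "((\<lambda>y. - exp (- c * y) / c) has_vector_derivative exp (- c * y)) (at y)"
        unfolding has_real_derivative_iff_has_vector_derivative[symmetric]
        using c by (auto intro!: derivative_eq_intros)
      have "x\<^sup>2 \<le> y\<^sup>2" using x y by (intro power_mono) auto
      then have "100000 * norm p \<le> y\<^sup>2" using x(2) by linarith
      then have "norm (boltzmann N (beta_of p) (of_real y)) \<le> exp (- real N * norm p * y\<^sup>2)"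
        using x y by (intro boltzmann_real_le p) auto
      also have "\<dots> \<le> exp (- c * y)"
      proof -
        have "real N * norm p * (x * y) \<le> real N * norm p * (y * y)"
          using x y by (intro mult_left_mono mult_right_mono) auto
        then show ?thesis by (simp add: c_def power2_eq_square mult_ac)
      qed
      finally show "norm (boltzmann N (beta_of p) (of_real y)) \<le> exp (- c * y)" .
    next
      show "continuous_on {x..L} (\<lambda>x. boltzmann_prim N (beta_of p) (of_real x))"
        by (rule continuous_on_compose2[of UNIV])
          (auto intro!: continuous_intros DERIV_continuous_on boltzmann_prim_deriv b N)
      show "continuous_on {x..L} (\<lambda>y. - exp (- c * y) / c)"
        using c by (intro continuous_intros) auto
    qed
    also have "\<dots> \<le> exp (- c * x) / c" using c by (simp add: field_simps)
    finally show ?thesis .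
  qed
  then have "norm (boltzmann_total N (beta_of p) - boltzmann_prim N (beta_of p) (of_real x)) \<le> exp (- c * x) / c"
    by (intro Lim_norm_ubound[OF trivial_limit_at_top_linorder tendsto_diff[OF boltzmann_prim_limit[OF b(1) N] tendsto_const]])
      (auto intro!: eventually_mono[OF eventually_gt_at_top[of x]])
  then show ?thesis by (simp add: c_def power2_eq_square mult_ac)
qed

text \<open>The hypotheses place both arguments between \<open>- pi / 4\<close> and
  \<open>pi / 4\<close>, so they add up to less than a right angle.\<close>

lemma Re_mult_pos:
  assumes "0 < Re c" "0 < Re (c\<^sup>2)" "0 < Re w" "0 < Re (w\<^sup>2)"
  shows "0 < Re (c * w)"
proof -
  have cone: "\<bar>Im z\<bar> < Re z" if "0 < Re z" "0 < Re (z\<^sup>2)" for z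
  proof -
    have "\<bar>Im z\<bar>\<^sup>2 < (Re z)\<^sup>2" using that by (simp add: power2_eq_square)
    then show ?thesis by (rule power_less_imp_less_base) (use that in simp)
  qed
  have "\<bar>Im c * Im w\<bar> < Re c * Re w"
    unfolding abs_mult using assms by (intro mult_strict_mono cone) auto
  then show ?thesis by simp
qed

lemma Re_csqrt_pos:
  assumes "0 < Re z"
  shows "0 < Re (csqrt z)"
proof -
  have *: "0 < Re c" if "0 \<le> Re c" "0 < Re (c\<^sup>2)" for c
    using that by (cases "Re c = 0") (auto simp: power2_eq_square not_less)
  show ?thesis by (rule *) (use csqrt_principal[of z] assms in auto)
qed

lemma not_nonpos_Reals_if: "0 < Re z \<or> Im z \<noteq> 0 \<Longrightarrow> z \<notin> \<real>\<^sub>\<le>\<^sub>0"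
  by (auto simp: complex_nonpos_Reals_iff)

lemma norm_csqrt: "norm (csqrt z) = sqrt (norm z)"
proof -
  have "(norm (csqrt z))\<^sup>2 = norm z" by (simp flip: norm_power)
  then show ?thesis by (metis norm_ge_zero real_sqrt_unique)
qed

lemma tendsto_lcs:
  assumes "p \<longlonglongrightarrow> p0" "norm p0 < rad"
  shows "(\<lambda>n. lcs' (p n)) \<longlonglongrightarrow> lcs' p0" "(\<lambda>n. lcs'' (p n)) \<longlonglongrightarrow> lcs'' p0"
  by (rule isCont_tendsto_compose[OF DERIV_isCont[OF lcs'_deriv[OF assms(2)]] assms(1)])
    (rule isCont_tendsto_compose[OF DERIV_isCont[OF lcs''_deriv[OF assms(2)]] assms(1)])

lemma lcs_continuous: "continuous_on (ball 0 rad) lcs"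
  by (rule continuous_at_imp_continuous_on) (metis DERIV_isCont lcs_deriv mem_ball_0)

lemma continuous_on_lcs:
  assumes "continuous_on S f" "\<And>t. t \<in> S \<Longrightarrow> norm (f t) < rad"
  shows "continuous_on S (\<lambda>t. lcs (f t))"
  using continuous_on_compose2[OF lcs_continuous assms(1)] assms(2) by (auto simp: image_subset_iff)

lemma tendsto_csqrt: "f \<longlonglongrightarrow> l \<Longrightarrow> l \<notin> \<real>\<^sub>\<le>\<^sub>0 \<Longrightarrow> (\<lambda>n. csqrt (f n)) \<longlonglongrightarrow> csqrt l"
  by (rule isCont_tendsto_compose[OF continuous_at_csqrt])

lemma segment_in_ball:
  fixes p d :: complex
  assumes "norm p < r" "norm (p + d) < r" "0 \<le> t" "t \<le> 1"
  shows "norm (p + of_real t * d) < r"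
proof -
  have "p + of_real t * d = (1 - t) *\<^sub>R p + t *\<^sub>R (p + d)"
    by (simp add: scaleR_conv_of_real algebra_simps)
  moreover have "p \<in> ball 0 r" "p + d \<in> ball 0 r" using assms by auto
  ultimately have "p + of_real t * d \<in> ball 0 r"
    using assms convexD_alt[OF convex_ball[of 0 r], of p "p + d" t] by simp
  then show ?thesis by simp
qed

text \<open>The Gaussian contribution of one side of the saddle point, without the factor
  \<open>exp (- N * h_saddle p) / sqrt N\<close>. In the \<open>4\<close>, one factor
  \<open>2\<close> belongs to the half line and the other to \<open>dq = 2 * u * du\<close>; the
  direction of the contour cancels.\<close>

definition saddle_const :: "complex \<Rightarrow> complex" where
  "saddle_const p = of_real (sqrt pi) / (4 * csqrt (- lcs'' p / 2) * csqrt p)"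

lemma Re_lcs''_neg: "norm p < rad \<Longrightarrow> 1 / 12 - 1 / 2000 \<le> Re (- lcs'' p / 2)"
proof -
  assume "norm p < rad"
  then have "\<bar>Re (lcs'' p + 1 / 6)\<bar> \<le> 1 / 1000"
    using lcs''_near abs_Re_le_cmod order_trans by blast
  then show ?thesis unfolding abs_le_iff by simp
qed

lemma saddle_const_nz: "norm p < rad \<Longrightarrow> p \<noteq> 0 \<Longrightarrow> saddle_const p \<noteq> 0"
  using Re_lcs''_neg[of p] by (auto simp: saddle_const_def)

lemma Re_perturb_square:
  assumes "norm x ^ 2 / 2 \<le> Re (x\<^sup>2)" "norm (e - x\<^sup>2 / 12) \<le> norm x ^ 2 / 1000"
  shows "norm x ^ 2 / 30 \<le> Re e"
proof -
  have "\<bar>Re (e - x\<^sup>2 / 12)\<bar> \<le> norm x ^ 2 / 1000" using assms(2) abs_Re_le_cmod order_trans by blast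
  then have "Re (x\<^sup>2) / 12 - norm x ^ 2 / 1000 \<le> Re e" unfolding abs_le_iff by simp
  moreover have "0 \<le> norm x ^ 2" by simp
  ultimately show ?thesis using assms(1) by linarith
qed

text \<open>The contour is a segment in the \<open>q\<close>-plane that leaves the saddle in
  direction \<open>d\<close>. The condition on \<open>d^2\<close> keeps this direction within
  \<open>pi / 6\<close> of the real axis, where the quadratic model wins over its error. The sign
  \<open>\<sigma>\<close> records whether the segment leaves to the right or to the left.\<close>

lemma saddle_segment_limit:
  fixes N :: "nat \<Rightarrow> nat" and p d :: "nat \<Rightarrow> complex"
  assumes N: "filterlim N at_top sequentially" "\<And>n. 0 < N n"
    and lim: "p \<longlonglongrightarrow> p0" "d \<longlonglongrightarrow> d0"
    and ball: "\<And>n. norm (p n) < rad" "\<And>n. norm (p n + d n) < rad" "norm p0 < rad" "p0 \<notin> \<real>\<^sub>\<le>\<^sub>0"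
    and d: "\<And>n. norm (d n) ^ 2 / 2 \<le> Re ((d n)\<^sup>2)" "norm d0 ^ 2 / 2 \<le> Re (d0\<^sup>2)" "0 < \<delta>" "\<And>n. \<delta> \<le> norm (d n)"
    and seg: "\<And>n t. 0 \<le> t \<Longrightarrow> t \<le> 1 \<Longrightarrow> p n + of_real t * d n \<notin> \<real>\<^sub>\<le>\<^sub>0"
      "0 < \<eta>" "\<And>n t. 0 \<le> t \<Longrightarrow> t \<le> 1 \<Longrightarrow> \<eta> \<le> norm (p n + of_real t * d n)"
    and \<sigma>: "\<sigma> = 1 \<or> \<sigma> = - 1" "0 < Re (\<sigma> * d0)"
  shows "(\<lambda>n. of_real (sqrt (N n)) * exp (of_nat (N n) * h_saddle (p n)) *
       (boltzmann_prim (N n) (beta_of (p n)) (csqrt (p n + d n)) - boltzmann_prim (N n) (beta_of (p n)) (csqrt (p n))))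
     \<longlonglongrightarrow> \<sigma> * saddle_const p0"
proof -
  define f where "f = (\<lambda>n t. h_rel (p n) (p n + of_real t * d n) - h_saddle (p n))"
  define g where "g = (\<lambda>n t. d n / (2 * csqrt (p n + of_real t * d n)))"
  define c where "c = csqrt (- lcs'' p0 / 2)"
  \<comment> \<open>The Gaussian formula needs the root of \<open>- lcs'' p0 / 2 * d0^2\<close> in
    the right half plane; the factor \<open>\<sigma>\<close> selects it.\<close>
  define r where "r = c * (\<sigma> * d0)"
  have \<sigma>2: "\<sigma>\<^sup>2 = 1" "\<sigma> \<noteq> 0" using \<sigma>(1) by auto
  have d0: "d0 \<noteq> 0" using \<sigma> by auto
  have c2: "c\<^sup>2 = - lcs'' p0 / 2" by (simp add: c_def)
  have cpos: "0 < Re (- lcs'' p0 / 2)" using Re_lcs''_neg[OF ball(3)] by simp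
  have Rc: "0 < Re c" unfolding c_def by (rule Re_csqrt_pos[OF cpos])
  have Rd: "0 < Re (d0\<^sup>2)" using d(2) d0 by (smt (verit) half_gt_zero zero_less_norm_iff zero_less_power)
  have sd: "(\<sigma> * d0)\<^sup>2 = d0\<^sup>2" by (simp add: power_mult_distrib \<sigma>2)
  have Rr: "0 < Re r" unfolding r_def
    by (rule Re_mult_pos[OF Rc _ \<sigma>(2)]) (use cpos Rd c2 sd in simp_all)
  have r2: "r\<^sup>2 = - lcs'' p0 / 2 * d0\<^sup>2" unfolding r_def power_mult_distrib[of c] c2 sd ..
  have Rr2: "0 < Re (r\<^sup>2)"
  proof -
    have "norm d0 ^ 2 / 30 \<le> Re (r\<^sup>2)"
    proof (rule Re_perturb_square[OF d(2)])
      have "r\<^sup>2 - d0\<^sup>2 / 12 = - (lcs'' p0 + 1 / 6) * (d0\<^sup>2 / 2)" unfolding r2 by (simp add: algebra_simps)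
      also have "norm \<dots> = norm (lcs'' p0 + 1 / 6) * (norm d0 ^ 2 / 2)"
        unfolding norm_mult norm_minus_cancel by (simp add: norm_divide norm_power)
      also have "\<dots> \<le> 1 / 1000 * (norm d0 ^ 2 / 2)" by (intro mult_right_mono lcs''_near ball) auto
      also have "\<dots> \<le> norm d0 ^ 2 / 1000" by simp
      finally show "norm (r\<^sup>2 - d0\<^sup>2 / 12) \<le> norm d0 ^ 2 / 1000" .
    qed
    moreover have "0 < norm d0 ^ 2" using d0 by simp
    ultimately show ?thesis by linarith
  qed
  note inb = segment_in_ball[OF ball(1,2)]
  have tN: "(\<lambda>n. s / sqrt (real (N n))) \<longlonglongrightarrow> 0" for s
    by (intro tendsto_divide_0[OF tendsto_const] filterlim_at_top_imp_at_infinity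
        filterlim_compose[OF sqrt_at_top] filterlim_compose[OF filterlim_real_sequentially] N)
  have lap: "(\<lambda>n. of_real (sqrt (N n)) * (\<integral>t. indicator {0..1} t *\<^sub>R (g n t * exp (- of_nat (N n) * f n t)) \<partial>lborel))
           \<longlonglongrightarrow> (d0 / (2 * csqrt p0)) * (of_real (sqrt pi) / (2 * r))"
  proof (rule laplace_half_line[OF N, where \<kappa> = "\<delta>\<^sup>2 / 30" and C = "1 / sqrt \<eta>"])
    show "0 < \<delta>\<^sup>2 / 30" using d by simp
    show "continuous_on {0..1} (f n)" for n
    proof -
      show ?thesis unfolding f_def h_rel_def using inb
        by (intro continuous_intros continuous_on_lcs) auto
    qed
    show "continuous_on {0..1} (g n)" for n
    proof -
      have "continuous_on {0..1} (\<lambda>t. csqrt (p n + of_real t * d n))"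
        using seg by (intro continuous_on_compose2[OF continuous_on_csqrt] continuous_intros) auto
      moreover have "csqrt (p n + of_real t * d n) \<noteq> 0" if "0 \<le> t" "t \<le> 1" for t
        using seg(1)[OF that, of n] by auto
      ultimately show ?thesis unfolding g_def by (intro continuous_intros) auto
    qed
    show "\<delta>\<^sup>2 / 30 * t\<^sup>2 \<le> Re (f n t)" if t: "0 \<le> t" "t \<le> 1" for n t
    proof -
      let ?x = "of_real t * d n"
      have nx: "norm ?x ^ 2 = t\<^sup>2 * norm (d n) ^ 2" by (simp add: norm_mult power_mult_distrib)
      have "?x\<^sup>2 = of_real (t\<^sup>2) * (d n)\<^sup>2" by (simp add: power_mult_distrib)
      then have Rx: "Re (?x\<^sup>2) = t\<^sup>2 * Re ((d n)\<^sup>2)"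
        by (simp only: Re_complex_of_real Im_complex_of_real times_complex.simps)
      have "norm ?x ^ 2 / 30 \<le> Re (f n t)"
      proof (rule Re_perturb_square)
        show "norm ?x ^ 2 / 2 \<le> Re (?x\<^sup>2)" unfolding nx Rx
          using mult_left_mono[OF d(1)[of n], of "t\<^sup>2"] by simp
        show "norm (f n t - ?x\<^sup>2 / 12) \<le> norm ?x ^ 2 / 1000"
          using h_rel_saddle[OF ball(1)[of n] inb[OF t, of n]] by (simp add: f_def)
      qed
      moreover have "\<delta>\<^sup>2 * t\<^sup>2 \<le> t\<^sup>2 * norm (d n) ^ 2"
        using d(3,4) by (subst mult.commute) (intro mult_left_mono power_mono; auto)
      ultimately show ?thesis unfolding nx by simp
    qed
    show "norm (g n t) \<le> 1 / sqrt \<eta>" if t: "0 \<le> t" "t \<le> 1" for n t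
    proof -
      have "norm (d n) \<le> norm (p n + d n) + norm (p n)" by (metis add_diff_cancel_left' norm_triangle_ineq4)
      then have "norm (d n) \<le> 1" using ball(1)[of n] ball(2)[of n] rad by linarith
      moreover have "sqrt \<eta> \<le> sqrt (norm (p n + of_real t * d n))" using seg(3)[OF t] by simp
      ultimately have "norm (d n) / (2 * sqrt (norm (p n + of_real t * d n))) \<le> 1 / (1 * sqrt \<eta>)"
        using seg(2) by (intro frac_le mult_mono) auto
      then show ?thesis by (simp add: g_def norm_divide norm_mult norm_csqrt)
    qed
    show "(\<lambda>n. g n (s / sqrt (N n))) \<longlonglongrightarrow> d0 / (2 * csqrt p0)" for s
    proof -
      have "(\<lambda>n. p n + of_real (s / sqrt (N n)) * d n) \<longlonglongrightarrow> p0 + of_real 0 * d0"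
        by (intro tendsto_intros lim tN)
      then have "(\<lambda>n. csqrt (p n + of_real (s / sqrt (N n)) * d n)) \<longlonglongrightarrow> csqrt p0"
        using ball(4) by (intro tendsto_csqrt) auto
      then show ?thesis unfolding g_def using ball(4) by (intro tendsto_intros lim) auto
    qed
    show "(\<lambda>n. of_nat (N n) * f n (s / sqrt (N n))) \<longlonglongrightarrow> r\<^sup>2 * of_real s ^ 2" if s: "0 \<le> s" for s
    proof -
      let ?x = "\<lambda>n. of_real (s / sqrt (N n)) * d n"
      \<comment> \<open>After rescaling, the quadratic term is of order one, while \<open>N\<close>
        times the cubic remainder is of order \<open>1 / sqrt N\<close>.\<close>
      have e0: "(\<lambda>n. of_nat (N n) * f n (s / sqrt (N n)) - (- lcs'' (p n) / 2 * (d n)\<^sup>2 * of_real s ^ 2)) \<longlonglongrightarrow> 0"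
      proof (rule Lim_null_comparison)
        have "\<forall>\<^sub>F n in sequentially. s / sqrt (N n) < 1" by (rule order_tendstoD(2)[OF tN]) simp
        then show "\<forall>\<^sub>F n in sequentially. norm (of_nat (N n) * f n (s / sqrt (N n)) - (- lcs'' (p n) / 2 * (d n)\<^sup>2 * of_real s ^ 2))
            \<le> curv * s ^ 2 * norm (d n) ^ 3 * (s / sqrt (N n))"
        proof eventually_elim
          case (elim n)
          have Npos: "0 < real (N n)" using N(2)[of n] by simp
          have t: "0 \<le> s / sqrt (N n)" "s / sqrt (N n) \<le> 1" using s elim by auto
          have sq: "complex_of_real (s / sqrt (N n)) ^ 2 = of_real s ^ 2 / of_nat (N n)"
          proof -
            have "(s / sqrt (N n)) ^ 2 = s ^ 2 / N n" by (simp add: power_divide)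
            then show ?thesis by (metis of_real_divide of_real_of_nat_eq of_real_power)
          qed
          have "of_nat (N n) * f n (s / sqrt (N n)) - (- lcs'' (p n) / 2 * (d n)\<^sup>2 * of_real s ^ 2)
             = of_nat (N n) * (f n (s / sqrt (N n)) + lcs'' (p n) * (?x n)\<^sup>2 / 2)"
            unfolding power_mult_distrib sq using N(2)[of n] by (simp add: field_simps)
          also have "norm \<dots> \<le> real (N n) * (curv * norm (?x n) ^ 3)"
          proof -
            have "norm (of_nat (N n) * Y) \<le> real (N n) * B" if "norm Y \<le> B" for Y :: complex and B
              using that by (simp add: norm_mult mult_left_mono)
            moreover have "norm (f n (s / sqrt (N n)) + lcs'' (p n) * (?x n)\<^sup>2 / 2) \<le> curv * norm (?x n) ^ 3"
              using h_rel_saddle3[OF ball(1)[of n] inb[OF t, of n]] by (simp only: f_def add_diff_cancel_left')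
            ultimately show ?thesis by blast
          qed
          also have "\<dots> = curv * s ^ 2 * norm (d n) ^ 3 * (s / sqrt (N n))"
          proof -
            have "norm (?x n) ^ 3 = (s / sqrt (N n)) ^ 3 * norm (d n) ^ 3"
              using s by (simp add: norm_mult norm_divide power_mult_distrib power_divide)
            moreover have "(s / sqrt (N n)) ^ 3 = s ^ 2 / N n * (s / sqrt (N n))"
              by (simp add: power3_eq_cube power_divide power2_eq_square)
            ultimately show ?thesis using Npos by simp
          qed
          finally show ?case .
        qed
        have "(\<lambda>n. curv * s ^ 2 * norm (d n) ^ 3 * (s / sqrt (N n))) \<longlonglongrightarrow> curv * s ^ 2 * norm d0 ^ 3 * 0"
          by (intro tendsto_intros lim tN)
        then show "(\<lambda>n. curv * s ^ 2 * norm (d n) ^ 3 * (s / sqrt (N n))) \<longlonglongrightarrow> 0" by simp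
      qed
      have "(\<lambda>n. - lcs'' (p n) / 2 * (d n)\<^sup>2 * of_real s ^ 2) \<longlonglongrightarrow> r\<^sup>2 * of_real s ^ 2"
        unfolding r2 by (intro tendsto_intros tendsto_lcs lim ball)  simp
      from tendsto_add[OF e0 this] show ?thesis by simp
    qed
  qed (use Rr Rr2 in auto)
  have "of_real (sqrt (N n)) * exp (of_nat (N n) * h_saddle (p n)) *
       (boltzmann_prim (N n) (beta_of (p n)) (csqrt (p n + d n)) - boltzmann_prim (N n) (beta_of (p n)) (csqrt (p n)))
    = of_real (sqrt (N n)) * (\<integral>t. indicator {0..1} t *\<^sub>R (g n t * exp (- of_nat (N n) * f n t)) \<partial>lborel)" for n
  proof -
    have "exp (of_nat (N n) * h_saddle (p n)) *
       (boltzmann_prim (N n) (beta_of (p n)) (csqrt (p n + d n)) - boltzmann_prim (N n) (beta_of (p n)) (csqrt (p n)))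
      = (\<integral>t. exp (of_nat (N n) * h_saddle (p n)) * (indicator {0..1} t *\<^sub>R
          (g n t * boltzmann (N n) (beta_of (p n)) (csqrt (p n + of_real t * d n)))) \<partial>lborel)"
      by (simp only: boltzmann_prim_segment[OF beta_of_nz[OF ball(1)] N(2) seg(1)] integral_mult_right_zero g_def)
    also have "\<dots> = (\<integral>t. indicator {0..1} t *\<^sub>R (g n t * exp (- of_nat (N n) * f n t)) \<partial>lborel)"
    proof (intro Bochner_Integration.integral_cong refl)
      fix t :: real
      show "exp (of_nat (N n) * h_saddle (p n)) * (indicator {0..1} t *\<^sub>R
          (g n t * boltzmann (N n) (beta_of (p n)) (csqrt (p n + of_real t * d n))))
         = indicator {0..1} t *\<^sub>R (g n t * exp (- of_nat (N n) * f n t))"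
      proof (cases "0 \<le> t \<and> t \<le> 1")
        case True
        then have "boltzmann (N n) (beta_of (p n)) (csqrt (p n + of_real t * d n)) = exp (- of_nat (N n) * h_rel (p n) (p n + of_real t * d n))"
          using boltzmann_eq[OF ball(1)[of n], of "csqrt (p n + of_real t * d n)" "N n"] inb[of t n] by simp
        then show ?thesis using True by (simp add: f_def algebra_simps flip: exp_add)
      qed auto
    qed
    finally show ?thesis by (simp add: mult.assoc)
  qed
  moreover have "(d0 / (2 * csqrt p0)) * (of_real (sqrt pi) / (2 * r)) = \<sigma> * saddle_const p0"
    using d0 \<sigma>(1) by (auto simp: r_def c_def saddle_const_def)
  ultimately show ?thesis using lap by (simp only:)
qed

text \<open>The origin is a critical point of \<open>h\<close> in the variable \<open>u\<close>, so
  the ray is parametrised by \<open>u = t * csqrt e\<close>, that is \<open>q = t^2 * e\<close>; in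
  the \<open>q\<close>-plane the integrand would be singular there. The lower bound on the real part
  is a hypothesis because its proof depends on the sector.\<close>

lemma origin_ray_limit:
  fixes N :: "nat \<Rightarrow> nat" and p e :: "nat \<Rightarrow> complex"
  assumes N: "filterlim N at_top sequentially" "\<And>n. 0 < N n"
    and lim: "p \<longlonglongrightarrow> p0" "e \<longlonglongrightarrow> e0"
    and ball: "\<And>n. norm (p n) < rad" "\<And>n. norm (e n) < rad" "norm p0 < rad" "e0 \<notin> \<real>\<^sub>\<le>\<^sub>0"
    and \<kappa>: "0 < \<kappa>" "\<And>n t. 0 \<le> t \<Longrightarrow> t \<le> 1 \<Longrightarrow> \<kappa> * t\<^sup>2 \<le> Re (h_rel (p n) (of_real (t\<^sup>2) * e n))"
  shows "(\<lambda>n. of_real (sqrt (N n)) * boltzmann_prim (N n) (beta_of (p n)) (csqrt (e n)))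
     \<longlonglongrightarrow> csqrt e0 * (of_real (sqrt pi) / (2 * csqrt ((lcs' p0 - 1 / 2) * e0)))"
    and "(lcs' p0 - 1 / 2) * e0 \<noteq> 0"
proof -
  define f where "f = (\<lambda>n t. h_rel (p n) (of_real (t\<^sup>2) * e n))"
  define r where "r = csqrt ((lcs' p0 - 1 / 2) * e0)"
  have r2: "r\<^sup>2 = (lcs' p0 - 1 / 2) * e0" by (simp add: r_def)
  have inb: "norm (of_real (t\<^sup>2) * e n) < rad" if "0 \<le> t" "t \<le> 1" for t n
  proof -
    have "t\<^sup>2 \<le> 1" using that by (simp add: power_le_one)
    then have "norm (of_real (t\<^sup>2) * e n) \<le> 1 * norm (e n)"
      unfolding norm_mult norm_of_real by (intro mult_right_mono) auto
    then show ?thesis using ball(2)[of n] by simp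
  qed
  have tN: "(\<lambda>n. s / sqrt (real (N n))) \<longlonglongrightarrow> 0" for s
    by (intro tendsto_divide_0[OF tendsto_const] filterlim_at_top_imp_at_infinity
        filterlim_compose[OF sqrt_at_top] filterlim_compose[OF filterlim_real_sequentially] N)
  have tN1: "(\<lambda>n. s / real (N n)) \<longlonglongrightarrow> 0" for s
    by (intro tendsto_divide_0[OF tendsto_const] filterlim_at_top_imp_at_infinity
        filterlim_compose[OF filterlim_real_sequentially] N)
  have limf: "(\<lambda>n. of_nat (N n) * f n (s / sqrt (N n))) \<longlonglongrightarrow> r\<^sup>2 * of_real s ^ 2" if s: "0 \<le> s" for s
  proof -
    have sq: "(s / sqrt (N n))\<^sup>2 = s\<^sup>2 / N n" for n by (simp add: power_divide)
    have eq: "of_nat (N n) * f n (s / sqrt (N n)) = of_real s ^ 2 * e n * lcs' (p n) - of_nat (N n) * lcs (of_real (s\<^sup>2 / N n) * e n)" for n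
      unfolding f_def h_rel_def sq using N(2)[of n] by (simp add: field_simps)
    have e0: "(\<lambda>n. of_nat (N n) * lcs (of_real (s\<^sup>2 / N n) * e n) - of_real s ^ 2 * e n / 2) \<longlonglongrightarrow> 0"
    proof (rule Lim_null_comparison)
      have "\<forall>\<^sub>F n in sequentially. s / sqrt (N n) < 1" by (rule order_tendstoD(2)[OF tN]) simp
      then show "\<forall>\<^sub>F n in sequentially. norm (of_nat (N n) * lcs (of_real (s\<^sup>2 / N n) * e n) - of_real s ^ 2 * e n / 2)
          \<le> s\<^sup>2 * norm (e n) ^ 2 * (s\<^sup>2 / N n)"
      proof eventually_elim
        case (elim n)
        define z where "z = of_real (s\<^sup>2 / N n) * e n"
        have Npos: "0 < real (N n)" using N(2)[of n] by simp
        have t: "0 \<le> s / sqrt (N n)" "s / sqrt (N n) \<le> 1" using s elim by auto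
        have zb: "norm z < rad" using inb[OF t, of n] unfolding sq z_def .
        have "norm (lcs z - z / 2) \<le> norm (lcs z - lcs 0 - lcs' 0 * (z - 0) + (z - 0)\<^sup>2 / 12) + norm (z\<^sup>2 / 12)"
          using norm_triangle_ineq4[of "lcs z - lcs 0 - lcs' 0 * (z - 0) + (z - 0)\<^sup>2 / 12" "z\<^sup>2 / 12"]
          by (simp add: lcs_at_0)
        also have "\<dots> \<le> norm (z - 0) ^ 2 / 1000 + norm z ^ 2 / 12"
          using rad zb by (intro add_mono lcs_approx) (auto simp: norm_divide norm_power)
        also have "\<dots> \<le> norm z ^ 2" by simp
        finally have lz: "norm (lcs z - z / 2) \<le> norm z ^ 2" .
        have "of_nat (N n) * lcs z - of_real s ^ 2 * e n / 2 = of_nat (N n) * (lcs z - z / 2)"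
          using Npos by (simp add: z_def field_simps)
        also have "norm \<dots> \<le> real (N n) * norm z ^ 2"
          unfolding norm_mult norm_of_nat using lz by (intro mult_left_mono) auto
        also have "\<dots> = s\<^sup>2 * norm (e n) ^ 2 * (s\<^sup>2 / N n)"
          using Npos by (simp add: z_def norm_mult norm_divide norm_power power_mult_distrib power_divide power2_eq_square)
        finally show ?case by (simp add: z_def)
      qed
      have "(\<lambda>n. s\<^sup>2 * norm (e n) ^ 2 * (s\<^sup>2 / N n)) \<longlonglongrightarrow> s\<^sup>2 * norm e0 ^ 2 * 0"
        by (intro tendsto_intros lim tN1)
      then show "(\<lambda>n. s\<^sup>2 * norm (e n) ^ 2 * (s\<^sup>2 / N n)) \<longlonglongrightarrow> 0" by simp
    qed
    have "(\<lambda>n. of_real s ^ 2 * e n * lcs' (p n) - of_real s ^ 2 * e n / 2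
           - (of_nat (N n) * lcs (of_real (s\<^sup>2 / N n) * e n) - of_real s ^ 2 * e n / 2))
       \<longlonglongrightarrow> of_real s ^ 2 * e0 * lcs' p0 - of_real s ^ 2 * e0 / 2 - 0"
      by (intro tendsto_diff e0 tendsto_intros tendsto_lcs lim ball) simp
    then show ?thesis unfolding eq r2 by (simp add: algebra_simps)
  qed
  \<comment> \<open>At \<open>s = 1\<close> the lower bound, multiplied by \<open>N n\<close>,
    survives the limit and puts \<open>r^2\<close> into the right half plane. This gives both the
    branch of the root and the second conclusion.\<close>
  have "\<kappa> \<le> Re (r\<^sup>2 * of_real 1 ^ 2)"
  proof (rule tendsto_lowerbound[OF tendsto_Re[OF limf[of 1]]])
    show "\<forall>\<^sub>F n in sequentially. \<kappa> \<le> Re (of_nat (N n) * f n (1 / sqrt (N n)))"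
    proof (rule always_eventually, rule allI)
      fix n
      have Npos: "1 \<le> real (N n)" using N(2)[of n] by linarith
      have "\<kappa> * (1 / sqrt (N n))\<^sup>2 \<le> Re (f n (1 / sqrt (N n)))"
        unfolding f_def using Npos by (intro \<kappa>) auto
      then have "real (N n) * (\<kappa> * (1 / sqrt (N n))\<^sup>2) \<le> real (N n) * Re (f n (1 / sqrt (N n)))"
        by (intro mult_left_mono) auto
      moreover have "real (N n) * (\<kappa> * (1 / sqrt (N n))\<^sup>2) = \<kappa>" using Npos by (simp add: power_divide)
      ultimately show "\<kappa> \<le> Re (of_nat (N n) * f n (1 / sqrt (N n)))" by simp
    qed
  qed auto
  then have Rr2: "0 < Re (r\<^sup>2)" using \<kappa> by simp
  then have Rr: "0 < Re r" unfolding r2 unfolding r_def by (rule Re_csqrt_pos)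
  show "(lcs' p0 - 1 / 2) * e0 \<noteq> 0" using Rr2 unfolding r2 by (metis zero_complex.sel(1) less_irrefl)
  have lap: "(\<lambda>n. of_real (sqrt (N n)) * (\<integral>t. indicator {0..1} t *\<^sub>R (csqrt (e n) * exp (- of_nat (N n) * f n t)) \<partial>lborel))
           \<longlonglongrightarrow> csqrt e0 * (of_real (sqrt pi) / (2 * r))"
  proof (rule laplace_half_line[OF N, where \<kappa> = \<kappa> and C = 1])
    show "continuous_on {0..1} (f n)" for n
    proof -
      show ?thesis unfolding f_def h_rel_def using inb
        by (intro continuous_intros continuous_on_lcs) auto
    qed
    show "norm (csqrt (e n)) \<le> 1" for n using ball(2)[of n] rad by (simp add: norm_csqrt)
    show "(\<lambda>n. csqrt (e n)) \<longlonglongrightarrow> csqrt e0" by (intro tendsto_csqrt lim ball)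
  qed (use Rr Rr2 \<kappa> limf in \<open>auto simp: f_def\<close>)
  moreover have "of_real (sqrt (N n)) * boltzmann_prim (N n) (beta_of (p n)) (csqrt (e n))
    = of_real (sqrt (N n)) * (\<integral>t. indicator {0..1} t *\<^sub>R (csqrt (e n) * exp (- of_nat (N n) * f n t)) \<partial>lborel)" for n
  proof -
    have "boltzmann_prim (N n) (beta_of (p n)) (csqrt (e n)) = (\<integral>t. indicator {0..1} t *\<^sub>R (csqrt (e n) * exp (- of_nat (N n) * f n t)) \<partial>lborel)"
      unfolding boltzmann_prim_ray[OF beta_of_nz[OF ball(1)] N(2)]
    proof (intro Bochner_Integration.integral_cong refl)
      fix t :: real
      show "indicator {0..1} t *\<^sub>R (csqrt (e n) * boltzmann (N n) (beta_of (p n)) (of_real t * csqrt (e n)))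
         = indicator {0..1} t *\<^sub>R (csqrt (e n) * exp (- of_nat (N n) * f n t))"
      proof (cases "0 \<le> t \<and> t \<le> 1")
        case True
        have "(of_real t * csqrt (e n))\<^sup>2 = of_real (t\<^sup>2) * e n" by (simp add: power_mult_distrib)
        then have "boltzmann (N n) (beta_of (p n)) (of_real t * csqrt (e n)) = exp (- of_nat (N n) * f n t)"
          using boltzmann_eq[OF ball(1)[of n], of "of_real t * csqrt (e n)" "N n"] inb[of t n] True unfolding f_def by simp
        then show ?thesis by simp
      qed auto
    qed
    then show ?thesis by simp
  qed
  ultimately show "(\<lambda>n. of_real (sqrt (N n)) * boltzmann_prim (N n) (beta_of (p n)) (csqrt (e n)))
     \<longlonglongrightarrow> csqrt e0 * (of_real (sqrt pi) / (2 * csqrt ((lcs' p0 - 1 / 2) * e0)))"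
    by (simp only: r_def)
qed

lemma sqrt_exp_decay:
  fixes X :: "nat \<Rightarrow> complex"
  assumes N: "filterlim N at_top sequentially" and \<kappa>: "0 < \<kappa>"
    and X: "\<And>n. norm (X n) \<le> A * exp (- real (N n) * \<kappa>)"
  shows "(\<lambda>n. of_real (sqrt (N n)) * X n) \<longlonglongrightarrow> 0"
proof (rule Lim_null_comparison)
  show "\<forall>\<^sub>F n in sequentially. norm (of_real (sqrt (N n)) * X n) \<le> sqrt (N n) * (A * exp (- real (N n) * \<kappa>))"
    unfolding norm_mult by (intro always_eventually allI mult_mono X) auto
  have "((\<lambda>x. sqrt x * (A * exp (- x * \<kappa>))) \<longlongrightarrow> 0) at_top"
    using \<kappa> by real_asymp
  from filterlim_compose[OF this filterlim_compose[OF filterlim_real_sequentially N]]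
  show "(\<lambda>n. sqrt (N n) * (A * exp (- real (N n) * \<kappa>))) \<longlonglongrightarrow> 0" .
qed

text \<open>If the bounds failed for all constants, violations with \<open>C = N0 = m + 1\<close>
  for each \<open>m\<close> would form sequences, and a convergent subsequence would contradict a
  finite nonzero limit. Uniformity is thus obtained from limits along arbitrary sequences, without a
  rate.\<close>

lemma compact_uniform_bounds:
  fixes X :: "nat \<Rightarrow> complex \<Rightarrow> complex"
  assumes K: "compact K"
    and lim: "\<And>N p p0. filterlim N at_top sequentially \<Longrightarrow> (\<And>n. 0 < N n) \<Longrightarrow> (\<And>n. p n \<in> K) \<Longrightarrow> p0 \<in> K \<Longrightarrow>
       p \<longlonglongrightarrow> p0 \<Longrightarrow> (\<lambda>n. X (N n) (p n)) \<longlonglongrightarrow> l p0"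
    and nz: "\<And>p. p \<in> K \<Longrightarrow> l p \<noteq> 0"
  shows "\<exists>C\<ge>1. \<exists>N0. \<forall>N\<ge>N0. \<forall>p\<in>K. 1 / C \<le> norm (X N p) \<and> norm (X N p) \<le> C"
proof (rule ccontr)
  assume neg: "\<not> ?thesis"
  have "\<exists>N p. Suc m \<le> N \<and> p \<in> K \<and> \<not> (1 / real (Suc m) \<le> norm (X N p) \<and> norm (X N p) \<le> real (Suc m))" for m
  proof (rule ccontr)
    assume "\<not> ?thesis"
    then have "\<forall>N\<ge>Suc m. \<forall>p\<in>K. 1 / real (Suc m) \<le> norm (X N p) \<and> norm (X N p) \<le> real (Suc m)" by blast
    moreover have "1 \<le> real (Suc m)" by simp
    ultimately show False using neg by blast
  qed
  then obtain N p where Np: "\<And>m. Suc m \<le> N m" "\<And>m. p m \<in> K"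
    "\<And>m. \<not> (1 / real (Suc m) \<le> norm (X (N m) (p m)) \<and> norm (X (N m) (p m)) \<le> real (Suc m))"
    by metis
  obtain p0 s where s: "p0 \<in> K" "strict_mono s" "(p \<circ> s) \<longlonglongrightarrow> p0"
    using K Np(2) unfolding compact_def by blast
  have smf: "filterlim s at_top sequentially" by (rule filterlim_subseq[OF s(2)])
  have "filterlim N at_top sequentially"
    by (rule filterlim_at_top_mono[OF filterlim_ident]) (use Np(1) in \<open>auto intro!: always_eventually simp: Suc_leD\<close>)
  from filterlim_compose[OF this smf] have "filterlim (\<lambda>n. N (s n)) at_top sequentially" .
  then have "(\<lambda>n. X (N (s n)) ((p \<circ> s) n)) \<longlonglongrightarrow> l p0"
    using Np(1,2) s by (intro lim) (auto simp: o_def intro: order_less_le_trans[OF zero_less_Suc])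
  then have L: "(\<lambda>n. norm (X (N (s n)) (p (s n)))) \<longlonglongrightarrow> norm (l p0)"
    unfolding o_def by (rule tendsto_norm)
  have l: "0 < norm (l p0)" using nz s by simp
  have big: "filterlim (\<lambda>n. real (Suc (s n))) at_top sequentially"
    using filterlim_compose[OF filterlim_real_sequentially filterlim_compose[OF filterlim_Suc smf]] by simp
  have inv: "(\<lambda>n. 1 / real (Suc (s n))) \<longlonglongrightarrow> 0"
    by (intro tendsto_divide_0[OF tendsto_const] filterlim_at_top_imp_at_infinity big)
  have "\<forall>\<^sub>F n in sequentially. norm (l p0) + 1 \<le> real (Suc (s n))"
    using big unfolding filterlim_at_top by blast
  moreover have "\<forall>\<^sub>F n in sequentially. norm (X (N (s n)) (p (s n))) < norm (l p0) + 1"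
    "\<forall>\<^sub>F n in sequentially. norm (l p0) / 2 < norm (X (N (s n)) (p (s n)))"
    "\<forall>\<^sub>F n in sequentially. 1 / real (Suc (s n)) < norm (l p0) / 2"
    using order_tendstoD(2)[OF L, of "norm (l p0) + 1"] order_tendstoD(1)[OF L, of "norm (l p0) / 2"]
      order_tendstoD(2)[OF inv, of "norm (l p0) / 2"] l by auto
  ultimately have "\<forall>\<^sub>F n in sequentially. False"
  proof eventually_elim
    case (elim n)
    then show ?case using Np(3)[of "s n"] by linarith
  qed
  then show False by simp
qed

text \<open>The contour returns to the real axis at \<open>sqrt (100000 * norm p)\<close>: beyond that point the quartic
  term of \<open>ln_cosh_le\<close> dominates, see \<open>boltzmann_real_le\<close>.\<close>

definition far :: "complex \<Rightarrow> complex" where "far p = of_real (100000 * norm p)"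
text \<open>The factor leaves room in the disc of radius \<open>rad\<close> for auxiliary contour
  points of norm up to \<open>112500 * norm p\<close>.\<close>

definition rad1 :: real where "rad1 = rad / 1000000"

lemma rad1: "0 < rad1" "rad1 < rad" "rad1 < 1"
  using rad by (auto simp: rad1_def)

lemma norm_far: "norm p < rad1 \<Longrightarrow> norm (far p) < rad"
proof -
  assume "norm p < rad1"
  moreover have "norm (far p) = 100000 * norm p" by (simp add: far_def norm_mult)
  ultimately show ?thesis unfolding rad1_def using norm_ge_zero[of p] by linarith
qed

lemma norm_h_saddle_le: "norm p < rad \<Longrightarrow> norm (h_saddle p) \<le> norm p ^ 2 / 6"
proof -
  assume p: "norm p < rad"
  have "norm (h_saddle p) \<le> norm (h_saddle p + p\<^sup>2 / 12) + norm (p\<^sup>2 / 12)"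
    using norm_triangle_ineq4[of "h_saddle p + p\<^sup>2 / 12" "p\<^sup>2 / 12"] by simp
  also have "\<dots> \<le> norm p ^ 2 / 1000 + norm p ^ 2 / 12"
    using h_saddle_approx[OF p] by (simp add: norm_divide norm_power)
  also have "\<dots> \<le> norm p ^ 2 / 6" by simp
  finally show ?thesis .
qed

text \<open>The rate \<open>100000 * norm p ^ 2\<close> far exceeds
  \<open>norm (h_saddle p)\<close>, which is at most \<open>norm p ^ 2 / 6\<close>; the tail stays
  negligible after multiplication by \<open>exp (N * h_saddle p)\<close>.\<close>

lemma far_tail:
  assumes p: "norm p < rad1" "0 < \<eta>" "\<eta> \<le> norm p" and N: "N > 0"
  shows "norm (boltzmann_total N (beta_of p) - boltzmann_prim N (beta_of p) (csqrt (far p)))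
     \<le> 1 / (\<eta> * sqrt \<eta>) * exp (- real N * (100000 * norm p ^ 2))"
proof -
  define x where "x = sqrt (100000 * norm p)"
  have x: "0 < x" "x\<^sup>2 = 100000 * norm p" "csqrt (far p) = of_real x"
    using p unfolding x_def far_def by (auto simp del: of_real_mult of_real_numeral)
  have "norm (boltzmann_total N (beta_of p) - boltzmann_prim N (beta_of p) (csqrt (far p)))
      \<le> exp (- real N * norm p * x\<^sup>2) / (real N * norm p * x)"
    unfolding x(3) using p rad1 x N by (intro boltzmann_tail) auto
  also have "\<dots> = 1 / (real N * norm p * x) * exp (- real N * (100000 * norm p ^ 2))"
  proof -
    have "- real N * norm p * x\<^sup>2 = - real N * (100000 * norm p ^ 2)"
      unfolding x(2) by (simp add: power2_eq_square)
    then show ?thesis by (simp only:) simp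
  qed
  also have "\<dots> \<le> 1 / (1 * \<eta> * sqrt \<eta>) * exp (- real N * (100000 * norm p ^ 2))"
  proof (intro mult_right_mono frac_le mult_mono)
    show "sqrt \<eta> \<le> x" unfolding x_def using p by simp
  qed (use p N in auto)
  finally show ?thesis by simp
qed

lemma exp_norm_le: "norm (exp (of_nat N * z)) \<le> exp (real N * norm z)" for z :: complex
  using mult_left_mono[OF complex_Re_le_cmod[of z], of "real N"] by simp

lemma power2_norm_complex: "norm z ^ 2 = Re z ^ 2 + Im z ^ 2" for z :: complex
  by (simp add: cmod_power2)

text \<open>The right half of the saddle: the contour runs straight to \<open>far p\<close>, which
  gives the Gaussian constant, and then along the real axis, which is exponentially smaller.
  Positive real parts keep the segment off the cut of \<open>csqrt\<close>.\<close>

lemma total_minus_saddle_limit: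
  fixes N :: "nat \<Rightarrow> nat" and p :: "nat \<Rightarrow> complex"
  assumes N: "filterlim N at_top sequentially" "\<And>n. 0 < N n"
    and lim: "p \<longlonglongrightarrow> p0"
    and p: "\<And>n. norm (p n) < rad1" "\<And>n. \<eta> \<le> Re (p n)" "norm p0 < rad1" "\<eta> \<le> Re p0" "0 < \<eta>"
  shows "(\<lambda>n. of_real (sqrt (N n)) * (exp (of_nat (N n) * h_saddle (p n)) *
       (boltzmann_total (N n) (beta_of (p n)) - boltzmann_prim (N n) (beta_of (p n)) (csqrt (p n)))))
     \<longlonglongrightarrow> saddle_const p0"
proof -
  \<comment> \<open>As \<open>far z\<close> is \<open>100000\<close> times as long as
    \<open>z\<close>, the direction \<open>far z - z\<close> is almost real whatever the argument of
    \<open>z\<close>.\<close>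
  have far: "norm z ^ 2 * (99999::real)\<^sup>2 \<le> norm (far z - z) ^ 2" "norm (far z - z) ^ 2 / 2 \<le> Re ((far z - z)\<^sup>2)"
    "0 < Re (far z - z)" if "\<eta> \<le> Re z" for z
  proof -
    have z: "0 < norm z" "Re z \<le> norm z" "\<bar>Im z\<bar> \<le> norm z"
      using that p(5) complex_Re_le_cmod[of z] abs_Im_le_cmod[of z] by auto
    have R: "99999 * norm z \<le> Re (far z - z)" using z by (simp add: far_def)
    then show "0 < Re (far z - z)" using z by linarith
    have a1: "n * 99999\<^sup>2 \<le> A + I" if "99999\<^sup>2 * n \<le> A" "I \<le> n" "0 \<le> I" for n A I :: real
      using that by simp
    have a2: "(A + I) / 2 \<le> A - I" if "99999\<^sup>2 * n \<le> A" "I \<le> n" "0 \<le> I" for n A I :: real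
      using that by simp
    have f1: "99999\<^sup>2 * (norm z)\<^sup>2 \<le> (Re (far z - z))\<^sup>2"
      using R by (simp only: power_mult_distrib[symmetric]) (intro power_mono; simp)
    have f2: "(Im (far z - z))\<^sup>2 \<le> (norm z)\<^sup>2" "0 \<le> (Im (far z - z))\<^sup>2"
      using z by (simp_all add: far_def abs_le_square_iff[symmetric])
    show "norm z ^ 2 * (99999::real)\<^sup>2 \<le> norm (far z - z) ^ 2" "norm (far z - z) ^ 2 / 2 \<le> Re ((far z - z)\<^sup>2)"
      unfolding power2_norm_complex[of "far z - z"] Re_power2
      using a1[OF f1 f2] a2[OF f1 f2] by blast+
  qed
  have pn: "\<eta> \<le> norm (p n)" for n using p(2)[of n] complex_Re_le_cmod[of "p n"] by linarith
  have Rseg: "\<eta> \<le> Re (p n + of_real t * (far (p n) - p n))" if "0 \<le> t" "t \<le> 1" for n t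
  proof -
    have "\<eta> \<le> 100000 * norm (p n)" using pn[of n] p(5) by linarith
    then have "\<eta> * t \<le> 100000 * norm (p n) * t" "\<eta> * (1 - t) \<le> Re (p n) * (1 - t)"
      using that p(2)[of n] by (intro mult_right_mono; simp)+
    then show ?thesis by (simp add: far_def algebra_simps)
  qed
  have "(\<lambda>n. of_real (sqrt (N n)) * exp (of_nat (N n) * h_saddle (p n)) *
       (boltzmann_prim (N n) (beta_of (p n)) (csqrt (p n + (far (p n) - p n))) - boltzmann_prim (N n) (beta_of (p n)) (csqrt (p n))))
     \<longlonglongrightarrow> 1 * saddle_const p0"
  proof (rule saddle_segment_limit[OF N lim, where \<eta> = \<eta> and \<delta> = "99999 * \<eta>"])
    show "(\<lambda>n. far (p n) - p n) \<longlonglongrightarrow> far p0 - p0"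
      unfolding far_def by (intro tendsto_intros lim)
    show "norm (p n) < rad" "norm p0 < rad" for n using p(1)[of n] p(3) rad1 by linarith+
    show "norm (p n + (far (p n) - p n)) < rad" for n using norm_far[OF p(1)] by simp
    show "99999 * \<eta> \<le> norm (far (p n) - p n)" for n
    proof (rule power2_le_imp_le)
      have "\<eta>\<^sup>2 \<le> (norm (p n))\<^sup>2" using pn p(5) by (intro power_mono) auto
      then show "(99999 * \<eta>)\<^sup>2 \<le> (norm (far (p n) - p n))\<^sup>2"
        using far(1)[OF p(2)[of n]] by (simp add: power_mult_distrib)
    qed auto
    show "p n + of_real t * (far (p n) - p n) \<notin> \<real>\<^sub>\<le>\<^sub>0" if "0 \<le> t" "t \<le> 1" for n t
      using Rseg[OF that, of n] p(5) by (intro not_nonpos_Reals_if) linarith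
    show "\<eta> \<le> norm (p n + of_real t * (far (p n) - p n))" if "0 \<le> t" "t \<le> 1" for n t
      using Rseg[OF that, of n] complex_Re_le_cmod order_trans by blast
  qed (use far p in \<open>auto intro!: not_nonpos_Reals_if\<close>)
  then have A: "(\<lambda>n. of_real (sqrt (N n)) * (exp (of_nat (N n) * h_saddle (p n)) *
       (boltzmann_prim (N n) (beta_of (p n)) (csqrt (far (p n))) - boltzmann_prim (N n) (beta_of (p n)) (csqrt (p n)))))
     \<longlonglongrightarrow> saddle_const p0" by (simp add: mult.assoc)
  have B: "(\<lambda>n. of_real (sqrt (N n)) * (exp (of_nat (N n) * h_saddle (p n)) *
       (boltzmann_total (N n) (beta_of (p n)) - boltzmann_prim (N n) (beta_of (p n)) (csqrt (far (p n))))))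
     \<longlonglongrightarrow> 0"
  proof (rule sqrt_exp_decay[OF N(1), where \<kappa> = "\<eta>\<^sup>2"])
    fix n
    have r: "norm (p n) < rad" using p(1)[of n] rad1 by linarith
    have "norm (exp (of_nat (N n) * h_saddle (p n)) *
       (boltzmann_total (N n) (beta_of (p n)) - boltzmann_prim (N n) (beta_of (p n)) (csqrt (far (p n)))))
       \<le> exp (real (N n) * (norm (p n) ^ 2 / 6)) * (1 / (\<eta> * sqrt \<eta>) * exp (- real (N n) * (100000 * norm (p n) ^ 2)))"
      unfolding norm_mult
    proof (intro mult_mono far_tail p pn N order_trans[OF exp_norm_le])
      show "exp (real (N n) * norm (h_saddle (p n))) \<le> exp (real (N n) * (norm (p n) ^ 2 / 6))"
        unfolding exp_le_cancel_iff by (intro mult_left_mono norm_h_saddle_le r) simp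
    qed auto
    also have "\<dots> = 1 / (\<eta> * sqrt \<eta>) * exp (real (N n) * (norm (p n) ^ 2 / 6 - 100000 * norm (p n) ^ 2))"
      by (simp add: exp_add[symmetric] algebra_simps)
    also have "\<dots> \<le> 1 / (\<eta> * sqrt \<eta>) * exp (- real (N n) * \<eta>\<^sup>2)"
    proof (intro mult_left_mono)
      have "\<eta>\<^sup>2 \<le> norm (p n) ^ 2" using pn p(5) by (intro power_mono) auto
      then have "norm (p n) ^ 2 / 6 - 100000 * norm (p n) ^ 2 \<le> - \<eta>\<^sup>2"
        using zero_le_power2[of \<eta>] by linarith
      then have "real (N n) * (norm (p n) ^ 2 / 6 - 100000 * norm (p n) ^ 2) \<le> real (N n) * (- \<eta>\<^sup>2)"
        by (rule mult_left_mono) simp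
      then show "exp (real (N n) * (norm (p n) ^ 2 / 6 - 100000 * norm (p n) ^ 2)) \<le> exp (- real (N n) * \<eta>\<^sup>2)"
        by simp
    qed (use p in auto)
    finally show "norm (exp (of_nat (N n) * h_saddle (p n)) *
       (boltzmann_total (N n) (beta_of (p n)) - boltzmann_prim (N n) (beta_of (p n)) (csqrt (far (p n)))))
       \<le> 1 / (\<eta> * sqrt \<eta>) * exp (- real (N n) * \<eta>\<^sup>2)" .
  qed (use p in auto)
  from tendsto_add[OF A B] show ?thesis by (simp add: algebra_simps)
qed

text \<open>The three sectors of the upper half plane overlap; their slopes are chosen such that all sign
  conditions along the contours become polynomial inequalities with rational coefficients.\<close>

definition near_set :: "real \<Rightarrow> real \<Rightarrow> complex set" where
  "near_set \<eta> \<rho> = {p. \<eta> \<le> Re p \<and> Re p \<le> 3 * Im p \<and> Im p \<le> 3 * Re p \<and> norm p \<le> \<rho>}"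
definition inner_set :: "real \<Rightarrow> real \<Rightarrow> complex set" where
  "inner_set \<eta> \<rho> = {p. \<eta> \<le> Re p \<and> 0 \<le> Im p \<and> 2 * Im p \<le> Re p \<and> norm p \<le> \<rho>}"
definition outer_set :: "real \<Rightarrow> real \<Rightarrow> complex set" where
  "outer_set \<eta> \<rho> = {p. \<eta> \<le> norm p \<and> 0 \<le> Im p \<and> 2 * Re p \<le> (4 / 5) * Im p \<and> norm p \<le> \<rho>}"

lemma compact_closed_bounded: "closed S \<Longrightarrow> S \<subseteq> cball 0 r \<Longrightarrow> compact (S :: complex set)"
  using compact_eq_bounded_closed bounded_subset bounded_cball by blast

lemma compact_regions: "compact (near_set \<eta> \<rho>)" "compact (inner_set \<eta> \<rho>)" "compact (outer_set \<eta> \<rho>)"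
proof -
  have "closed (near_set \<eta> \<rho>)" "closed (inner_set \<eta> \<rho>)" "closed (outer_set \<eta> \<rho>)"
    unfolding near_set_def inner_set_def outer_set_def
    by (intro closed_Collect_conj closed_Collect_le continuous_intros)+
  then show "compact (near_set \<eta> \<rho>)" "compact (inner_set \<eta> \<rho>)" "compact (outer_set \<eta> \<rho>)"
    by (auto intro!: compact_closed_bounded[of _ \<rho>] simp: near_set_def inner_set_def outer_set_def)
qed

section \<open>The sector in which the origin and the saddle point compete\<close>

lemma near_cone_ineq:
  assumes "Re p \<le> 3 * Im p" "Im p \<le> 3 * Re p"
  shows "Re p ^ 2 + Im p ^ 2 \<le> 10 / 3 * (Re p * Im p)"
proof -
  have "0 \<le> (3 * Im p - Re p) * (3 * Re p - Im p)" using assms by (intro mult_nonneg_nonneg) auto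
  then show ?thesis by (simp add: algebra_simps power2_eq_square)
qed

text \<open>For \<open>p = a + \<i> * b\<close> and \<open>q = s * \<i> * p\<close> the leading
  terms have real part \<open>s * a * b / 3 - s^2 * (a^2 - b^2) / 12\<close>. It is positive because
  \<open>a * b\<close> is comparable to \<open>norm p ^ 2\<close> in the cone, so the origin
  dominates all the way to the valley point.\<close>

lemma near_ray_limit:
  fixes N :: "nat \<Rightarrow> nat" and p :: "nat \<Rightarrow> complex"
  assumes N: "filterlim N at_top sequentially" "\<And>n. 0 < N n"
    and lim: "p \<longlonglongrightarrow> p0" and p: "\<And>n. p n \<in> near_set \<eta> \<rho>" "p0 \<in> near_set \<eta> \<rho>" "0 < \<eta>" "\<rho> < rad1"
  shows "(\<lambda>n. of_real (sqrt (N n)) * boltzmann_prim (N n) (beta_of (p n)) (csqrt (\<i> * p n)))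
     \<longlonglongrightarrow> csqrt (\<i> * p0) * (of_real (sqrt pi) / (2 * csqrt ((lcs' p0 - 1 / 2) * (\<i> * p0))))"
    and "(lcs' p0 - 1 / 2) * (\<i> * p0) \<noteq> 0"
proof -
  have pn: "\<eta> \<le> norm (p n)" "norm (p n) < rad" for n
    using p(1)[of n] complex_Re_le_cmod[of "p n"] p(4) rad1 by (auto simp: near_set_def)
  have "\<eta>\<^sup>2 / 50 * t\<^sup>2 \<le> Re (h_rel (p n) (of_real (t\<^sup>2) * (\<i> * p n)))" if t: "0 \<le> t" "t \<le> 1" for n t
  proof -
    define a where "a = Re (p n)" define b where "b = Im (p n)" define s where "s = t\<^sup>2"
    have ab: "0 < a" "a \<le> 3 * b" "b \<le> 3 * a" using p(1)[of n] p(3) by (auto simp: near_set_def a_def b_def)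
    have s: "0 \<le> s" "s \<le> 1" using t by (auto simp: s_def power_le_one)
    define q where "q = of_real s * (\<i> * p n)"
    have nq: "norm q = s * norm (p n)" using s by (simp add: q_def norm_mult)
    have nq1: "norm q \<le> 1 * norm (p n)" unfolding nq using s by (intro mult_right_mono) auto
    have "norm (h_rel (p n) q - (q\<^sup>2 / 12 - p n * q / 6)) \<le> (norm (p n) * norm q + norm q ^ 2) / 1000"
      using pn nq1 by (intro h_rel_near_0) (auto intro: order_le_less_trans)
    also have "\<dots> \<le> s * norm (p n) ^ 2 / 500"
    proof -
      have "norm q ^ 2 \<le> norm (p n) * norm q"
        unfolding power2_eq_square using nq1 by (intro mult_right_mono) auto
      moreover have "norm (p n) * norm q = s * norm (p n) ^ 2" by (simp add: nq power2_eq_square)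
      ultimately have "norm (p n) * norm q + norm q ^ 2 \<le> 2 * (s * norm (p n) ^ 2)" by simp
      from divide_right_mono[OF this, of 1000] show ?thesis by simp
    qed
    finally have "\<bar>Re (h_rel (p n) q) - Re (q\<^sup>2 / 12 - p n * q / 6)\<bar> \<le> s * norm (p n) ^ 2 / 500"
      unfolding minus_complex.sel(1)[symmetric] using abs_Re_le_cmod order_trans by blast
    moreover have "Re (q\<^sup>2 / 12 - p n * q / 6) = - s\<^sup>2 * (a\<^sup>2 - b\<^sup>2) / 12 + s * (2 * a * b) / 6"
      by (simp add: q_def a_def b_def power2_eq_square field_simps)
    moreover have "Y' - B \<le> X" if "\<bar>X - Y\<bar> \<le> B" "Y = Y'" for X Y Y' B :: real using that by simp
    ultimately have L: "- s\<^sup>2 * (a\<^sup>2 - b\<^sup>2) / 12 + s * (2 * a * b) / 6 - s * norm (p n) ^ 2 / 500 \<le> Re (h_rel (p n) q)"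
      by blast
    have n2: "norm (p n) ^ 2 = a\<^sup>2 + b\<^sup>2" by (simp add: power2_norm_complex a_def b_def)
    have ab2: "a\<^sup>2 + b\<^sup>2 \<le> 10 / 3 * (a * b)" using near_cone_ineq[of "p n"] ab by (simp add: a_def b_def)
    \<comment> \<open>Follows from \<open>s * (a^2 - b^2) <= 4 * a * b - (a^2 + b^2) / 3\<close>
      after multiplication by \<open>s\<close>. For \<open>a >= b\<close> this uses
      \<open>s <= 1\<close> and \<open>a <= 3 * b\<close>; otherwise the left side is at most
      \<open>0\<close> and \<open>near_cone_ineq\<close> shows that the right side is not
      negative.\<close>
    have M: "s * (a\<^sup>2 + b\<^sup>2) / 36 \<le> - s\<^sup>2 * (a\<^sup>2 - b\<^sup>2) / 12 + s * (2 * a * b) / 6"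
    proof -
      have "s * (a\<^sup>2 - b\<^sup>2) \<le> 4 * (a * b) - (a\<^sup>2 + b\<^sup>2) / 3"
      proof (cases "b\<^sup>2 \<le> a\<^sup>2")
        case True
        have "s * (a\<^sup>2 - b\<^sup>2) \<le> 1 * (a\<^sup>2 - b\<^sup>2)" using s True by (intro mult_right_mono) auto
        moreover have "a * a \<le> a * (3 * b)" using ab by (intro mult_left_mono) auto
        moreover have "a\<^sup>2 = a * a" "a * (3 * b) = 3 * (a * b)" by (simp_all add: power2_eq_square)
        moreover have "X \<le> 4 * c - (A + B) / 3" if "X \<le> A - B" "A \<le> 3 * c" "0 \<le> B" for X A B c :: real
          using that by (simp add: field_simps)
        ultimately show ?thesis by (metis zero_le_power2 mult_1)
      next
        case False
        then have "s * (a\<^sup>2 - b\<^sup>2) \<le> 0" using s by (intro mult_nonneg_nonpos) auto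
        moreover have "X \<le> 4 * c - S / 3" if "X \<le> 0" "S \<le> 10 / 3 * c" "0 \<le> S" for X S c :: real
          using that by simp
        ultimately show ?thesis using ab2 sum_power2_ge_zero[of a b] by blast
      qed
      then have m1: "s * (s * (a\<^sup>2 - b\<^sup>2)) \<le> s * (4 * (a * b) - (a\<^sup>2 + b\<^sup>2) / 3)" using s by (intro mult_left_mono) auto
      have m2: "s * (s * (a\<^sup>2 - b\<^sup>2)) = s\<^sup>2 * (a\<^sup>2 - b\<^sup>2)" by (simp add: power2_eq_square)
      have m3: "s * (4 * (a * b) - (a\<^sup>2 + b\<^sup>2) / 3) = 4 * (s * (a * b)) - s * (a\<^sup>2 + b\<^sup>2) / 3" by (simp add: algebra_simps)
      have m4: "S / 36 \<le> - P / 12 + 2 * c / 6" if "P \<le> 4 * c - S / 3" for P c S :: real using that by simp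
      have "s * (a\<^sup>2 + b\<^sup>2) / 36 \<le> - (s\<^sup>2 * (a\<^sup>2 - b\<^sup>2)) / 12 + 2 * (s * (a * b)) / 6"
        by (rule m4[OF m1[unfolded m2 m3]])
      moreover have "2 * (s * (a * b)) = s * (2 * a * b)" "- (s\<^sup>2 * (a\<^sup>2 - b\<^sup>2)) = - s\<^sup>2 * (a\<^sup>2 - b\<^sup>2)" by simp_all
      ultimately show ?thesis by (simp only:)
    qed
    have "\<eta>\<^sup>2 \<le> norm (p n) ^ 2" using pn p(3) by (intro power_mono) auto
    then have "s * \<eta>\<^sup>2 \<le> s * norm (p n) ^ 2" using s by (intro mult_left_mono) auto
    moreover have "0 \<le> s * norm (p n) ^ 2" using s by simp
    ultimately have "s * \<eta>\<^sup>2 / 50 \<le> Re (h_rel (p n) q)"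
      using L M unfolding n2 by linarith
    then show ?thesis by (simp add: q_def s_def mult.commute)
  qed
  note * = this
  show "(\<lambda>n. of_real (sqrt (N n)) * boltzmann_prim (N n) (beta_of (p n)) (csqrt (\<i> * p n)))
     \<longlonglongrightarrow> csqrt (\<i> * p0) * (of_real (sqrt pi) / (2 * csqrt ((lcs' p0 - 1 / 2) * (\<i> * p0))))"
    and "(lcs' p0 - 1 / 2) * (\<i> * p0) \<noteq> 0"
    by (rule origin_ray_limit[OF N lim, where \<kappa> = "\<eta>\<^sup>2 / 50"];
        (rule *)?; use pn p rad1 in \<open>auto intro!: not_nonpos_Reals_if tendsto_intros lim simp: norm_mult near_set_def\<close>)+
qed

text \<open>The direction \<open>(\<i> - 1) * p\<close> has a square with real part
  \<open>4 * Re p * Im p\<close>, so the segment from the saddle to the valley point is admissible;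
  it leaves to the left. Together with the right half the saddle constant occurs twice.\<close>

lemma near_segment_limit:
  fixes N :: "nat \<Rightarrow> nat" and p :: "nat \<Rightarrow> complex"
  assumes N: "filterlim N at_top sequentially" "\<And>n. 0 < N n"
    and lim: "p \<longlonglongrightarrow> p0" and p: "\<And>n. p n \<in> near_set \<eta> \<rho>" "p0 \<in> near_set \<eta> \<rho>" "0 < \<eta>" "\<rho> < rad1"
  shows "(\<lambda>n. of_real (sqrt (N n)) * (exp (of_nat (N n) * h_saddle (p n)) *
       (boltzmann_total (N n) (beta_of (p n)) - boltzmann_prim (N n) (beta_of (p n)) (csqrt (\<i> * p n)))))
     \<longlonglongrightarrow> 2 * saddle_const p0"
proof -
  have pn: "\<eta> \<le> norm (p n)" "norm (p n) < rad1" "norm (p n) < rad" for n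
    using p(1)[of n] complex_Re_le_cmod[of "p n"] p(4) rad1 by (auto simp: near_set_def)
  have p0: "norm p0 < rad1" "norm p0 < rad" using p(2,4) rad1 by (auto simp: near_set_def)
  have n2: "norm (((\<i> - 1) * z)) ^ 2 = 2 * (Re z ^ 2 + Im z ^ 2)" for z
    unfolding power2_norm_complex by (simp add: power2_eq_square algebra_simps)
  have sq: "norm ((\<i> - 1) * z) ^ 2 / 2 \<le> Re (((\<i> - 1) * z)\<^sup>2)" if "z \<in> near_set \<eta> \<rho>" for z
  proof -
    have "Re (((\<i> - 1) * z)\<^sup>2) = 4 * (Re z * Im z)"
      by (simp add: power2_eq_square algebra_simps)
    moreover have "0 \<le> Re z * Im z" using that p(3) by (auto simp: near_set_def intro!: mult_nonneg_nonneg)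
    moreover have "Re z ^ 2 + Im z ^ 2 \<le> 10 / 3 * (Re z * Im z)"
      using that by (intro near_cone_ineq) (auto simp: near_set_def)
    moreover have "2 * B / 2 \<le> X" if "X = 4 * c" "0 \<le> c" "B \<le> 10 / 3 * c" for X c B :: real
      using that by simp
    ultimately show ?thesis unfolding n2 by blast
  qed
  \<comment> \<open>The segment leaves the right half plane, but its imaginary part is a mixture of
    \<open>Im p\<close> and \<open>Re p\<close>, which keeps it off the cut of
    \<open>csqrt\<close>.\<close>
  have Imseg: "\<eta> / 3 \<le> Im (p n + of_real t * ((\<i> - 1) * p n))" if "0 \<le> t" "t \<le> 1" for n t
  proof -
    have "\<eta> / 3 \<le> Im (p n)" "\<eta> / 3 \<le> Re (p n)" using p(1)[of n] p(3) by (auto simp: near_set_def)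
    then have "\<eta> / 3 * (1 - t) \<le> Im (p n) * (1 - t)" "\<eta> / 3 * t \<le> Re (p n) * t"
      using that by (intro mult_right_mono; simp)+
    moreover have "\<eta> / 3 * (1 - t) + \<eta> / 3 * t = \<eta> / 3" by (simp add: field_simps)
    moreover have "Im (p n + of_real t * ((\<i> - 1) * p n)) = Im (p n) * (1 - t) + Re (p n) * t" by (simp add: algebra_simps)
    ultimately show ?thesis by linarith
  qed
  have A: "(\<lambda>n. of_real (sqrt (N n)) * exp (of_nat (N n) * h_saddle (p n)) *
       (boltzmann_prim (N n) (beta_of (p n)) (csqrt (p n + (\<i> - 1) * p n)) - boltzmann_prim (N n) (beta_of (p n)) (csqrt (p n))))
     \<longlonglongrightarrow> (- 1) * saddle_const p0"
  proof (rule saddle_segment_limit[OF N lim, where \<eta> = "\<eta> / 3" and \<delta> = \<eta> and ?d0.0 = "(\<i> - 1) * p0"])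
    show "norm (p n + (\<i> - 1) * p n) < rad" for n
      using pn(3)[of n] by (simp add: algebra_simps norm_mult)
    show "\<eta> \<le> norm ((\<i> - 1) * p n)" for n
    proof (rule power2_le_imp_le)
      have "\<eta>\<^sup>2 \<le> norm (p n) ^ 2" using pn p(3) by (intro power_mono) auto
      then show "\<eta>\<^sup>2 \<le> (norm ((\<i> - 1) * p n))\<^sup>2"
        unfolding n2 power2_norm_complex[of "p n"]
        by (rule order_trans) (use sum_power2_ge_zero[of "Re (p n)" "Im (p n)"] in simp)
    qed auto
    show "p n + of_real t * ((\<i> - 1) * p n) \<notin> \<real>\<^sub>\<le>\<^sub>0" if "0 \<le> t" "t \<le> 1" for n t
      using Imseg[OF that, of n] p(3) by (intro not_nonpos_Reals_if) linarith
    show "\<eta> / 3 \<le> norm (p n + of_real t * ((\<i> - 1) * p n))" if "0 \<le> t" "t \<le> 1" for n t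
      using Imseg[OF that, of n] abs_Im_le_cmod[of "p n + of_real t * ((\<i> - 1) * p n)"] by linarith
    show "0 < Re (- 1 * ((\<i> - 1) * p0))" using p by (auto simp: near_set_def algebra_simps)
  qed (use pn p p0 sq in \<open>auto intro!: tendsto_intros lim not_nonpos_Reals_if simp: near_set_def\<close>)
  have B: "(\<lambda>n. of_real (sqrt (N n)) * (exp (of_nat (N n) * h_saddle (p n)) *
       (boltzmann_total (N n) (beta_of (p n)) - boltzmann_prim (N n) (beta_of (p n)) (csqrt (p n)))))
     \<longlonglongrightarrow> saddle_const p0"
    using p pn p0 by (intro total_minus_saddle_limit[OF N lim, of \<eta>]) (auto simp: near_set_def)
  have eq: "p n + (\<i> - 1) * p n = \<i> * p n" for n by (simp add: algebra_simps)
  from tendsto_diff[OF B A] show ?thesis unfolding eq by (simp add: algebra_simps)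
qed

section \<open>The sector in which the saddle point dominates\<close>

lemma norm_boltzmann_prim_csqrt_le:
  assumes p: "norm p < rad" and N: "N > 0" and e: "norm e < rad"
    and B: "\<And>s. 0 \<le> s \<Longrightarrow> s \<le> 1 \<Longrightarrow> norm (exp (- of_nat N * h_rel p (of_real s * e))) \<le> B"
  shows "norm (boltzmann_prim N (beta_of p) (csqrt e)) \<le> B"
proof -
  have B0: "0 \<le> B" using B[of 0] by simp
  have "norm (boltzmann_prim N (beta_of p) (csqrt e) - boltzmann_prim N (beta_of p) 0) \<le> B * norm (csqrt e - 0)"
  proof (rule field_differentiable_bound[of "closed_segment 0 (csqrt e)" _ "boltzmann N (beta_of p)"])
    fix z assume "z \<in> closed_segment 0 (csqrt e)"
    then obtain t where t: "0 \<le> t" "t \<le> 1" "z = of_real t * csqrt e"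
      by (auto simp: in_segment scaleR_conv_of_real)
    have z2: "z\<^sup>2 = of_real (t\<^sup>2) * e" by (simp add: t(3) power_mult_distrib)
    have t2: "0 \<le> t\<^sup>2" "t\<^sup>2 \<le> 1" using t by (auto simp: power_le_one)
    have "norm (z\<^sup>2) \<le> 1 * norm e" unfolding z2 norm_mult norm_of_real using t2 by (intro mult_right_mono) auto
    then show "norm (boltzmann N (beta_of p) z) \<le> B"
      using boltzmann_eq[OF p, of z N] B[OF t2] e unfolding z2 by simp
  qed (auto intro: boltzmann_prim_deriv[OF beta_of_nz[OF p] N])
  also have "\<dots> \<le> B * 1" using e rad B0 by (intro mult_left_mono) (auto simp: norm_csqrt)
  finally show ?thesis by simp
qed

text \<open>Here \<open>p\<close> itself is an admissible direction, its argument being below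
  \<open>pi / 6\<close>. The segment from \<open>p\<close> to \<open>p / 2\<close> provides the left
  half of the Gaussian, and on the rest of the way to the origin the real part of the exponent stays
  above the saddle value by a fixed amount.\<close>

lemma inner_limit:
  fixes N :: "nat \<Rightarrow> nat" and p :: "nat \<Rightarrow> complex"
  assumes N: "filterlim N at_top sequentially" "\<And>n. 0 < N n"
    and lim: "p \<longlonglongrightarrow> p0" and p: "\<And>n. p n \<in> inner_set \<eta> \<rho>" "p0 \<in> inner_set \<eta> \<rho>" "0 < \<eta>" "\<rho> < rad1"
  shows "(\<lambda>n. of_real (sqrt (N n)) * (exp (of_nat (N n) * h_saddle (p n)) * boltzmann_total (N n) (beta_of (p n))))
     \<longlonglongrightarrow> 2 * saddle_const p0"
proof -
  have pn: "\<eta> \<le> norm (p n)" "norm (p n) < rad1" "norm (p n) < rad" for n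
    using p(1)[of n] complex_Re_le_cmod[of "p n"] p(4) rad1 by (auto simp: inner_set_def)
  have p0: "norm p0 < rad1" "norm p0 < rad" using p(2,4) rad1 by (auto simp: inner_set_def)
  have sq: "norm (of_real c * z) ^ 2 / 2 \<le> Re ((of_real c * z)\<^sup>2)" if "z \<in> inner_set \<eta> \<rho>" for z c
  proof -
    have "(2 * Im z)\<^sup>2 \<le> (Re z)\<^sup>2" using that by (intro power_mono) (auto simp: inner_set_def)
    moreover have "3 * (Im z)\<^sup>2 \<le> (2 * Im z)\<^sup>2" by (simp add: power_mult_distrib)
    ultimately have "3 * (Im z)\<^sup>2 \<le> (Re z)\<^sup>2" by (rule order_trans[rotated])
    then have m: "(Re z ^ 2 + Im z ^ 2) / 2 \<le> Re z ^ 2 - Im z ^ 2" by (simp add: field_simps)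
    have "c\<^sup>2 * ((Re z ^ 2 + Im z ^ 2) / 2) \<le> c\<^sup>2 * (Re z ^ 2 - Im z ^ 2)"
      by (rule mult_left_mono[OF m]) simp
    moreover have "norm (of_real c * z) ^ 2 = c\<^sup>2 * (Re z ^ 2 + Im z ^ 2)"
      by (simp add: norm_mult power_mult_distrib cmod_power2)
    moreover have "Re ((of_real c * z)\<^sup>2) = c\<^sup>2 * (Re z ^ 2 - Im z ^ 2)"
      by (simp add: power2_eq_square algebra_simps)
    ultimately show ?thesis by (simp only: times_divide_eq_right)
  qed
  have sq1: "norm (- (z / 2)) ^ 2 / 2 \<le> Re ((- (z / 2))\<^sup>2)" if "z \<in> inner_set \<eta> \<rho>" for z
    using sq[OF that, of "- 1 / 2"] by simp
  have Rseg: "\<eta> / 2 \<le> Re (p n + of_real t * (- (p n / 2)))" if "0 \<le> t" "t \<le> 1" for n t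
  proof -
    have "\<eta> * (1 - t / 2) \<le> Re (p n) * (1 - t / 2)"
      using that p(1)[of n] by (intro mult_right_mono) (auto simp: inner_set_def)
    moreover have "\<eta> * (1 / 2) \<le> \<eta> * (1 - t / 2)" using that p(3) by (intro mult_left_mono) auto
    moreover have "Re (p n + of_real t * (- (p n / 2))) = Re (p n) * (1 - t / 2)" by (simp add: field_simps)
    ultimately show ?thesis by simp
  qed
  have A: "(\<lambda>n. of_real (sqrt (N n)) * exp (of_nat (N n) * h_saddle (p n)) *
       (boltzmann_prim (N n) (beta_of (p n)) (csqrt (p n + - (p n / 2))) - boltzmann_prim (N n) (beta_of (p n)) (csqrt (p n))))
     \<longlonglongrightarrow> (- 1) * saddle_const p0"
  proof (rule saddle_segment_limit[OF N lim, where \<eta> = "\<eta> / 2" and \<delta> = "\<eta> / 2" and ?d0.0 = "- (p0 / 2)"])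
    show "norm (p n + - (p n / 2)) < rad" for n
    proof -
      have "p n + - (p n / 2) = p n / 2" by simp
      then have "norm (p n + - (p n / 2)) = norm (p n) / 2" by (simp only: norm_divide) simp
      then show ?thesis using pn(3)[of n] rad by simp
    qed
    show "\<eta> / 2 \<le> norm (- (p n / 2))" for n
      using pn(1)[of n] by (simp add: norm_divide)
    show "p n + of_real t * (- (p n / 2)) \<notin> \<real>\<^sub>\<le>\<^sub>0" if "0 \<le> t" "t \<le> 1" for n t
      using Rseg[OF that, of n] p(3) by (intro not_nonpos_Reals_if) linarith
    show "\<eta> / 2 \<le> norm (p n + of_real t * (- (p n / 2)))" if "0 \<le> t" "t \<le> 1" for n t
      using Rseg[OF that, of n] complex_Re_le_cmod order_trans by blast
    show "0 < Re (- 1 * - (p0 / 2))" using p by (auto simp: inner_set_def)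
    show "(\<lambda>n. - (p n / 2)) \<longlonglongrightarrow> - (p0 / 2)" by (intro tendsto_intros lim) simp
    show "p0 \<notin> \<real>\<^sub>\<le>\<^sub>0" using p by (intro not_nonpos_Reals_if) (auto simp: inner_set_def)
  qed (use pn p p0 sq1 in auto)
  have B: "(\<lambda>n. of_real (sqrt (N n)) * (exp (of_nat (N n) * h_saddle (p n)) *
       (boltzmann_total (N n) (beta_of (p n)) - boltzmann_prim (N n) (beta_of (p n)) (csqrt (p n)))))
     \<longlonglongrightarrow> saddle_const p0"
    using p pn p0 by (intro total_minus_saddle_limit[OF N lim, of \<eta>]) (auto simp: inner_set_def)
  have C: "(\<lambda>n. of_real (sqrt (N n)) * (exp (of_nat (N n) * h_saddle (p n)) * boltzmann_prim (N n) (beta_of (p n)) (csqrt (p n / 2))))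
      \<longlonglongrightarrow> 0"
  \<comment> \<open>On the remaining ray \<open>q\<close> has distance at least
    \<open>\<eta> / 2\<close> from \<open>p\<close>, and \<open>Re_perturb_square\<close>
    contributes the factor \<open>1 / 30\<close>.\<close>
  proof (rule sqrt_exp_decay[OF N(1), where \<kappa> = "\<eta>\<^sup>2 / 120" and A = 1])
    fix n
    have "norm (boltzmann_prim (N n) (beta_of (p n)) (csqrt (p n / 2)))
      \<le> exp (- real (N n) * (\<eta>\<^sup>2 / 120)) / norm (exp (of_nat (N n) * h_saddle (p n)))"
    proof (rule norm_boltzmann_prim_csqrt_le[OF pn(3) N(2)])
      show "norm (p n / 2) < rad" using pn(3)[of n] rad by (simp add: norm_divide)
      fix s :: real assume s: "0 \<le> s" "s \<le> 1"
      define q where "q = of_real s * (p n / 2)"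
      have qp: "q - p n = of_real (s / 2 - 1) * p n" by (simp add: q_def algebra_simps)
      have nq: "norm q < rad"
      proof -
        have "norm q = s / 2 * norm (p n)" using s by (simp add: q_def norm_mult norm_divide)
        also have "\<dots> \<le> 1 * norm (p n)" using s by (intro mult_right_mono) auto
        finally show ?thesis using pn(3)[of n] by simp
      qed
      have "norm (q - p n) ^ 2 / 30 \<le> Re (h_rel (p n) q - h_saddle (p n))"
        using sq[OF p(1)[of n], of "s / 2 - 1"] unfolding qp[symmetric]
        by (rule Re_perturb_square[OF _ h_rel_saddle[OF pn(3) nq]])
      moreover have "(\<eta> / 2)\<^sup>2 \<le> norm (q - p n) ^ 2"
      proof (intro power_mono)
        have "1 / 2 * norm (p n) \<le> (1 - s / 2) * norm (p n)" using s by (intro mult_right_mono) auto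
        also have "\<dots> = norm (q - p n)"
          unfolding qp norm_mult norm_of_real using s by (simp add: abs_if)
        finally show "\<eta> / 2 \<le> norm (q - p n)" using pn(1)[of n] by linarith
      qed (use p in auto)
      ultimately have L: "\<eta>\<^sup>2 / 120 \<le> Re (h_rel (p n) q - h_saddle (p n))" by (simp add: power_divide)
      have "norm (exp (- of_nat (N n) * h_rel (p n) q)) * norm (exp (of_nat (N n) * h_saddle (p n)))
         = exp (- real (N n) * Re (h_rel (p n) q - h_saddle (p n)))"
        by (simp add: exp_add[symmetric] algebra_simps)
      also have "\<dots> \<le> exp (- real (N n) * (\<eta>\<^sup>2 / 120))"
        using mult_left_mono[OF L, of "real (N n)"] by simp
      finally show "norm (exp (- of_nat (N n) * h_rel (p n) (of_real s * (p n / 2))))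
         \<le> exp (- real (N n) * (\<eta>\<^sup>2 / 120)) / norm (exp (of_nat (N n) * h_saddle (p n)))"
        by (simp add: q_def field_simps)
    qed
    then show "norm (exp (of_nat (N n) * h_saddle (p n)) * boltzmann_prim (N n) (beta_of (p n)) (csqrt (p n / 2)))
       \<le> 1 * exp (- real (N n) * (\<eta>\<^sup>2 / 120))"
      by (simp add: norm_mult field_simps)
  qed (use p in auto)
  have eq: "p n + - (p n / 2) = p n / 2" for n by simp
  from tendsto_add[OF tendsto_diff[OF B A[unfolded eq]] C] show ?thesis by (simp add: algebra_simps)
qed

text \<open>In the outer sector the contour starts along the direction with square \<open>2 + \<i>\<close>: there both the
  quadratic term \<open>- p * q / 6\<close> and the quartic term \<open>q\<^sup>2 / 12\<close> of \<open>h_rel p q\<close> have positive real part.\<close>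

definition tilt :: "complex \<Rightarrow> complex" where
  "tilt p = of_real (50000 * norm p) * (2 + \<i>)"

section \<open>The sector in which the origin dominates\<close>

lemma outer_cone:
  assumes "p \<in> outer_set \<eta> \<rho>"
  shows "norm p / 10 \<le> Im p - 2 * Re p"
proof -
  have n: "norm p \<le> \<bar>Re p\<bar> + \<bar>Im p\<bar>" by (rule cmod_le)
  show ?thesis using assms n by (cases "0 \<le> Re p") (auto simp: outer_set_def)
qed

lemma norm_2_plus_i: "norm (2 + \<i>) \<le> 9 / 4" "norm (2 + \<i>) ^ 2 = 5"
proof -
  show e: "norm (2 + \<i>) ^ 2 = 5" by (simp add: cmod_power2)
  have "norm (2 + \<i>) ^ 2 \<le> (9 / 4)\<^sup>2" unfolding e by (simp add: power_divide)
  then show "norm (2 + \<i>) \<le> 9 / 4" by (rule power2_le_imp_le) simp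
qed

lemma Re_h_rel_ge:
  assumes p: "norm p < rad" and q: "norm q < rad"
  shows "Re (q\<^sup>2) / 12 - Re (p * q) / 6 - norm p * norm q / 1000 - norm q ^ 2 / 1000 \<le> Re (h_rel p q)"
proof -
  have "\<bar>Re (h_rel p q) - Re (q\<^sup>2 / 12 - p * q / 6)\<bar> \<le> (norm p * norm q + norm q ^ 2) / 1000"
    unfolding minus_complex.sel(1)[symmetric] using h_rel_near_0[OF p q] abs_Re_le_cmod order_trans by blast
  moreover have "Re (q\<^sup>2 / 12 - p * q / 6) = Re (q\<^sup>2) / 12 - Re (p * q) / 6"
    by (simp only: minus_complex.sel Re_divide_numeral)
  moreover have "A - B / 1000 - D / 1000 \<le> X" if "\<bar>X - A\<bar> \<le> (B + D) / 1000" for X A B D :: real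
    using that unfolding abs_le_iff by (simp add: field_simps)
  ultimately show ?thesis by (metis (no_types, lifting))
qed

text \<open>The contour is a ray to \<open>tilt p\<close>, a vertical segment in the
  \<open>q\<close>-plane to \<open>far p\<close>, which has the same real part, and then the real
  axis. On the ray, \<open>- Re (p * q)\<close> is a multiple of \<open>Im p - 2 * Re p\<close>,
  positive by \<open>outer_cone\<close>; the other two pieces are exponentially small.\<close>

lemma outer_limit:
  fixes N :: "nat \<Rightarrow> nat" and p :: "nat \<Rightarrow> complex"
  assumes N: "filterlim N at_top sequentially" "\<And>n. 0 < N n"
    and lim: "p \<longlonglongrightarrow> p0" and p: "\<And>n. p n \<in> outer_set \<eta> \<rho>" "p0 \<in> outer_set \<eta> \<rho>" "0 < \<eta>" "\<rho> < rad1"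
  shows "(\<lambda>n. of_real (sqrt (N n)) * boltzmann_total (N n) (beta_of (p n)))
     \<longlonglongrightarrow> csqrt (tilt p0) * (of_real (sqrt pi) / (2 * csqrt ((lcs' p0 - 1 / 2) * tilt p0)))"
    and "(lcs' p0 - 1 / 2) * tilt p0 \<noteq> 0"
proof -
  have pn: "\<eta> \<le> norm (p n)" "norm (p n) < rad1" "norm (p n) < rad" for n
    using p(1)[of n] p(4) rad1 by (auto simp: outer_set_def)
  have p0: "norm p0 < rad1" "norm p0 < rad" "\<eta> \<le> norm p0" using p(2,4) rad1 by (auto simp: outer_set_def)
  have "0 < norm p0" using p0 p(3) by linarith
  then have slit: "tilt p0 \<notin> \<real>\<^sub>\<le>\<^sub>0" by (intro not_nonpos_Reals_if) (simp add: tilt_def)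
  have nt: "norm (tilt z) \<le> 112500 * norm z" "norm (tilt z) ^ 2 = 12500000000 * norm z ^ 2" for z
    using mult_left_mono[OF norm_2_plus_i(1), of "50000 * norm z"] norm_2_plus_i(2)
    by (simp_all add: tilt_def norm_mult power_mult_distrib)
  have ntr: "norm (tilt z) < rad" if "norm z < rad1" for z
    using nt(1)[of z] that rad unfolding rad1_def by linarith
  have ray: "500 * \<eta>\<^sup>2 * t\<^sup>2 \<le> Re (h_rel (p n) (of_real (t\<^sup>2) * tilt (p n)))" if t: "0 \<le> t" "t \<le> 1" for n t
  proof -
    define s where "s = t\<^sup>2"
    have s: "0 \<le> s" "s \<le> 1" using t by (auto simp: s_def power_le_one)
    define q where "q = of_real s * tilt (p n)"
    define m where "m = norm (p n)"
    define \<delta> where "\<delta> = Im (p n) - 2 * Re (p n)"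
    have \<delta>: "m / 10 \<le> \<delta>" using outer_cone[OF p(1)] by (simp add: \<delta>_def m_def)
    have nq: "norm q \<le> s * (112500 * m)" unfolding q_def norm_mult m_def using s nt(1) by (simp add: mult_left_mono)
    have nq2: "norm q ^ 2 = s\<^sup>2 * (12500000000 * m\<^sup>2)" unfolding q_def norm_mult power_mult_distrib nt m_def by simp
    have "norm q \<le> 1 * norm (tilt (p n))" unfolding q_def norm_mult using s by (intro mult_right_mono) auto
    then have qr: "norm q < rad" using ntr[OF pn(2), of n] by simp
    have r1: "Re (q\<^sup>2) = s\<^sup>2 * (7500000000 * m\<^sup>2)"
      by (simp add: q_def tilt_def m_def power2_eq_square algebra_simps)
    have r2: "Re (p n * q) = - (s * (50000 * m) * \<delta>)"
      by (simp add: q_def tilt_def m_def \<delta>_def algebra_simps)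
    have m0: "0 \<le> m" by (simp add: m_def)
    have i1: "s * (50000 * m) * (m / 10) \<le> s * (50000 * m) * \<delta>" using \<delta> s m0 by (intro mult_left_mono) auto
    have i2: "m * norm q \<le> m * (s * (112500 * m))" using nq m0 by (intro mult_left_mono) auto
    have i3: "s * \<eta>\<^sup>2 \<le> s * m\<^sup>2" using pn(1)[of n] p(3) s by (intro mult_left_mono power_mono) (auto simp: m_def)
    have i4: "0 \<le> s\<^sup>2 * m\<^sup>2" "0 \<le> s * m\<^sup>2" using s by simp_all
    have e1: "s * (50000 * m) * (m / 10) = 5000 * (s * m\<^sup>2)" "m * (s * (112500 * m)) = 112500 * (s * m\<^sup>2)"
      by (simp_all add: power2_eq_square)
    \<comment> \<open>\<open>S\<close> and \<open>T\<close> stand for \<open>s * m^2\<close> and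
      \<open>s^2 * m^2\<close>. The large numbers are \<open>3\<close> and \<open>5\<close> times
      \<open>50000^2\<close>, from \<open>Re ((2 + \<i>)^2) = 3\<close> and
      \<open>norm (2 + \<i>)^2 = 5\<close>.\<close>
    have arith: "500 * E \<le> A / 12 - C / 6 - F / 1000 - G / 1000" if "A = 7500000000 * T" "C = - D" "5000 * S \<le> D" "F \<le> 112500 * S"
      "G = 12500000000 * T" "0 \<le> T" "E \<le> S" "0 \<le> S" for A C D E F G S T :: real using that by simp
    have "500 * (s * \<eta>\<^sup>2) \<le> Re (q\<^sup>2) / 12 - Re (p n * q) / 6 - m * norm q / 1000 - norm q ^ 2 / 1000"
      by (rule arith[of _ "s\<^sup>2 * m\<^sup>2" _ "s * (50000 * m) * \<delta>" "s * m\<^sup>2"])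
        (use r1 r2 i1[unfolded e1] i2[unfolded e1] i3 i4 nq2 in \<open>simp_all add: mult_ac\<close>)
    also have "\<dots> \<le> Re (h_rel (p n) q)" unfolding m_def by (rule Re_h_rel_ge[OF pn(3) qr])
    finally show ?thesis by (simp add: q_def s_def mult_ac)
  qed
  have limt: "(\<lambda>n. tilt (p n)) \<longlonglongrightarrow> tilt p0" unfolding tilt_def by (intro tendsto_intros lim)
  note orl = origin_ray_limit[OF N lim limt pn(3) ntr[OF pn(2)] p0(2) slit, of "500 * \<eta>\<^sup>2", OF _ ray]
  show nz: "(lcs' p0 - 1 / 2) * tilt p0 \<noteq> 0" using p(3) by (intro orl(2)) auto
  have A: "(\<lambda>n. of_real (sqrt (N n)) * boltzmann_prim (N n) (beta_of (p n)) (csqrt (tilt (p n))))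
     \<longlonglongrightarrow> csqrt (tilt p0) * (of_real (sqrt pi) / (2 * csqrt ((lcs' p0 - 1 / 2) * tilt p0)))"
    using p(3) by (intro orl(1)) auto
  have B: "(\<lambda>n. of_real (sqrt (N n)) * (boltzmann_prim (N n) (beta_of (p n)) (csqrt (far (p n))) - boltzmann_prim (N n) (beta_of (p n)) (csqrt (tilt (p n)))))
     \<longlonglongrightarrow> 0"
  proof (rule sqrt_exp_decay[OF N(1), where \<kappa> = "\<eta>\<^sup>2" and A = "1 / sqrt \<eta>"])
    fix n
    define m where "m = norm (p n)"
    have m: "0 < m" "\<eta> \<le> m" "m \<le> 1 / 1000000" using pn[of n] p(3) rad by (auto simp: m_def rad1_def)
    have "norm (boltzmann_prim (N n) (beta_of (p n)) (csqrt (far (p n))) - boltzmann_prim (N n) (beta_of (p n)) (csqrt (tilt (p n))))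
      \<le> 1 / sqrt \<eta> * exp (- real (N n) * \<eta>\<^sup>2) * norm (far (p n) - tilt (p n))"
    proof (rule field_differentiable_bound[of "closed_segment (tilt (p n)) (far (p n))" "\<lambda>q. boltzmann_prim (N n) (beta_of (p n)) (csqrt q)"
          "\<lambda>q. boltzmann (N n) (beta_of (p n)) (csqrt q) / (2 * csqrt q)"])
      fix q assume "q \<in> closed_segment (tilt (p n)) (far (p n))"
      then obtain t where t: "0 \<le> t" "t \<le> 1" "q = tilt (p n) + of_real t * (far (p n) - tilt (p n))"
        by (auto simp: in_segment scaleR_conv_of_real algebra_simps)
      define \<theta> where "\<theta> = 1 - t"
      have \<theta>: "0 \<le> \<theta>" "\<theta> \<le> 1" using t by (auto simp: \<theta>_def)
      \<comment> \<open>Only the imaginary part changes along the segment, so \<open>q\<close> keeps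
        the real part \<open>100000 * m\<close>, away from the cut.\<close>
      have q: "q = of_real (50000 * m) * Complex 2 \<theta>"
        by (simp add: t(3) tilt_def far_def m_def \<theta>_def complex_eq_iff algebra_simps)
      have c2: "norm (Complex 2 \<theta>) ^ 2 = 4 + \<theta>\<^sup>2" by (simp add: cmod_power2)
      have \<theta>2: "0 \<le> \<theta>\<^sup>2" "\<theta>\<^sup>2 \<le> 1" using \<theta> by (auto simp: power_le_one)
      have "norm (Complex 2 \<theta>) ^ 2 \<le> (9 / 4)\<^sup>2" unfolding c2 power_divide using \<theta>2 by simp
      then have c1: "norm (Complex 2 \<theta>) \<le> 9 / 4" by (rule power2_le_imp_le) simp
      have nq: "norm q \<le> 112500 * m" using mult_left_mono[OF c1, of "50000 * m"] m by (simp add: q norm_mult)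
      have qr: "norm q < rad" using nq pn(2)[of n] rad unfolding m_def rad1_def by linarith
      have nq2: "norm q ^ 2 \<le> 12500000000 * m\<^sup>2"
      proof -
        have "norm q ^ 2 = 2500000000 * m\<^sup>2 * (4 + \<theta>\<^sup>2)" using m unfolding q norm_mult power_mult_distrib c2 by simp
        also have "\<dots> \<le> 2500000000 * m\<^sup>2 * 5" using \<theta>2 by (intro mult_left_mono) auto
        finally show ?thesis by simp
      qed
      have r1: "7500000000 * m\<^sup>2 \<le> Re (q\<^sup>2)"
      proof -
        have "Re (q\<^sup>2) = 2500000000 * m\<^sup>2 * (4 - \<theta>\<^sup>2)" by (simp add: q power2_eq_square algebra_simps)
        moreover have "2500000000 * m\<^sup>2 * 3 \<le> 2500000000 * m\<^sup>2 * (4 - \<theta>\<^sup>2)" using \<theta>2 by (intro mult_left_mono) auto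
        ultimately show ?thesis by simp
      qed
      have i2: "m * norm q \<le> m * (112500 * m)" using nq m by (intro mult_left_mono) auto
      have r2: "Re (p n * q) \<le> m * norm q" unfolding m_def norm_mult[symmetric] by (rule complex_Re_le_cmod)
      have e1: "m * (112500 * m) = 112500 * m\<^sup>2" by (simp add: power2_eq_square)
      have arith: "T \<le> A / 12 - C / 6 - F / 1000 - G / 1000" if "7500000000 * T \<le> A" "C \<le> F" "F \<le> 112500 * T"
        "G \<le> 12500000000 * T" "0 \<le> T" for A C F G T :: real using that by simp
      have "m\<^sup>2 \<le> Re (q\<^sup>2) / 12 - Re (p n * q) / 6 - m * norm q / 1000 - norm q ^ 2 / 1000"
        by (rule arith[OF r1 r2 i2[unfolded e1] nq2]) simp
      also have "\<dots> \<le> Re (h_rel (p n) q)" unfolding m_def by (rule Re_h_rel_ge[OF pn(3) qr])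
      finally have "\<eta>\<^sup>2 \<le> Re (h_rel (p n) q)" using power_mono[OF m(2), of 2] p(3) by simp
      then have e: "norm (boltzmann (N n) (beta_of (p n)) (csqrt q)) \<le> exp (- real (N n) * \<eta>\<^sup>2)"
        using boltzmann_eq[OF pn(3)[of n], of "csqrt q" "N n"] qr mult_left_mono[of "\<eta>\<^sup>2" "Re (h_rel (p n) q)" "real (N n)"] by simp
      have Rq: "100000 * m = Re q" by (simp add: q)
      have "\<eta> \<le> norm q" using complex_Re_le_cmod[of q] m Rq by linarith
      then have "sqrt \<eta> \<le> 2 * norm (csqrt q)" using p(3) by (simp add: norm_csqrt) (smt (verit) real_sqrt_ge_zero real_sqrt_le_mono)
      then show "norm (boltzmann (N n) (beta_of (p n)) (csqrt q) / (2 * csqrt q)) \<le> 1 / sqrt \<eta> * exp (- real (N n) * \<eta>\<^sup>2)"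
        unfolding norm_divide norm_mult using e p(3)
        by (simp add: frac_le)
      show "((\<lambda>q. boltzmann_prim (N n) (beta_of (p n)) (csqrt q)) has_field_derivative boltzmann (N n) (beta_of (p n)) (csqrt q) / (2 * csqrt q))
         (at q within closed_segment (tilt (p n)) (far (p n)))"
        using Rq m by (intro boltzmann_prim_csqrt_deriv beta_of_nz pn N not_nonpos_Reals_if) auto
    qed auto
    also have "\<dots> \<le> 1 / sqrt \<eta> * exp (- real (N n) * \<eta>\<^sup>2) * 1"
    proof (intro mult_left_mono)
      have "far (p n) - tilt (p n) = - (of_real (50000 * m) * \<i>)" by (simp add: far_def tilt_def m_def complex_eq_iff)
      then have "norm (far (p n) - tilt (p n)) = 50000 * m" using m by (simp add: norm_mult)
      then show "norm (far (p n) - tilt (p n)) \<le> 1" using m by simp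
    qed (use p in auto)
    finally show "norm (boltzmann_prim (N n) (beta_of (p n)) (csqrt (far (p n))) - boltzmann_prim (N n) (beta_of (p n)) (csqrt (tilt (p n))))
      \<le> 1 / sqrt \<eta> * exp (- real (N n) * \<eta>\<^sup>2)" by simp
  qed (use p in auto)
  have C: "(\<lambda>n. of_real (sqrt (N n)) * (boltzmann_total (N n) (beta_of (p n)) - boltzmann_prim (N n) (beta_of (p n)) (csqrt (far (p n)))))
     \<longlonglongrightarrow> 0"
  proof (rule sqrt_exp_decay[OF N(1), where \<kappa> = "\<eta>\<^sup>2" and A = "1 / (\<eta> * sqrt \<eta>)"])
    fix n
    have "norm (boltzmann_total (N n) (beta_of (p n)) - boltzmann_prim (N n) (beta_of (p n)) (csqrt (far (p n))))
        \<le> 1 / (\<eta> * sqrt \<eta>) * exp (- real (N n) * (100000 * norm (p n) ^ 2))"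
      by (intro far_tail pn p N)
    also have "\<dots> \<le> 1 / (\<eta> * sqrt \<eta>) * exp (- real (N n) * \<eta>\<^sup>2)"
    proof (intro mult_left_mono)
      have "\<eta>\<^sup>2 \<le> 1 * norm (p n) ^ 2" using power_mono[OF pn(1)[of n], of 2] p(3) by simp
      also have "\<dots> \<le> 100000 * norm (p n) ^ 2" by (intro mult_right_mono) auto
      finally have "real (N n) * \<eta>\<^sup>2 \<le> real (N n) * (100000 * norm (p n) ^ 2)" by (intro mult_left_mono) auto
      then show "exp (- real (N n) * (100000 * norm (p n) ^ 2)) \<le> exp (- real (N n) * \<eta>\<^sup>2)" by simp
    qed (use p in auto)
    finally show "norm (boltzmann_total (N n) (beta_of (p n)) - boltzmann_prim (N n) (beta_of (p n)) (csqrt (far (p n))))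
        \<le> 1 / (\<eta> * sqrt \<eta>) * exp (- real (N n) * \<eta>\<^sup>2)" .
  qed (use p in auto)
  from tendsto_add[OF tendsto_add[OF A B] C]
  show "(\<lambda>n. of_real (sqrt (N n)) * boltzmann_total (N n) (beta_of (p n)))
     \<longlonglongrightarrow> csqrt (tilt p0) * (of_real (sqrt pi) / (2 * csqrt ((lcs' p0 - 1 / 2) * tilt p0)))"
    by (simp add: algebra_simps)
qed

lemma partition_nonzero_inner:
  assumes "0 < \<eta>" "\<rho> < rad1"
  shows "\<exists>N0. \<forall>N\<ge>N0. \<forall>p\<in>inner_set \<eta> \<rho>. partition_function (beta_of p) N \<noteq> 0"
proof -
  have nz: "2 * saddle_const p \<noteq> 0" if "p \<in> inner_set \<eta> \<rho>" for p
  proof -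
    have "p \<noteq> 0" "norm p < rad" using that assms rad1 by (auto simp: inner_set_def)
    then show ?thesis using saddle_const_nz[of p] by simp
  qed
  obtain C N0 where C: "C \<ge> 1" "\<And>N p. N \<ge> N0 \<Longrightarrow> p \<in> inner_set \<eta> \<rho> \<Longrightarrow>
     1 / C \<le> norm (of_real (sqrt (real N)) * (exp (of_nat N * h_saddle p) * boltzmann_total N (beta_of p)))"
    using compact_uniform_bounds[OF compact_regions(2), of \<eta> \<rho>
        "\<lambda>N p. of_real (sqrt (real N)) * (exp (of_nat N * h_saddle p) * boltzmann_total N (beta_of p))" "\<lambda>p. 2 * saddle_const p"]
      inner_limit[OF _ _ _ _ _ assms] nz by blast
  show ?thesis
  proof (intro exI[of _ "max N0 1"] allI impI ballI)
    fix N p assume N: "max N0 1 \<le> N" and p: "p \<in> inner_set \<eta> \<rho>"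
    have "0 < 1 / C" using C(1) by simp
    also have "\<dots> \<le> norm (of_real (sqrt (real N)) * (exp (of_nat N * h_saddle p) * boltzmann_total N (beta_of p)))"
      using C(2) N p by simp
    finally have "boltzmann_total N (beta_of p) \<noteq> 0" by auto
    then show "partition_function (beta_of p) N \<noteq> 0" by (auto simp: boltzmann_total_def)
  qed
qed

lemma partition_nonzero_outer:
  assumes "0 < \<eta>" "\<rho> < rad1"
  shows "\<exists>N0. \<forall>N\<ge>N0. \<forall>p\<in>outer_set \<eta> \<rho>. partition_function (beta_of p) N \<noteq> 0"
proof -
  define l where "l = (\<lambda>p0. csqrt (tilt p0) * (of_real (sqrt pi) / (2 * csqrt ((lcs' p0 - 1 / 2) * tilt p0))))"
  have lim: "(\<lambda>n. of_real (sqrt (N n)) * boltzmann_total (N n) (beta_of (p n))) \<longlonglongrightarrow> l p0" and nz: "l p0 \<noteq> 0"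
    if "filterlim N at_top sequentially" "\<And>n. 0 < N n" "\<And>n. p n \<in> outer_set \<eta> \<rho>" "p0 \<in> outer_set \<eta> \<rho>" "p \<longlonglongrightarrow> p0" for N p p0
    using outer_limit[OF that(1,2,5,3,4) assms] by (auto simp: l_def)
  have nz': "l p0 \<noteq> 0" if "p0 \<in> outer_set \<eta> \<rho>" for p0
    using nz[of Suc "\<lambda>_. p0" p0] that filterlim_Suc by auto
  obtain C N0 where C: "C \<ge> 1" "\<And>N p. N \<ge> N0 \<Longrightarrow> p \<in> outer_set \<eta> \<rho> \<Longrightarrow>
     1 / C \<le> norm (of_real (sqrt (real N)) * boltzmann_total N (beta_of p))"
    using compact_uniform_bounds[OF compact_regions(3), of \<eta> \<rho> "\<lambda>N p. of_real (sqrt (real N)) * boltzmann_total N (beta_of p)" l] lim nz'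
    by blast
  show ?thesis
  proof (intro exI[of _ "max N0 1"] allI impI ballI)
    fix N p assume N: "max N0 1 \<le> N" and p: "p \<in> outer_set \<eta> \<rho>"
    have "0 < 1 / C" using C(1) by simp
    also have "\<dots> \<le> norm (of_real (sqrt (real N)) * boltzmann_total N (beta_of p))"
      using C(2) N p by simp
    finally have "boltzmann_total N (beta_of p) \<noteq> 0" by auto
    then show "partition_function (beta_of p) N \<noteq> 0" by (auto simp: boltzmann_total_def)
  qed
qed

section \<open>Zeros near the critical curve\<close>

definition near_open :: "real \<Rightarrow> real \<Rightarrow> complex set" where
  "near_open \<eta> \<rho> = {p. \<eta> < Re p \<and> Re p < 3 * Im p \<and> Im p < 3 * Re p \<and> norm p < \<rho>}"
text \<open>The slopes \<open>1 / 2\<close> and \<open>5 / 2\<close> are those that bound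
  \<open>inner_set\<close> and \<open>outer_set\<close>, so no direction of the upper half plane is
  left out. The wider \<open>near_open\<close> around it makes room for Cauchy estimates.\<close>

definition core_set :: "real \<Rightarrow> real \<Rightarrow> complex set" where
  "core_set \<eta> \<rho> = {p. \<eta> \<le> Re p \<and> Re p \<le> 2 * Im p \<and> 2 * Im p \<le> 5 * Re p \<and> norm p \<le> \<rho>}"

lemma near_open_props: "open (near_open \<eta> \<rho>)" "convex (near_open \<eta> \<rho>)" "near_open \<eta> \<rho> \<subseteq> near_set \<eta> \<rho>"
proof -
  show "open (near_open \<eta> \<rho>)"
    unfolding near_open_def by (intro open_Collect_conj open_Collect_less continuous_intros)
  have eq: "near_open \<eta> \<rho> = {p. Re p > \<eta>} \<inter> {p. inner (Complex 1 (- 3)) p < 0} \<inter> {p. inner (Complex (- 3) 1) p < 0} \<inter> ball 0 \<rho>"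
    by (auto simp: near_open_def inner_complex_def)
  show "convex (near_open \<eta> \<rho>)"
    unfolding eq by (intro convex_Int convex_halfspace_Re_gt convex_halfspace_lt convex_ball)
qed (auto simp: near_open_def near_set_def)

lemma core_set_props: "compact (core_set \<eta> \<rho>)" "convex (core_set \<eta> \<rho>)"
proof -
  have "closed (core_set \<eta> \<rho>)"
    unfolding core_set_def by (intro closed_Collect_conj closed_Collect_le continuous_intros)
  then show "compact (core_set \<eta> \<rho>)"
    by (rule compact_closed_bounded[of _ \<rho>]) (auto simp: core_set_def)
  have eq: "core_set \<eta> \<rho> = {p. Re p \<ge> \<eta>} \<inter> {p. inner (Complex 1 (- 2)) p \<le> 0} \<inter> {p. inner (Complex (- 5) 2) p \<le> 0} \<inter> cball 0 \<rho>"
    by (auto simp: core_set_def inner_complex_def)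
  show "convex (core_set \<eta> \<rho>)"
    unfolding eq by (intro convex_Int convex_halfspace_Re_ge convex_halfspace_le convex_cball)
qed

lemma core_subset_near: "0 < \<eta> \<Longrightarrow> \<eta> < \<eta>' \<Longrightarrow> \<rho>' < \<rho> \<Longrightarrow> core_set \<eta>' \<rho>' \<subseteq> near_open \<eta> \<rho>"
  by (auto simp: core_set_def near_open_def)

text \<open>The point is that \<open>M\<close> depends on the sets and \<open>C\<close> alone, not
  on \<open>q\<close>, hence later not on \<open>N\<close>. Cauchy's inequality bounds the
  derivative of the logarithm on \<open>K\<close>, and integration from a base point bounds the
  logarithm.\<close>

lemma holomorphic_log_bounds:
  assumes U: "open U" "convex U" and K: "compact K" "convex K" "K \<subseteq> U" and C: "1 \<le> C"
  shows "\<exists>M. \<forall>q. q holomorphic_on U \<and> (\<forall>z\<in>U. 1 / C \<le> norm (q z) \<and> norm (q z) \<le> C) \<longrightarrow>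
     (\<exists>g. g holomorphic_on U \<and> (\<forall>z\<in>U. q z = exp (g z)) \<and> (\<forall>z\<in>K. norm (g z) \<le> M \<and> norm (deriv g z) \<le> M))"
proof (cases "K = {}")
  case True
  have "\<exists>g. g holomorphic_on U \<and> (\<forall>z\<in>U. q z = exp (g z))"
    if "q holomorphic_on U" "\<forall>z\<in>U. 1 / C \<le> norm (q z) \<and> norm (q z) \<le> C" for q
  proof -
    have "q z \<noteq> 0" if "z \<in> U" for z
      using C \<open>\<forall>z\<in>U. _ z\<close> that by force
    then show ?thesis
      using contractible_imp_holomorphic_log[OF that(1) convex_imp_contractible[OF U(2)]] by metis
  qed
  then show ?thesis using True by auto
next
  case False
  then obtain z0 where z0: "z0 \<in> K" by blast
  obtain e where e: "e > 0" "\<And>z. z \<in> K \<Longrightarrow> cball z e \<subseteq> U"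
    using compact_subset_open_imp_cball_epsilon_subset[OF K(1) U(1) K(3)] by (metis UN_subset_iff)
  obtain R where R: "\<And>z w. z \<in> K \<Longrightarrow> w \<in> K \<Longrightarrow> norm (z - w) \<le> R"
    using compact_imp_bounded[OF K(1)] unfolding bounded_two_points dist_norm by blast
  define M1 where "M1 = C * (C / e)"
  have M1: "0 \<le> M1" using C e by (simp add: M1_def)
  \<comment> \<open>At the base point the real part is at most \<open>ln C\<close> and the imaginary
    part at most \<open>pi < 4\<close> in absolute value; \<open>M1 * R\<close> is the derivative
    bound times a bound for the diameter of \<open>K\<close>.\<close>
  define M where "M = max M1 (M1 * R + ln C + 4)"
  show ?thesis
  proof (intro exI[of _ M] allI impI)
    fix q assume "q holomorphic_on U \<and> (\<forall>z\<in>U. 1 / C \<le> norm (q z) \<and> norm (q z) \<le> C)"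
    then have q: "q holomorphic_on U" "\<And>z. z \<in> U \<Longrightarrow> 1 / C \<le> norm (q z)" "\<And>z. z \<in> U \<Longrightarrow> norm (q z) \<le> C" by auto
    have pos: "0 < 1 / C" using C by simp
    have qnz: "q z \<noteq> 0" if "z \<in> U" for z using q(2)[OF that] pos by auto
    obtain g0 where g0: "g0 holomorphic_on U" "\<And>z. z \<in> U \<Longrightarrow> q z = exp (g0 z)"
      using contractible_imp_holomorphic_log[OF q(1) convex_imp_contractible[OF U(2)]] qnz by metis
    \<comment> \<open>The added constant is a multiple of \<open>2 * pi * \<i>\<close>, so
      \<open>g\<close> is still a logarithm of \<open>q\<close>, now with its principal value at
      \<open>z0\<close>.\<close>
    define g where "g = (\<lambda>z. g0 z + (Ln (q z0) - g0 z0))"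
    have z0U: "z0 \<in> U" using z0 K by auto
    have gh: "g holomorphic_on U" unfolding g_def by (intro holomorphic_intros g0)
    have ge: "q z = exp (g z)" if "z \<in> U" for z
    proof -
      have "exp (Ln (q z0) - g0 z0) = 1" using qnz[OF z0U] g0(2)[OF z0U] by (simp add: exp_diff)
      then show ?thesis using g0(2)[OF that] by (simp add: g_def exp_add)
    qed
    have gd: "(g has_field_derivative deriv g z) (at z)" if "z \<in> U" for z
      by (rule holomorphic_derivI[OF gh U(1) that])
    have dbound: "norm (deriv g z) \<le> M1" if z: "z \<in> K" for z
    proof -
      have zU: "z \<in> U" using z K by auto
      have "((\<lambda>z. exp (g z)) has_field_derivative exp (g z) * deriv g z) (at z)"
        by (auto intro!: derivative_eq_intros gd zU)
      then have "(q has_field_derivative exp (g z) * deriv g z) (at z)"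
        by (rule has_field_derivative_transform_within_open[OF _ U(1) zU]) (simp add: ge)
      then have dq: "deriv q z = q z * deriv g z" using ge[OF zU] by (simp add: DERIV_imp_deriv)
      have "norm ((deriv ^^ 1) q z) \<le> fact 1 * C / e ^ 1"
      proof (rule Cauchy_inequality)
        show "q holomorphic_on ball z e" using q(1) e(2)[OF z] by (rule holomorphic_on_subset[OF _ order_trans[OF ball_subset_cball]])
        show "continuous_on (cball z e) q" using holomorphic_on_imp_continuous_on[OF q(1)] e(2)[OF z] continuous_on_subset by blast
        show "norm (q x) \<le> C" if "norm (z - x) = e" for x
          using that e(2)[OF z] by (intro q(3)) (auto simp: dist_norm)
      qed (rule e(1))
      then have "norm (q z) * norm (deriv g z) \<le> C / e" by (simp add: dq norm_mult)
      moreover have "1 / C * norm (deriv g z) \<le> norm (q z) * norm (deriv g z)"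
        using q(2)[OF zU] by (intro mult_right_mono) auto
      ultimately have "1 / C * norm (deriv g z) \<le> C / e" by linarith
      then show ?thesis using C by (simp add: M1_def field_simps)
    qed
    have gb: "norm (g z) \<le> M1 * R + ln C + 4" if z: "z \<in> K" for z
    proof -
      have "norm (g z - g z0) \<le> M1 * norm (z - z0)"
        by (rule field_differentiable_bound[OF K(2) _ dbound z z0])
          (use K in \<open>auto intro: has_field_derivative_at_within gd\<close>)
      also have "\<dots> \<le> M1 * R" by (intro mult_left_mono R z z0 M1)
      finally have 1: "norm (g z - g z0) \<le> M1 * R" .
      have "g z0 = Ln (q z0)" by (simp add: g_def)
      then have "norm (g z0) \<le> \<bar>Re (Ln (q z0))\<bar> + \<bar>Im (Ln (q z0))\<bar>" using cmod_le[of "g z0"] by simp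
      moreover have "\<bar>Im (Ln (q z0))\<bar> \<le> pi" using mpi_less_Im_Ln[OF qnz[OF z0U]] Im_Ln_le_pi[OF qnz[OF z0U]] by linarith
      moreover have "\<bar>Re (Ln (q z0))\<bar> \<le> ln C"
      proof -
        have "ln (norm (q z0)) \<le> ln C" using q(3)[OF z0U] qnz[OF z0U] by (intro ln_mono) auto
        moreover have "ln (1 / C) \<le> ln (norm (q z0))" using q(2)[OF z0U] pos by (intro ln_mono) auto
        ultimately show ?thesis using C qnz[OF z0U] by (simp add: Re_Ln ln_div abs_le_iff)
      qed
      moreover have "norm (g z) \<le> norm (g z - g z0) + norm (g z0)" by (metis diff_add_cancel norm_triangle_ineq)
      ultimately show ?thesis using 1 pi_less_4 by linarith
    qed
    show "\<exists>g. g holomorphic_on U \<and> (\<forall>z\<in>U. q z = exp (g z)) \<and> (\<forall>z\<in>K. norm (g z) \<le> M \<and> norm (deriv g z) \<le> M)"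
      using gh ge gb dbound by (intro exI[of _ g]) (auto simp: M_def le_max_iff_disj)
  qed
qed

text \<open>\<open>g\<close> is the logarithm of the quotient of the two contributions. The factors
  \<open>sqrt N\<close> cancel in it, so it is bounded independently of \<open>N\<close> and only a
  lower order correction to \<open>N * h_saddle p\<close>.\<close>

lemma partition_zeros_near:
  assumes "0 < \<eta>" "\<eta> < \<eta>'" "\<rho>' < \<rho>" "\<rho> < rad1"
  shows "\<exists>M N0. \<forall>N\<ge>N0. \<exists>g. g holomorphic_on near_open \<eta> \<rho> \<and>
     (\<forall>p\<in>core_set \<eta>' \<rho>'. norm (g p) \<le> M \<and> norm (deriv g p) \<le> M) \<and>
     (\<forall>p\<in>near_open \<eta> \<rho>. partition_function (beta_of p) N = 0 \<longleftrightarrow> exp (of_nat N * h_saddle p + g p) = - 1)"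
proof -
  let ?U = "near_open \<eta> \<rho>"
  \<comment> \<open>\<open>A\<close> is the integral from the origin to the valley point,
    \<open>B\<close> the integral from there to infinity, normalised by the size of the saddle
    contribution.\<close>
  define A where "A = (\<lambda>N p. boltzmann_prim N (beta_of p) (csqrt (\<i> * p)))"
  define B where "B = (\<lambda>N p. exp (of_nat N * h_saddle p) * (boltzmann_total N (beta_of p) - A N p))"
  define l where "l = (\<lambda>p0. csqrt (\<i> * p0) * (of_real (sqrt pi) / (2 * csqrt ((lcs' p0 - 1 / 2) * (\<i> * p0)))))"
  have cs: "\<i> * p \<notin> \<real>\<^sub>\<le>\<^sub>0" "p \<noteq> 0" "norm p < rad" if "p \<in> near_set \<eta> \<rho>" for p
    using that assms rad1 by (auto intro!: not_nonpos_Reals_if simp: near_set_def)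
  have limA: "(\<lambda>n. of_real (sqrt (N n)) * A (N n) (p n)) \<longlonglongrightarrow> l p0" and nzA: "l p0 \<noteq> 0"
    if "filterlim N at_top sequentially" "\<And>n. 0 < N n" "\<And>n. p n \<in> near_set \<eta> \<rho>" "p0 \<in> near_set \<eta> \<rho>" "p \<longlonglongrightarrow> p0" for N p p0
    using near_ray_limit[OF that(1,2,5,3,4) assms(1,4)] cs[OF that(4)] by (auto simp: l_def A_def)
  have nzA': "l p0 \<noteq> 0" if "p0 \<in> near_set \<eta> \<rho>" for p0
    using nzA[of Suc "\<lambda>_. p0" p0] that filterlim_Suc by auto
  obtain C1 N1 where C1: "C1 \<ge> 1" "\<And>N p. N \<ge> N1 \<Longrightarrow> p \<in> near_set \<eta> \<rho> \<Longrightarrow>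
     1 / C1 \<le> norm (of_real (sqrt (real N)) * A N p) \<and> norm (of_real (sqrt (real N)) * A N p) \<le> C1"
    using compact_uniform_bounds[OF compact_regions(1), of \<eta> \<rho> "\<lambda>N p. of_real (sqrt (real N)) * A N p" l] limA nzA'
    by blast
  have limB: "(\<lambda>n. of_real (sqrt (N n)) * B (N n) (p n)) \<longlonglongrightarrow> 2 * saddle_const p0"
    if "filterlim N at_top sequentially" "\<And>n. 0 < N n" "\<And>n. p n \<in> near_set \<eta> \<rho>" "p0 \<in> near_set \<eta> \<rho>" "p \<longlonglongrightarrow> p0" for N p p0
    using near_segment_limit[OF that(1,2,5,3,4) assms(1,4)] by (simp add: B_def A_def)
  have nzB: "2 * saddle_const p0 \<noteq> 0" if "p0 \<in> near_set \<eta> \<rho>" for p0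
    using saddle_const_nz[OF cs(3,2)[OF that]] by simp
  obtain C2 N2 where C2: "C2 \<ge> 1" "\<And>N p. N \<ge> N2 \<Longrightarrow> p \<in> near_set \<eta> \<rho> \<Longrightarrow>
     1 / C2 \<le> norm (of_real (sqrt (real N)) * B N p) \<and> norm (of_real (sqrt (real N)) * B N p) \<le> C2"
    using compact_uniform_bounds[OF compact_regions(1), of \<eta> \<rho> "\<lambda>N p. of_real (sqrt (real N)) * B N p" "\<lambda>p. 2 * saddle_const p"] limB nzB
    by blast
  define C where "C = C1 * C2"
  have C: "1 \<le> C" using mult_mono[OF C1(1) C2(1)] C1(1) by (simp add: C_def)
  obtain M where M: "\<And>q. q holomorphic_on ?U \<Longrightarrow> (\<And>z. z \<in> ?U \<Longrightarrow> 1 / C \<le> norm (q z) \<and> norm (q z) \<le> C) \<Longrightarrow>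
     (\<exists>g. g holomorphic_on ?U \<and> (\<forall>z\<in>?U. q z = exp (g z)) \<and> (\<forall>z\<in>core_set \<eta>' \<rho>'. norm (g z) \<le> M \<and> norm (deriv g z) \<le> M))"
    using holomorphic_log_bounds[OF near_open_props(1,2) core_set_props core_subset_near[OF assms(1-3)] C] by blast
  show ?thesis
  proof (intro exI[of _ M] exI[of _ "max (max N1 N2) 1"] allI impI)
    fix N :: nat assume "max (max N1 N2) 1 \<le> N"
    then have N: "N1 \<le> N" "N2 \<le> N" "0 < N" by auto
    have U: "?U \<subseteq> near_set \<eta> \<rho>" by (rule near_open_props)
    have sN: "0 < sqrt (real N)" using N by simp
    have bA: "1 / C1 \<le> sqrt N * norm (A N p)" "sqrt N * norm (A N p) \<le> C1"
      and bB: "1 / C2 \<le> sqrt N * norm (B N p)" "sqrt N * norm (B N p) \<le> C2" if "p \<in> ?U" for p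
      using C1(2)[OF N(1)] C2(2)[OF N(2)] U that by (auto simp: norm_mult)
    have Ap: "0 < norm (A N p)" "0 < norm (B N p)" if "p \<in> ?U" for p
    proof -
      have "0 < 1 / C1" "0 < 1 / C2" using C1(1) C2(1) by auto
      then have "0 < sqrt N * norm (A N p)" "0 < sqrt N * norm (B N p)"
        using bA(1)[OF that] bB(1)[OF that] by linarith+
      then show "0 < norm (A N p)" "0 < norm (B N p)" by (auto simp: zero_less_mult_iff)
    qed
    have hb: "beta_of holomorphic_on ?U" "h_saddle holomorphic_on ?U"
      using cs(3) U by (auto intro!: holomorphic_on_subset[OF beta_of_holomorphic] holomorphic_on_subset[OF h_saddle_holomorphic])
    have Rb: "0 < Re (beta_of p)" if "p \<in> ?U" for p
      using Re_beta_of[OF cs(3), of p] U that by force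
    have hcs: "(\<lambda>p. csqrt (\<i> * p)) holomorphic_on ?U"
      using cs(1) U by (intro holomorphic_intros) auto
    have hA: "A N holomorphic_on ?U"
      unfolding A_def by (intro boltzmann_prim_holomorphic(1) hb hcs Rb N)
    have hB: "B N holomorphic_on ?U"
      unfolding B_def by (intro holomorphic_intros hb hA boltzmann_prim_holomorphic(2)[OF hb(1) hcs Rb N(3)])
    have "\<exists>g. g holomorphic_on ?U \<and> (\<forall>z\<in>?U. A N z / B N z = exp (g z)) \<and> (\<forall>z\<in>core_set \<eta>' \<rho>'. norm (g z) \<le> M \<and> norm (deriv g z) \<le> M)"
    proof (rule M)
      show "(\<lambda>p. A N p / B N p) holomorphic_on ?U"
        using Ap(2) by (intro holomorphic_intros hA hB) auto
      fix p assume p: "p \<in> ?U"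
      have q: "norm (A N p / B N p) = (sqrt N * norm (A N p)) / (sqrt N * norm (B N p))"
        using sN by (simp add: norm_divide)
      have "(1 / C1) / C2 \<le> (sqrt N * norm (A N p)) / (sqrt N * norm (B N p))"
        using bA[OF p] bB[OF p] C1(1) C2(1) Ap(2)[OF p] sN by (intro frac_le) auto
      moreover have "(sqrt N * norm (A N p)) / (sqrt N * norm (B N p)) \<le> C1 / (1 / C2)"
        using bA[OF p] bB[OF p] C1(1) C2(1) by (intro frac_le) auto
      ultimately show "1 / C \<le> norm (A N p / B N p) \<and> norm (A N p / B N p) \<le> C"
        unfolding q C_def by simp
    qed
    then obtain g where g: "g holomorphic_on ?U" "\<And>z. z \<in> ?U \<Longrightarrow> A N z / B N z = exp (g z)"
       "\<forall>z\<in>core_set \<eta>' \<rho>'. norm (g z) \<le> M \<and> norm (deriv g z) \<le> M" by blast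
    have "partition_function (beta_of p) N = 0 \<longleftrightarrow> exp (of_nat N * h_saddle p + g p) = - 1" if p: "p \<in> ?U" for p
    proof -
      have nz: "beta_of p \<noteq> 0" using Rb[OF p] by auto
      have t: "boltzmann_total N (beta_of p) = A N p + exp (- (of_nat N * h_saddle p)) * B N p"
        by (simp add: B_def exp_minus mult.assoc[symmetric])
      have "exp (of_nat N * h_saddle p + g p) * B N p = exp (of_nat N * h_saddle p) * A N p"
        unfolding exp_add g(2)[OF p, symmetric] using Ap(2)[OF p] by simp
      also have "\<dots> = exp (of_nat N * h_saddle p) * boltzmann_total N (beta_of p) - B N p"
        unfolding t by (simp add: exp_minus field_simps)
      finally have "(exp (of_nat N * h_saddle p + g p) + 1) * B N p = exp (of_nat N * h_saddle p) * boltzmann_total N (beta_of p)"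
        by (simp add: algebra_simps)
      moreover have "B N p \<noteq> 0" using Ap(2)[OF p] by auto
      ultimately have "boltzmann_total N (beta_of p) = 0 \<longleftrightarrow> exp (of_nat N * h_saddle p + g p) + 1 = 0"
        by (metis exp_not_eq_zero mult_eq_0_iff)
      then show ?thesis using boltzmann_total_eq_0_iff[OF nz N(3)] by (simp add: eq_neg_iff_add_eq_0)
    qed
    then show "\<exists>g. g holomorphic_on ?U \<and>
       (\<forall>p\<in>core_set \<eta>' \<rho>'. norm (g p) \<le> M \<and> norm (deriv g p) \<le> M) \<and>
       (\<forall>p\<in>?U. partition_function (beta_of p) N = 0 \<longleftrightarrow> exp (of_nat N * h_saddle p + g p) = - 1)"
      using g by blast
  qed
qed

section \<open>Critical arc\<close>

text \<open>All power series involved have real coefficients. This transfers the results for the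
  upper half plane to the lower one.\<close>

lemma beta_of_cnj: "beta_of (cnj p) = cnj (beta_of p)"
proof -
  have s: "(\<Sum>n. a n * cnj p ^ n) = cnj (\<Sum>n. a n * p ^ n)"
    if "summable (\<lambda>n. a n * p ^ n)" "\<And>n. cnj (a n) = a n" for a
    using bounded_linear.suminf[OF bounded_linear_cnj that(1)] by (simp add: that(2))
  have c: "cnj (cosh_sqrt_coeff n) = cosh_sqrt_coeff n" for n by (simp add: cosh_sqrt_coeff_def)
  have d: "cnj (diffs cosh_sqrt_coeff n) = diffs cosh_sqrt_coeff n" for n by (simp add: diffs_def c)
  have "lcs' (cnj p) = cnj (lcs' p)"
    unfolding lcs'_def cosh_sqrt_def cosh_sqrt'_def
    by (simp add: s[OF summable_cosh_sqrt c] s[OF termdiff_converges_all[OF summable_cosh_sqrt] d])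
  then show ?thesis by (simp add: beta_of_def)
qed

text \<open>\<open>lcs' z + z / 6\<close> has Lipschitz constant \<open>1 / 1000\<close>. The
  estimate yields injectivity of \<open>beta_of\<close> on the whole disc and continuity of its
  local inverse.\<close>

lemma lcs'_expanding:
  assumes "norm z < rad" "norm w < rad"
  shows "norm (z - w) \<le> 7 * norm (lcs' z - lcs' w)"
proof -
  have "norm ((z - w) / 6) \<le> norm (lcs' z - lcs' w + (z - w) / 6) + norm (lcs' z - lcs' w)"
    by (metis add_diff_cancel_left' norm_triangle_ineq4)
  also have "\<dots> \<le> norm (z - w) / 1000 + norm (lcs' z - lcs' w)"
    using lcs'_approx[OF assms] by simp
  finally have "x / 6 \<le> x / 1000 + norm (lcs' z - lcs' w)" if "x = norm (z - w)" for x
    using that by (simp add: norm_divide)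
  then have *: "norm (z - w) / 6 \<le> norm (z - w) / 1000 + norm (lcs' z - lcs' w)" by blast
  have "x \<le> 7 * y" if "x / 6 \<le> x / 1000 + y" "0 \<le> x" for x y :: real using that by simp
  from this[OF * norm_ge_zero] show ?thesis .
qed

lemma beta_of_inj: "inj_on beta_of (ball 0 rad)"
proof (rule inj_onI)
  fix z w assume zw: "z \<in> ball 0 rad" "w \<in> ball 0 rad" "beta_of z = beta_of w"
  then have "lcs' z = lcs' w" by (simp add: beta_of_def)
  then show "z = w" using lcs'_expanding[of z w] zw by simp
qed

lemma norm_beta_of_bounds:
  assumes "norm p < rad"
  shows "norm (beta_of p - 1) \<le> 35 / 100 * norm p" "norm p \<le> 31 / 10 * norm (beta_of p - 1)"
proof -
  have "norm (beta_of p - 1) \<le> norm (beta_of p - 1 - p / 3) + norm (p / 3)"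
    by (metis diff_add_cancel norm_triangle_ineq)
  then have "norm (beta_of p - 1) \<le> norm p / 100 + norm p / 3"
    using beta_of_approx[OF assms] by (simp add: norm_divide)
  moreover have "y \<le> 35 / 100 * x" if "y \<le> x / 100 + x / 3" "0 \<le> x" for x y :: real using that by simp
  ultimately show "norm (beta_of p - 1) \<le> 35 / 100 * norm p" using norm_ge_zero by blast
  have "norm (p / 3) \<le> norm (beta_of p - 1 - p / 3) + norm (beta_of p - 1)"
    by (metis add_diff_cancel_left' diff_diff_eq2 norm_minus_commute norm_triangle_ineq4 add.commute)
  then have "norm p / 3 \<le> norm p / 100 + norm (beta_of p - 1)"
    using beta_of_approx[OF assms] by (simp add: norm_divide)
  moreover have "x \<le> 31 / 10 * y" if "x / 3 \<le> x / 100 + y" "0 \<le> x" for x y :: real using that by simp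
  ultimately show "norm p \<le> 31 / 10 * norm (beta_of p - 1)" using norm_ge_zero by blast
qed

text \<open>A function whose derivative stays in a half plane is expanding (Noshiro--Warschawski).\<close>

lemma expanding_if_Re_deriv_ge:
  fixes f :: "complex \<Rightarrow> complex"
  assumes S: "convex S" "z \<in> S" "w \<in> S"
    and d: "\<And>x. x \<in> S \<Longrightarrow> (f has_field_derivative f' x) (at x)"
    and m: "\<And>x. x \<in> S \<Longrightarrow> m \<le> Re (a * f' x)"
  shows "m * norm (z - w) \<le> norm a * norm (f z - f w)"
proof (cases "z = w")
  case False
  \<comment> \<open>The factor \<open>cnj (z - w)\<close> turns \<open>f' x * (z - w)\<close> into
    \<open>norm (z - w)^2 * f' x\<close>, so the mean value theorem for the real part brings in
    \<open>Re (a * f' x)\<close>.\<close>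
  let ?c = "a * cnj (z - w)"
  have seg: "closed_segment w z \<subseteq> S" using S by (simp add: closed_segment_subset)
  obtain x where x: "x \<in> closed_segment w z" "Re (?c * f z) - Re (?c * f w) = Re (?c * f' x * (z - w))"
    using complex_mvt_line[of w z "\<lambda>x. ?c * f x" "\<lambda>x. ?c * f' x"] DERIV_cmult[OF d] seg by blast
  have "?c * f' x * (z - w) = of_real (norm (z - w) ^ 2) * (a * f' x)"
    unfolding complex_norm_square by (simp only: mult_ac)
  then have eq: "Re (?c * f z - ?c * f w) = norm (z - w) ^ 2 * Re (a * f' x)"
    unfolding minus_complex.sel x(2) by (simp only: Re_complex_of_real Im_complex_of_real times_complex.simps)
  have "norm (z - w) ^ 2 * m \<le> norm (z - w) ^ 2 * Re (a * f' x)"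
    using m[of x] x(1) seg by (intro mult_left_mono) auto
  also have "\<dots> = Re (?c * (f z - f w))" unfolding eq[symmetric] by (simp only: right_diff_distrib)
  also have "\<dots> \<le> norm a * norm (z - w) * norm (f z - f w)"
    using complex_Re_le_cmod[of "?c * (f z - f w)"] by (simp only: norm_mult complex_mod_cnj)
  finally have "norm (z - w) * (m * norm (z - w)) \<le> norm (z - w) * (norm a * norm (f z - f w))"
    by (simp only: power2_eq_square mult_ac)
  then show ?thesis using False by (simp add: mult_le_cancel_left_pos)
qed simp

text \<open>The derivative of \<open>- h_saddle\<close> is about \<open>p / 6\<close>, and
  multiplication by \<open>1 - \<i>\<close> turns the first quadrant into the cone around the
  positive real axis.\<close>

lemma Re_h_saddle_deriv_ge:
  assumes "norm p < rad" "0 \<le> Re p" "0 \<le> Im p"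
  shows "norm p / 7 \<le> Re ((1 - \<i>) * (- (p * lcs'' p)))"
proof -
  let ?e = "- ((1 - \<i>) * p * (lcs'' p + 1 / 6))"
  have "(1 - \<i>) * (- (p * lcs'' p)) = (1 - \<i>) * p / 6 + ?e" by (simp add: algebra_simps)
  then have eq: "Re ((1 - \<i>) * (- (p * lcs'' p))) = (Re p + Im p) / 6 + Re ?e" by (simp add: algebra_simps)
  have n: "norm (1 - \<i>) \<le> 2" by (rule order_trans[OF norm_triangle_ineq4]) simp
  have "norm ?e \<le> 2 * norm p * (1 / 1000)"
    unfolding norm_minus_cancel norm_mult using lcs''_near[OF assms(1)] n by (intro mult_mono) auto
  then have "\<bar>Re ?e\<bar> \<le> 2 * norm p * (1 / 1000)" using abs_Re_le_cmod order_trans by blast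
  moreover have "norm p \<le> Re p + Im p" using cmod_le[of p] assms by simp
  moreover have "x / 7 \<le> s / 6 + e" if "\<bar>e\<bar> \<le> 2 * x * (1 / 1000)" "x \<le> s" "0 \<le> x" for x s e :: real
    using that unfolding abs_le_iff by simp
  ultimately show ?thesis unfolding eq using norm_ge_zero by blast
qed

text \<open>The derivative vanishes at \<open>0\<close>, so the expansion argument is run on the
  part of the quadrant with \<open>Re z + Im z >= m\<close>, which is convex, contains both points
  and keeps a positive distance from \<open>0\<close>.\<close>

lemma h_saddle_inj_quadrant:
  assumes "norm p < rad" "0 \<le> Re p" "0 \<le> Im p" "norm q < rad" "0 \<le> Re q" "0 \<le> Im q" "h_saddle p = h_saddle q" "p \<noteq> 0" "q \<noteq> 0"
  shows "p = q"
proof (rule ccontr)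
  assume "p \<noteq> q"
  define m where "m = min (Re p + Im p) (Re q + Im q)"
  define S where "S = {z. 0 \<le> Re z} \<inter> {z. 0 \<le> Im z} \<inter> ball 0 rad \<inter> {z. m \<le> inner (Complex 1 1) z}"
  have mp: "0 < m" using assms by (auto simp: m_def complex_eq_iff)
  have cv: "convex S" unfolding S_def
    using convex_halfspace_Re_ge[of 0] convex_halfspace_Im_ge[of 0] convex_halfspace_ge[of m "Complex 1 1"]
    by (intro convex_Int convex_ball) auto
  have pS: "p \<in> S" "q \<in> S" using assms by (auto simp: S_def m_def inner_complex_def)
  have "m / 14 * norm (p - q) \<le> norm (1 - \<i>) * norm (- h_saddle p - - h_saddle q)"
  proof (rule expanding_if_Re_deriv_ge[OF cv pS, where f' = "\<lambda>p. - (p * lcs'' p)"])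
    fix x assume x: "x \<in> S"
    then show "((\<lambda>p. - h_saddle p) has_field_derivative - (x * lcs'' x)) (at x)"
      by (intro DERIV_minus h_saddle_deriv) (auto simp: S_def)
    have "m \<le> Re x + Im x" using x by (auto simp: S_def inner_complex_def)
    also have "\<dots> \<le> 2 * norm x" using complex_Re_le_cmod[of x] abs_Im_le_cmod[of x] by linarith
    finally show "m / 14 \<le> Re ((1 - \<i>) * (- (x * lcs'' x)))"
      using Re_h_saddle_deriv_ge[of x] x by (auto simp: S_def)
  qed
  then have "m / 14 * norm (p - q) \<le> 0" using assms(7) by simp
  then show False using mp \<open>p \<noteq> q\<close> by (simp add: mult_le_0_iff)
qed

text \<open>What the counting argument uses about \<open>u\<close> and the critical curve, expressed
  through the local inverse \<open>pinv\<close> of \<open>beta_of\<close>: the zero set of the real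
  part of the saddle value, and that \<open>R0\<close> is continuous, increasing and close to the
  diagonal. The fractions of \<open>rad1\<close> are margins.\<close>

locale critical_arc =
  fixes \<delta> :: real and pinv :: "complex \<Rightarrow> complex" and R0 :: "real \<Rightarrow> real"
  assumes \<delta>: "0 < \<delta>" "\<delta> \<le> rad1 / 100"
    and pinv: "\<And>\<beta>. norm (\<beta> - 1) < \<delta> \<Longrightarrow> norm (pinv \<beta>) < rad1 / 10" "\<And>\<beta>. norm (\<beta> - 1) < \<delta> \<Longrightarrow> beta_of (pinv \<beta>) = \<beta>"
    and pinv_cont: "continuous_on (ball 1 \<delta>) pinv"
    and crit: "\<And>\<beta>. norm (\<beta> - 1) < \<delta> \<Longrightarrow> \<beta> \<noteq> 1 \<Longrightarrow> Re (h_saddle (pinv \<beta>)) = 0 \<longleftrightarrow> \<bar>Im \<beta>\<bar> = \<bar>R0 (Re \<beta> - 1)\<bar>"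
    and R0_cont: "continuous_on {0..\<delta>} R0"
    and R0_near: "\<And>\<epsilon>. 0 \<le> \<epsilon> \<Longrightarrow> \<epsilon> \<le> \<delta> \<Longrightarrow> \<bar>R0 \<epsilon> - \<epsilon>\<bar> \<le> \<epsilon> / 100"
    and R0_mono: "\<And>x y. 0 \<le> x \<Longrightarrow> x < y \<Longrightarrow> y \<le> \<delta> \<Longrightarrow> R0 x < R0 y"

text \<open>\<open>csqrt (pinv \<beta>)\<close> solves the critical equation within the disc of
  \<open>saddle_points\<close>, hence it is \<open>u \<beta>\<close> up to sign, and
  \<open>h\<close> depends only on the square. \<open>R0\<close> increases near \<open>0\<close>
  because the quadratic bound forces its derivative at \<open>0\<close> to be \<open>1\<close> and
  the derivative is continuous.\<close>

lemma critical_arc_exists: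
  fixes c0 c :: real and u :: "complex \<Rightarrow> complex" and R0 :: "real \<Rightarrow> real"
  assumes c0: "0 < c0" and u: "saddle_points c0 u"
    and c: "0 < c" and cc: "critical_curve u c R0"
  shows "\<exists>\<delta> pinv. critical_arc \<delta> pinv R0 \<and> \<delta> \<le> c \<and> (\<forall>\<beta>. norm (\<beta> - 1) < \<delta> \<longrightarrow> h \<beta> (u \<beta>) = h_saddle (pinv \<beta>))"
proof -
  let ?B = "ball (0::complex) (rad1 / 10)"
  have B: "?B \<subseteq> ball 0 rad" using rad1 by auto
  have injB: "inj_on beta_of ?B" using beta_of_inj B by (rule inj_on_subset)
  have "open (beta_of ` ?B)"
    using holomorphic_on_subset[OF beta_of_holomorphic B] injB by (intro open_mapping_thm3) auto
  moreover have "1 \<in> beta_of ` ?B" using rad1 by (intro image_eqI[of _ _ 0]) auto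
  ultimately obtain \<delta>1 where \<delta>1: "\<delta>1 > 0" "ball 1 \<delta>1 \<subseteq> beta_of ` ?B" by (meson openE)
  define pinv where "pinv = the_inv_into ?B beta_of"
  have pinv: "norm (pinv \<beta>) < rad1 / 10" "norm (pinv \<beta>) < rad" "beta_of (pinv \<beta>) = \<beta>" if "norm (\<beta> - 1) < \<delta>1" for \<beta>
  proof -
    have b: "\<beta> \<in> beta_of ` ?B" using that \<delta>1(2) by (auto simp: dist_norm norm_minus_commute)
    show "beta_of (pinv \<beta>) = \<beta>" unfolding pinv_def by (rule f_the_inv_into_f[OF injB b])
    show "norm (pinv \<beta>) < rad1 / 10" using the_inv_into_into[OF injB b order_refl] by (simp add: pinv_def)
    then show "norm (pinv \<beta>) < rad" using rad1 by linarith
  qed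
  have pcont: "continuous_on (ball 1 \<delta>1) pinv"
  proof -
    have lc: "lcs' (pinv \<beta>) = 1 / (2 * \<beta>)" if "norm (\<beta> - 1) < \<delta>1" for \<beta>
    proof -
      have "1 / \<beta> = 2 * lcs' (pinv \<beta>)" using inverse_beta_of[OF pinv(2)[OF that]] pinv(3)[OF that] by simp
      moreover have "1 / (2 * \<beta>) = 1 / \<beta> / 2" by simp
      ultimately show ?thesis by simp
    qed
    have nz: "\<beta> \<noteq> 0" if "norm (\<beta> - 1) < \<delta>1" for \<beta> :: complex
      using beta_of_nz[OF pinv(2)[OF that]] pinv(3)[OF that] by simp
    have "continuous (at x within ball 1 \<delta>1) pinv" if x: "x \<in> ball 1 \<delta>1" for x
      unfolding continuous_within
    proof (rule Lim_transform_eventually[OF _ always_eventually])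
      have "((\<lambda>\<beta>. pinv \<beta> - pinv x) \<longlongrightarrow> 0) (at x within ball 1 \<delta>1)"
      proof (rule Lim_null_comparison)
        show "\<forall>\<^sub>F \<beta> in at x within ball 1 \<delta>1. norm (pinv \<beta> - pinv x) \<le> 7 * norm (1 / (2 * \<beta>) - 1 / (2 * x))"
          unfolding eventually_at_filter using x lcs'_expanding[OF pinv(2) pinv(2)] lc
          by (intro always_eventually) (auto simp: dist_norm norm_minus_commute)
        have "((\<lambda>\<beta>. 7 * norm (1 / (2 * \<beta>) - 1 / (2 * x))) \<longlongrightarrow> 7 * norm (1 / (2 * x) - 1 / (2 * x))) (at x within ball 1 \<delta>1)"
          using nz[of x] x by (intro tendsto_intros) (auto simp: dist_norm norm_minus_commute)
        then show "((\<lambda>\<beta>. 7 * norm (1 / (2 * \<beta>) - 1 / (2 * x))) \<longlongrightarrow> 0) (at x within ball 1 \<delta>1)" by simp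
      qed
      from tendsto_add[OF this tendsto_const[of "pinv x"]]
      show "((\<lambda>\<beta>. pinv \<beta> - pinv x + pinv x) \<longlongrightarrow> pinv x) (at x within ball 1 \<delta>1)" by simp
    qed simp
    then show ?thesis by (simp add: continuous_on_eq_continuous_within)
  qed
  obtain \<delta>2 where \<delta>2: "\<delta>2 > 0" "\<And>\<beta>. \<beta> \<noteq> 1 \<Longrightarrow> norm (\<beta> - 1) < \<delta>2 \<Longrightarrow> \<bar>Re \<beta> - 1\<bar> \<le> c \<Longrightarrow>
        (\<bar>Im \<beta>\<bar> < \<bar>R0 (Re \<beta> - 1)\<bar> \<longrightarrow> Re (h \<beta> (u \<beta>)) < 0) \<and>
        (\<bar>Im \<beta>\<bar> = \<bar>R0 (Re \<beta> - 1)\<bar> \<longrightarrow> Re (h \<beta> (u \<beta>)) = 0) \<and>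
        (\<bar>Im \<beta>\<bar> > \<bar>R0 (Re \<beta> - 1)\<bar> \<longrightarrow> Re (h \<beta> (u \<beta>)) > 0)"
    using cc unfolding critical_curve_def eventually_at dist_norm by (metis UNIV_I insertI1)
  obtain C where C: "C > 0" "\<And>\<epsilon>. -c \<le> \<epsilon> \<Longrightarrow> \<epsilon> \<le> c \<Longrightarrow> \<bar>R0 \<epsilon> - \<epsilon>\<bar> \<le> C * \<epsilon>\<^sup>2"
    using cc unfolding critical_curve_def by (metis atLeastAtMost_iff)
  obtain D where D: "\<And>x. -c \<le> x \<Longrightarrow> x \<le> c \<Longrightarrow> D 0 x = R0 x"
    "\<And>n x. -c \<le> x \<Longrightarrow> x \<le> c \<Longrightarrow> (D n has_real_derivative D (Suc n) x) (at x within {-c..c})"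
    using cc unfolding critical_curve_def smooth_on_interval_def by (metis atLeastAtMost_iff)
  have int: "at x within {-c..c} = at x" if "-c < x" "x < c" for x
    using that by (intro at_within_interior) (simp add: interior_atLeastAtMost_real)
  have R0d: "(R0 has_real_derivative D 1 x) (at x)" if "-c < x" "x < c" for x
  proof (rule has_field_derivative_transform_within_open)
    show "(D 0 has_real_derivative D 1 x) (at x)" using D(2)[of x 0] that int[OF that] by simp
    show "x \<in> {-c<..<c}" "open {-c<..<c}" using that by auto
  qed (use D(1) in auto)
  have R00: "R0 0 = 0" using C(2)[of 0] c by simp
  have "(R0 has_real_derivative 1) (at 0)"
    unfolding has_field_derivative_iff
  proof (rule Lim_transform_eventually[OF _ always_eventually])
    have "((\<lambda>y. (R0 y - R0 0) / (y - 0) - 1) \<longlongrightarrow> 0) (at 0)"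
    proof (rule Lim_null_comparison)
      have "\<forall>\<^sub>F y in at 0. \<bar>y\<bar> < c \<and> y \<noteq> (0::real)"
        unfolding eventually_at using c by (intro exI[of _ c]) auto
      then show "\<forall>\<^sub>F y in at 0. norm ((R0 y - R0 0) / (y - 0) - 1) \<le> C * \<bar>y\<bar>"
      proof eventually_elim
        case (elim y)
        have "norm ((R0 y - R0 0) / (y - 0) - 1) = \<bar>R0 y - y\<bar> / \<bar>y\<bar>"
          using elim R00 by (simp add: abs_divide[symmetric] diff_divide_distrib)
        also have "\<dots> \<le> C * y\<^sup>2 / \<bar>y\<bar>" using C(2)[of y] elim by (intro divide_right_mono) auto
        also have "\<dots> = C * \<bar>y\<bar>" using elim by (simp add: power2_eq_square abs_if)
        finally show ?case .
      qed
      show "((\<lambda>y. C * \<bar>y\<bar>) \<longlongrightarrow> 0) (at 0)" by (rule tendsto_eq_intros refl | simp)+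
    qed
    from tendsto_add[OF this tendsto_const[of 1]]
    show "((\<lambda>y. (R0 y - R0 0) / (y - 0) - 1 + 1) \<longlongrightarrow> 1) (at 0)" by simp
  qed simp
  then have D10: "D 1 0 = 1" using R0d[of 0] c DERIV_unique by force
  have "isCont (D 1) 0" using D(2)[of 0 1] int[of 0] c by (auto intro: DERIV_isCont)
  then obtain \<delta>3 where \<delta>3: "\<delta>3 > 0" "\<And>x. \<bar>x\<bar> < \<delta>3 \<Longrightarrow> \<bar>D 1 x - 1\<bar> < 1"
    unfolding continuous_at_eps_delta dist_real_def D10 by (metis diff_zero zero_less_one)
  \<comment> \<open>\<open>\<delta>3\<close> keeps the derivative of \<open>R0\<close> positive,
    \<open>1 / (100 * C)\<close> turns the quadratic error into \<open>\<epsilon> / 100\<close>, and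
    \<open>c0 / 2\<close> makes \<open>saddle_points\<close> applicable; the other entries are
    domains and margins.\<close>
  define \<delta> where "\<delta> = Min {rad1 / 100, \<delta>1, \<delta>2, \<delta>3 / 2, c / 2, 1 / (100 * C), c0 / 2, rad1}"
  have \<delta>: "0 < \<delta>" "\<delta> \<le> rad1 / 100" "\<delta> \<le> \<delta>1" "\<delta> \<le> \<delta>2" "\<delta> < \<delta>3" "\<delta> < c" "\<delta> \<le> 1 / (100 * C)" "\<delta> \<le> c0" "\<delta> \<le> 2 * c0"
    using rad1 \<delta>1 \<delta>2(1) \<delta>3(1) c C(1) c0 by (auto simp: \<delta>_def min_def)
  have hu: "h \<beta> (u \<beta>) = h_saddle (pinv \<beta>)" if b: "norm (\<beta> - 1) < \<delta>" for \<beta>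
  proof (cases "\<beta> = 1")
    case True
    have "pinv 1 = pinv (beta_of 0)" by simp
    also have "\<dots> = 0" unfolding pinv_def using rad1 by (intro the_inv_into_f_f[OF injB]) auto
    finally show ?thesis using u True by (simp add: saddle_points_def h_def log_cosh_spec(2) h_saddle_def)
  next
    case False
    define p where "p = pinv \<beta>"
    have p: "norm p < rad" "beta_of p = \<beta>" using pinv(2,3)[of \<beta>] b \<delta> by (auto simp: p_def)
    have pnz: "p \<noteq> 0" using p False by auto
    have b0: "0 < norm (\<beta> - 1)" "norm (\<beta> - 1) \<le> c0" using False b \<delta> by auto
    have pz: "csqrt p \<in> {z. cmod z \<le> 10 * sqrt c0 \<and> z / \<beta> - tanh z = 0}"
    proof -
      have "norm p \<le> 31 / 10 * c0" using norm_beta_of_bounds(2)[OF p(1)] b0 p(2) by simp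
      then have "norm p \<le> 100 * c0" using c0 by linarith
      then have "sqrt (norm p) \<le> sqrt (10\<^sup>2 * c0)" by simp
      then have "norm (csqrt p) \<le> 10 * sqrt c0" by (simp add: norm_csqrt real_sqrt_mult)
      then show ?thesis using h_at_saddle(2)[of "csqrt p"] p by simp
    qed
    have S: "{z. cmod z \<le> 10 * sqrt c0 \<and> z / \<beta> - tanh z = 0} = {0, u \<beta>, - u \<beta>}"
      using u b0 unfolding saddle_points_def by blast
    have "csqrt p \<in> {0, u \<beta>, - u \<beta>}" using pz unfolding S .
    then have "csqrt p = u \<beta> \<or> csqrt p = - u \<beta>" using pnz by auto
    then have "(csqrt p)\<^sup>2 = (u \<beta>)\<^sup>2" by (metis power2_minus)
    then have "(u \<beta>)\<^sup>2 = p" by simp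
    then show ?thesis using h_at_saddle(1)[of "u \<beta>"] p by (simp add: p_def)
  qed
  have "critical_arc \<delta> pinv R0"
  proof
    show "0 < \<delta>" "\<delta> \<le> rad1 / 100" using \<delta> by auto
    show "norm (pinv \<beta>) < rad1 / 10" "beta_of (pinv \<beta>) = \<beta>" if "norm (\<beta> - 1) < \<delta>" for \<beta>
      using pinv that \<delta> by auto
    show "continuous_on (ball 1 \<delta>) pinv" by (rule continuous_on_subset[OF pcont]) (use \<delta> in auto)
    show "Re (h_saddle (pinv \<beta>)) = 0 \<longleftrightarrow> \<bar>Im \<beta>\<bar> = \<bar>R0 (Re \<beta> - 1)\<bar>" if b: "norm (\<beta> - 1) < \<delta>" "\<beta> \<noteq> 1" for \<beta>
    proof -
      have "\<bar>Re \<beta> - 1\<bar> \<le> c" using abs_Re_le_cmod[of "\<beta> - 1"] b \<delta> by simp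
      then show ?thesis using \<delta>2(2)[of \<beta>] b \<delta> hu[OF b(1)] by (smt (verit))
    qed
    show "continuous_on {0..\<delta>} R0"
      using \<delta> by (intro continuous_at_imp_continuous_on ballI DERIV_isCont[OF R0d]) auto
    show "\<bar>R0 \<epsilon> - \<epsilon>\<bar> \<le> \<epsilon> / 100" if e: "0 \<le> \<epsilon>" "\<epsilon> \<le> \<delta>" for \<epsilon>
    proof -
      have "\<bar>R0 \<epsilon> - \<epsilon>\<bar> \<le> C * \<epsilon>\<^sup>2" using e \<delta> by (intro C) auto
      also have "\<dots> = \<epsilon> * (C * \<epsilon>)" by (simp add: power2_eq_square)
      also have "\<dots> \<le> \<epsilon> * (1 / 100)"
      proof (intro mult_left_mono)
        have "C * \<epsilon> \<le> C * (1 / (100 * C))" using e \<delta> C(1) by (intro mult_left_mono) auto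
        then show "C * \<epsilon> \<le> 1 / 100" using C(1) by simp
      qed (rule e)
      finally show ?thesis by simp
    qed
    show "R0 x < R0 y" if "0 \<le> x" "x < y" "y \<le> \<delta>" for x y
    proof (rule DERIV_pos_imp_increasing[OF \<open>x < y\<close>])
      fix z assume z: "x \<le> z" "z \<le> y"
      have "\<bar>D 1 z - 1\<bar> < 1" using z that \<delta> by (intro \<delta>3) auto
      then show "\<exists>D. (R0 has_real_derivative D) (at z) \<and> 0 < D"
        using z that \<delta> by (intro exI[of _ "D 1 z"] conjI R0d) auto
    qed
  qed
  then show ?thesis using hu \<delta> by (intro exI[of _ \<delta>] exI[of _ pinv]) auto
qed

section \<open>The upper arc parametrised by its saddle value\<close>

context critical_arc
begin

definition arc :: "real \<Rightarrow> complex" where "arc \<epsilon> = upper_arc R0 \<epsilon>"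
text \<open>Along the arc the saddle value is purely imaginary; with
  \<open>p = pinv (arc \<epsilon>)\<close> minus its imaginary part is about
  \<open>Re p * Im p / 6\<close>, which explains the sign. In this parameter the zeros are
  asymptotically equidistributed.\<close>

definition action :: "real \<Rightarrow> real" where "action \<epsilon> = - Im (h_saddle (pinv (arc \<epsilon>)))"
definition modulus :: "real \<Rightarrow> real" where "modulus \<epsilon> = norm (arc \<epsilon> - 1)"

lemma arc_sel [simp]: "Re (arc \<epsilon>) = 1 + \<epsilon>" "Im (arc \<epsilon>) = R0 \<epsilon>"
  by (simp_all add: arc_def upper_arc_def)

lemma R0_0 [simp]: "R0 0 = 0" using R0_near[of 0] \<delta> by simp

lemma arc_0 [simp]: "arc 0 = 1" by (simp add: complex_eq_iff)

lemma R0_bounds: "0 \<le> \<epsilon> \<Longrightarrow> \<epsilon> \<le> \<delta> \<Longrightarrow> 99 / 100 * \<epsilon> \<le> R0 \<epsilon> \<and> R0 \<epsilon> \<le> 101 / 100 * \<epsilon>"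
  using R0_near[of \<epsilon>] unfolding abs_le_iff by linarith

lemma pinv_unique: "norm p < rad1 / 10 \<Longrightarrow> norm (beta_of p - 1) < \<delta> \<Longrightarrow> pinv (beta_of p) = p"
  using inj_onD[OF beta_of_inj, of "pinv (beta_of p)" p] pinv[of "beta_of p"] rad1 by auto

lemma pinv_1 [simp]: "pinv 1 = 0"
  using pinv_unique[of 0] rad1 \<delta> by simp

lemma pinv_rad: "norm (\<beta> - 1) < \<delta> \<Longrightarrow> norm (pinv \<beta>) < rad"
  using pinv(1)[of \<beta>] rad1 by linarith

lemma modulus_bounds:
  assumes "0 \<le> \<epsilon>" "\<epsilon> \<le> \<delta>"
  shows "\<epsilon> \<le> modulus \<epsilon>" "modulus \<epsilon> \<le> 201 / 100 * \<epsilon>"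
proof -
  show "\<epsilon> \<le> modulus \<epsilon>"
    using complex_Re_le_cmod[of "arc \<epsilon> - 1"] by (simp add: modulus_def)
  have "modulus \<epsilon> \<le> \<bar>Re (arc \<epsilon> - 1)\<bar> + \<bar>Im (arc \<epsilon> - 1)\<bar>" unfolding modulus_def by (rule cmod_le)
  also have "\<dots> = \<bar>\<epsilon>\<bar> + \<bar>R0 \<epsilon>\<bar>" by simp
  also have "\<dots> \<le> 201 / 100 * \<epsilon>" using R0_bounds[OF assms] assms by simp
  finally show "modulus \<epsilon> \<le> 201 / 100 * \<epsilon>" .
qed

lemma arc_in: "0 \<le> \<epsilon> \<Longrightarrow> \<epsilon> \<le> \<delta> / 4 \<Longrightarrow> norm (arc \<epsilon> - 1) < \<delta>"
  using modulus_bounds[of \<epsilon>] \<delta> unfolding modulus_def by linarith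

lemma modulus_mono: "0 \<le> x \<Longrightarrow> x < y \<Longrightarrow> y \<le> \<delta> \<Longrightarrow> modulus x < modulus y"
proof -
  assume xy: "0 \<le> x" "x < y" "y \<le> \<delta>"
  have "x\<^sup>2 < y\<^sup>2" using xy by (intro power_strict_mono) auto
  moreover have "(R0 x)\<^sup>2 \<le> (R0 y)\<^sup>2" using R0_mono[OF xy] R0_bounds[of x] xy by (intro power_mono) auto
  ultimately show ?thesis by (simp add: modulus_def cmod_def)
qed

lemma arc_cont: "continuous_on {0..\<delta>} arc"
proof -
  have "arc = (\<lambda>\<epsilon>. of_real (1 + \<epsilon>) + \<i> * of_real (R0 \<epsilon>))" by (auto simp: complex_eq_iff)
  then show ?thesis by (simp only:) (intro continuous_intros R0_cont)
qed

lemma modulus_cont: "continuous_on {0..\<delta>} modulus"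
  unfolding modulus_def by (intro continuous_intros arc_cont)

lemma modulus_0 [simp]: "modulus 0 = 0" by (simp add: modulus_def)

lemma modulus_le_iff: "0 \<le> x \<Longrightarrow> x \<le> \<delta> \<Longrightarrow> 0 \<le> y \<Longrightarrow> y \<le> \<delta> \<Longrightarrow> modulus x \<le> modulus y \<longleftrightarrow> x \<le> y"
  using modulus_mono[of x y] modulus_mono[of y x] by (cases x y rule: linorder_cases) auto

definition core_cone :: "complex \<Rightarrow> bool" where
  "core_cone p \<longleftrightarrow> 0 < Re p \<and> Re p \<le> 2 * Im p \<and> 2 * Im p \<le> 5 * Re p"

lemma pinv_approx:
  assumes "norm (\<beta> - 1) < \<delta>"
  shows "norm (pinv \<beta> - 3 * (\<beta> - 1)) \<le> 93 / 1000 * norm (\<beta> - 1)"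
    "norm (\<beta> - 1 - pinv \<beta> / 3) \<le> norm (pinv \<beta>) / 100" "norm (pinv \<beta>) \<le> 31 / 10 * norm (\<beta> - 1)"
    "norm (\<beta> - 1) \<le> 35 / 100 * norm (pinv \<beta>)"
proof -
  note r = pinv_rad[OF assms]
  show a: "norm (\<beta> - 1 - pinv \<beta> / 3) \<le> norm (pinv \<beta>) / 100" using beta_of_approx[OF r] pinv(2)[OF assms] by simp
  show b: "norm (pinv \<beta>) \<le> 31 / 10 * norm (\<beta> - 1)" "norm (\<beta> - 1) \<le> 35 / 100 * norm (pinv \<beta>)"
    using norm_beta_of_bounds[OF r] pinv(2)[OF assms] by simp_all
  have "pinv \<beta> - 3 * (\<beta> - 1) = - 3 * (\<beta> - 1 - pinv \<beta> / 3)" by (simp add: algebra_simps)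
  then have "norm (pinv \<beta> - 3 * (\<beta> - 1)) = 3 * norm (\<beta> - 1 - pinv \<beta> / 3)" by (simp only: norm_mult) simp
  then show "norm (pinv \<beta> - 3 * (\<beta> - 1)) \<le> 93 / 1000 * norm (\<beta> - 1)" using a b by linarith
qed

text \<open>\<open>R0 \<epsilon>\<close> is within one percent of \<open>\<epsilon>\<close>, so
  \<open>arc \<epsilon> - 1\<close> is nearly diagonal, and \<open>pinv\<close> nearly multiplies it
  by \<open>3\<close>; the slope of the image is close to \<open>1\<close>, well between
  \<open>1 / 2\<close> and \<open>5 / 2\<close>.\<close>

lemma arc_core:
  assumes "0 < \<epsilon>" "\<epsilon> \<le> \<delta> / 4"
  shows "core_cone (pinv (arc \<epsilon>))" "Re (pinv (arc \<epsilon>)) < 2 * Im (pinv (arc \<epsilon>))" "2 * Im (pinv (arc \<epsilon>)) < 5 * Re (pinv (arc \<epsilon>))"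
proof -
  define p where "p = pinv (arc \<epsilon>)"
  have e: "0 \<le> \<epsilon>" "\<epsilon> \<le> \<delta>" using assms \<delta> by auto
  have "norm (p - 3 * (arc \<epsilon> - 1)) \<le> 93 / 1000 * norm (arc \<epsilon> - 1)"
    using pinv_approx(1)[OF arc_in] assms by (simp add: p_def)
  also have "\<dots> \<le> 2 / 10 * \<epsilon>" using modulus_bounds(2)[OF e] e unfolding modulus_def by simp
  finally have n: "norm (p - 3 * (arc \<epsilon> - 1)) \<le> 2 / 10 * \<epsilon>" .
  have "\<bar>Re p - 3 * \<epsilon>\<bar> \<le> 2 / 10 * \<epsilon>" using abs_Re_le_cmod[of "p - 3 * (arc \<epsilon> - 1)"] n by simp
  moreover have "\<bar>Im p - 3 * R0 \<epsilon>\<bar> \<le> 2 / 10 * \<epsilon>" using abs_Im_le_cmod[of "p - 3 * (arc \<epsilon> - 1)"] n by simp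
  ultimately have "Re p < 2 * Im p" "2 * Im p < 5 * Re p" "0 < Re p"
    using R0_bounds[OF e] assms unfolding abs_le_iff by linarith+
  then show "core_cone (pinv (arc \<epsilon>))" "Re (pinv (arc \<epsilon>)) < 2 * Im (pinv (arc \<epsilon>))" "2 * Im (pinv (arc \<epsilon>)) < 5 * Re (pinv (arc \<epsilon>))"
    by (auto simp: core_cone_def p_def)
qed

text \<open>The leading term \<open>- Re p * Im p / 6\<close> beats the error because
  \<open>norm p ^ 2 <= 5 * Re p * Im p\<close> in the cone.\<close>

lemma core_Im_h_saddle_neg:
  assumes "core_cone p" "norm p < rad"
  shows "Im (h_saddle p) < 0"
proof -
  have ab: "0 < Re p" "0 < Im p" "Re p \<le> 2 * Im p" "2 * Im p \<le> 5 * Re p" using assms by (auto simp: core_cone_def)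
  have "Re p * Re p \<le> Re p * (2 * Im p)" "Im p * (2 * Im p) \<le> Im p * (5 * Re p)" using ab by (intro mult_left_mono; simp)+
  then have "Re p ^ 2 \<le> 2 * (Re p * Im p)" "2 * Im p ^ 2 \<le> 5 * (Re p * Im p)"
    by (simp_all add: power2_eq_square algebra_simps)
  moreover have "A + B \<le> 5 * c" if "A \<le> 2 * c" "2 * B \<le> 5 * c" "0 < c" for A B c :: real using that by simp
  ultimately have n: "norm p ^ 2 \<le> 5 * (Re p * Im p)"
    unfolding cmod_power2 using mult_pos_pos[OF ab(1,2)] by blast
  have "\<bar>Im (h_saddle p + p\<^sup>2 / 12)\<bar> \<le> norm p ^ 2 / 1000"
    using h_saddle_approx[OF assms(2)] abs_Im_le_cmod order_trans by blast
  moreover have "Im (h_saddle p + p\<^sup>2 / 12) = Im (h_saddle p) + Re p * Im p / 6" by (simp add: power2_eq_square)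
  moreover have "h < 0" if "\<bar>h + c / 6\<bar> \<le> n / 1000" "n \<le> 5 * c" "0 < c" for h c n :: real
    using that unfolding abs_le_iff by simp
  ultimately show ?thesis using n mult_pos_pos[OF ab(1,2)] by metis
qed

lemma h_saddle_arc:
  assumes "0 \<le> \<epsilon>" "\<epsilon> \<le> \<delta> / 4"
  shows "h_saddle (pinv (arc \<epsilon>)) = - \<i> * of_real (action \<epsilon>)"
proof (cases "\<epsilon> = 0")
  case True
  then show ?thesis by (simp add: action_def h_saddle_def)
next
  case False
  have "arc \<epsilon> \<noteq> 1" using False by (simp add: complex_eq_iff)
  then have "Re (h_saddle (pinv (arc \<epsilon>))) = 0" using crit[OF arc_in[OF assms]] by simp
  then show ?thesis by (simp add: complex_eq_iff action_def)
qed

lemma action_0 [simp]: "action 0 = 0" by (simp add: action_def h_saddle_def)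

lemma action_pos: "0 < \<epsilon> \<Longrightarrow> \<epsilon> \<le> \<delta> / 4 \<Longrightarrow> 0 < action \<epsilon>"
  using core_Im_h_saddle_neg[OF arc_core(1) pinv_rad[OF arc_in]] by (simp add: action_def)

lemma action_cont: "continuous_on {0..\<delta> / 4} action"
proof -
  have "continuous_on {0..\<delta> / 4} (\<lambda>\<epsilon>. pinv (arc \<epsilon>))"
    using arc_in \<delta> by (intro continuous_on_compose2[OF pinv_cont] continuous_on_subset[OF arc_cont])
      (auto simp: dist_norm norm_minus_commute)
  then have "continuous_on {0..\<delta> / 4} (\<lambda>\<epsilon>. h_saddle (pinv (arc \<epsilon>)))"
    using arc_in pinv_rad by (intro continuous_on_compose2[OF holomorphic_on_imp_continuous_on[OF h_saddle_holomorphic]]) auto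
  then show ?thesis unfolding action_def by (intro continuous_intros)
qed

text \<open>The saddle value is purely imaginary on the arc, so equal actions mean equal saddle
  values, and \<open>h_saddle\<close> is injective in the first quadrant.\<close>

lemma action_inj: "inj_on action {0..\<delta> / 4}"
proof (rule inj_onI)
  fix x y assume x: "x \<in> {0..\<delta> / 4}" and y: "y \<in> {0..\<delta> / 4}" and eq: "action x = action y"
  show "x = y"
  proof (cases "x = 0 \<or> y = 0")
    case True
    then show ?thesis using action_pos[of x] action_pos[of y] x y eq by (cases "x = 0"; cases "y = 0") auto
  next
    case False
    then have xy: "0 < x" "x \<le> \<delta> / 4" "0 < y" "y \<le> \<delta> / 4" using x y by auto
    have "pinv (arc x) = pinv (arc y)"
    proof (rule h_saddle_inj_quadrant)
      show "norm (pinv (arc x)) < rad" "norm (pinv (arc y)) < rad"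
        using pinv_rad[OF arc_in[OF less_imp_le[OF xy(1)] xy(2)]] pinv_rad[OF arc_in[OF less_imp_le[OF xy(3)] xy(4)]] by blast+
      show "h_saddle (pinv (arc x)) = h_saddle (pinv (arc y))"
        unfolding h_saddle_arc[OF less_imp_le[OF xy(1)] xy(2)] h_saddle_arc[OF less_imp_le[OF xy(3)] xy(4)] eq by (rule refl)
      have "0 < Re (pinv (arc x))" "0 < Im (pinv (arc x))" "0 < Re (pinv (arc y))" "0 < Im (pinv (arc y))"
        using arc_core(1)[OF xy(1,2)] arc_core(1)[OF xy(3,4)] unfolding core_cone_def by linarith+
      then show "0 \<le> Re (pinv (arc x))" "0 \<le> Im (pinv (arc x))" "0 \<le> Re (pinv (arc y))" "0 \<le> Im (pinv (arc y))"
        "pinv (arc x) \<noteq> 0" "pinv (arc y) \<noteq> 0" by auto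
    qed
    then have "beta_of (pinv (arc x)) = beta_of (pinv (arc y))" by (rule arg_cong)
    then have "arc x = arc y"
      unfolding pinv(2)[OF arc_in[OF less_imp_le[OF xy(1)] xy(2)]] pinv(2)[OF arc_in[OF less_imp_le[OF xy(3)] xy(4)]] .
    then show ?thesis using arc_sel(1) by (metis add_left_cancel)
  qed
qed

text \<open>A continuous injective function on an interval is monotone, and positivity beyond
  \<open>0\<close> fixes the direction.\<close>

lemma action_mono: "0 \<le> x \<Longrightarrow> x < y \<Longrightarrow> y \<le> \<delta> / 4 \<Longrightarrow> action x < action y"
proof -
  assume xy: "0 \<le> x" "x < y" "y \<le> \<delta> / 4"
  show ?thesis
  proof (cases "x = 0")
    case True then show ?thesis using action_pos[of y] xy by simp
  next
    case False
    have "continuous_on {0..y} action" "inj_on action {0..y}"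
      using xy by (auto intro: continuous_on_subset[OF action_cont] inj_on_subset[OF action_inj])
    then have "action 0 < action x \<and> action x < action y \<or> action y < action x \<and> action x < action 0"
      using False xy by (intro continuous_inj_imp_mono) auto
    then show ?thesis using action_pos[of x] False xy by auto
  qed
qed

lemma action_le_iff: "0 \<le> x \<Longrightarrow> x \<le> \<delta> / 4 \<Longrightarrow> 0 \<le> y \<Longrightarrow> y \<le> \<delta> / 4 \<Longrightarrow> action x \<le> action y \<longleftrightarrow> x \<le> y"
  using action_mono[of x y] action_mono[of y x] by (cases x y rule: linorder_cases) auto

definition action_inv :: "real \<Rightarrow> real" where "action_inv = the_inv_into {0..\<delta> / 4} action"

lemma action_inv_action: "0 \<le> \<epsilon> \<Longrightarrow> \<epsilon> \<le> \<delta> / 4 \<Longrightarrow> action_inv (action \<epsilon>) = \<epsilon>"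
  unfolding action_inv_def by (intro the_inv_into_f_f[OF action_inj]) auto

lemma action_surj:
  assumes "0 \<le> a" "a \<le> b" "b \<le> \<delta> / 4" "action a \<le> y" "y \<le> action b"
  obtains \<epsilon> where "a \<le> \<epsilon>" "\<epsilon> \<le> b" "action \<epsilon> = y"
  using IVT'[of action a y b] assms continuous_on_subset[OF action_cont, of "{a..b}"] by auto

lemma action_inv_cont: "continuous_on {0..action (\<delta> / 4)} action_inv"
proof -
  have "continuous_on (action ` {0..\<delta> / 4}) action_inv"
    by (rule continuous_on_inv[OF action_cont compact_Icc]) (simp add: action_inv_action)
  moreover have "{0..action (\<delta> / 4)} \<subseteq> action ` {0..\<delta> / 4}"
  proof
    fix y assume "y \<in> {0..action (\<delta> / 4)}"
    then obtain \<epsilon> where "0 \<le> \<epsilon>" "\<epsilon> \<le> \<delta> / 4" "action \<epsilon> = y"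
      using \<delta> action_surj[of 0 "\<delta> / 4" y] by (metis action_0 atLeastAtMost_iff divide_nonneg_pos less_imp_le order_refl zero_less_numeral)
    then show "y \<in> action ` {0..\<delta> / 4}" by (metis atLeastAtMost_iff imageI)
  qed
  ultimately show ?thesis by (rule continuous_on_subset)
qed

text \<open>The real part of the saddle value determines only \<open>|Im \<beta>|\<close>. In the
  core cone \<open>\<beta> - 1\<close> is close to \<open>p / 3\<close>, so
  \<open>Re \<beta> - 1\<close> and \<open>Im \<beta>\<close> are positive and only the upper arc
  remains.\<close>

lemma arc_char:
  assumes "norm (\<beta> - 1) < \<delta>" "core_cone (pinv \<beta>)" "Re (h_saddle (pinv \<beta>)) = 0"
  shows "0 < Re \<beta> - 1" "Re \<beta> - 1 < \<delta>" "\<beta> = arc (Re \<beta> - 1)"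
proof -
  define p where "p = pinv \<beta>"
  have ab: "0 < Re p" "Re p \<le> 2 * Im p" "2 * Im p \<le> 5 * Re p" using assms by (auto simp: core_cone_def p_def)
  have n: "norm p \<le> Re p + Im p" using cmod_le[of p] ab by simp
  have "norm (\<beta> - 1 - p / 3) \<le> norm p / 100" using pinv_approx(2)[OF assms(1)] by (simp add: p_def)
  then have "\<bar>Re (\<beta> - 1 - p / 3)\<bar> \<le> norm p / 100" "\<bar>Im (\<beta> - 1 - p / 3)\<bar> \<le> norm p / 100"
    using abs_Re_le_cmod abs_Im_le_cmod order_trans by blast+
  then have i: "\<bar>Re \<beta> - 1 - Re p / 3\<bar> \<le> norm p / 100" "\<bar>Im \<beta> - Im p / 3\<bar> \<le> norm p / 100" by simp_all
  have w: "0 < Re \<beta> - 1" "0 < Im \<beta>" using ab n i unfolding abs_le_iff by linarith+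
  show "0 < Re \<beta> - 1" by (rule w)
  show r: "Re \<beta> - 1 < \<delta>" using complex_Re_le_cmod[of "\<beta> - 1"] assms(1) by simp
  have "\<beta> \<noteq> 1" using w by auto
  then have "\<bar>Im \<beta>\<bar> = \<bar>R0 (Re \<beta> - 1)\<bar>" using crit[OF assms(1)] assms(3) by simp
  moreover have "0 \<le> R0 (Re \<beta> - 1)" using R0_bounds[of "Re \<beta> - 1"] w r by auto
  ultimately have "Im \<beta> = R0 (Re \<beta> - 1)" using w by linarith
  then show "\<beta> = arc (Re \<beta> - 1)"
    by (metis add.commute arc_sel complex_eqI diff_add_cancel)
qed

end

lemma finite_partition_zeros: "finite {\<beta>. norm (\<beta> - 1) \<le> r \<and> partition_function \<beta> N = 0}"
proof (cases "(\<lambda>\<beta>. partition_function \<beta> N) constant_on UNIV")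
  case True
  then have "partition_function \<beta> N \<noteq> 0" for \<beta>
    using partition_function_real_pos[of 0 N] unfolding constant_on_def by (metis UNIV_I zero_complex.sel(2))
  then show ?thesis by simp
next
  case False
  have "finite {z \<in> cball 1 r. partition_function z N = 0}"
    by (rule holomorphic_compact_finite_zeros[OF partition_function_holomorphic open_UNIV connected_UNIV compact_cball _ False]) auto
  moreover have "{z \<in> cball 1 r. partition_function z N = 0} = {\<beta>. norm (\<beta> - 1) \<le> r \<and> partition_function \<beta> N = 0}"
    by (auto simp: dist_norm norm_minus_commute)
  ultimately show ?thesis by simp
qed

lemma exp_eq_minus_1: "exp z = - 1 \<Longrightarrow> \<exists>k::int. - z = \<i> * of_real (pi * (2 * of_int k + 1))"
proof -
  assume "exp z = - 1"
  then have "exp z = exp (\<i> * of_real pi)" by simp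
  then obtain n :: int where "z = \<i> * of_real pi + of_int (2 * n) * (of_real pi * \<i>)"
    unfolding exp_eq by (auto simp: mult_ac)
  then have "- z = \<i> * of_real (pi * (2 * of_int (- n - 1) + 1))" by (simp add: algebra_simps)
  then show ?thesis by blast
qed

section \<open>Counting zeros along the arc\<close>

context critical_arc
begin

text \<open>The half plane is that of \<open>pinv \<beta>\<close> because the sectors are given in
  terms of \<open>p\<close>; the inner radius keeps \<open>p\<close> away from \<open>0\<close>,
  where the asymptotics degenerate.\<close>

definition upper_zeros :: "real \<Rightarrow> real \<Rightarrow> nat \<Rightarrow> complex set" where
  "upper_zeros d d' N = {\<beta>. d \<le> norm (\<beta> - 1) \<and> norm (\<beta> - 1) \<le> d' \<and> 0 < Im (pinv \<beta>) \<and> partition_function \<beta> N = 0}"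

definition Phi :: "real \<Rightarrow> complex" where "Phi y = arc (action_inv y)"

lemma finite_upper_zeros: "finite (upper_zeros d d' N)"
  by (rule finite_subset[OF _ finite_partition_zeros[of d' N]]) (auto simp: upper_zeros_def)

text \<open>\<open>norm p >= 2 * d\<close> since \<open>\<beta> - 1\<close> is about
  \<open>p / 3\<close>. Outside the outer sector \<open>Im p <= 5 / 2 * Re p\<close>, hence
  \<open>norm p <= 7 / 2 * Re p\<close>, and this gives \<open>Re p >= d / 2\<close>.\<close>

lemma pinv_core:
  assumes "0 < d" "d \<le> norm (\<beta> - 1)" "norm (\<beta> - 1) < \<delta>" "0 < Im (pinv \<beta>)"
    "pinv \<beta> \<notin> inner_set (d / 2) (rad1 / 2)" "pinv \<beta> \<notin> outer_set (d / 2) (rad1 / 2)"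
  shows "pinv \<beta> \<in> core_set (d / 2) (rad1 / 2)" "core_cone (pinv \<beta>)"
proof -
  define p where "p = pinv \<beta>"
  have n: "norm p \<le> rad1 / 2" using pinv(1)[OF assms(3)] rad1 by (simp add: p_def)
  have l: "2 * d \<le> norm p" using pinv_approx(4)[OF assms(3)] assms(1,2) unfolding p_def by linarith
  have a: "norm p \<le> \<bar>Re p\<bar> + \<bar>Im p\<bar>" by (rule cmod_le)
  have i: "0 < Im p" "p \<notin> inner_set (d / 2) (rad1 / 2)" "p \<notin> outer_set (d / 2) (rad1 / 2)" using assms by (auto simp: p_def)
  have o: "4 / 5 * Im p < 2 * Re p" using i(3,1) n l assms(1) by (force simp: outer_set_def)
  then have re: "0 < Re p" "2 * Im p \<le> 5 * Re p" using i(1) by linarith+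
  have dd: "d / 2 \<le> Re p" using a l re i(1) assms(1) by linarith
  have "Re p \<le> 2 * Im p" using i(2,1) n dd by (force simp: inner_set_def)
  then show "pinv \<beta> \<in> core_set (d / 2) (rad1 / 2)" "core_cone (pinv \<beta>)"
    using dd re n by (auto simp: core_set_def core_cone_def p_def)
qed

text \<open>Spreading each zero over its cell of length \<open>2 * pi / N\<close> turns the sum into the integral of a step
  function, which converges pointwise, so that dominated convergence applies.\<close>

lemma upper_zeros_limit:
  fixes f :: "complex \<Rightarrow> real"
  assumes e: "0 < e1" "e1 < e2" "e2 < \<delta> / 4"
    and f: "continuous_on UNIV f" "\<And>z. \<bar>f z\<bar> \<le> B"
  shows "(\<lambda>N. (\<Sum>\<beta>\<in>upper_zeros (modulus e1) (modulus e2) N. f \<beta>) / real N)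
     \<longlonglongrightarrow> 1 / (2 * pi) * (\<integral>y. indicator {action e1..action e2} y * f (Phi y) \<partial>lborel)"
proof -
  define d where "d = modulus e1"
  define d' where "d' = modulus e2"
  have e': "0 \<le> e1" "e1 \<le> \<delta>" "0 \<le> e2" "e2 \<le> \<delta>" "e1 \<le> \<delta> / 4" "e2 \<le> \<delta> / 4" using e \<delta> by auto
  have dpos: "0 < d" using modulus_bounds(1)[OF e'(1,2)] e by (simp add: d_def)
  have d'\<delta>: "d' < \<delta>" using modulus_bounds(2)[OF e'(3,4)] e \<delta> unfolding d'_def by linarith
  let ?Z = "\<lambda>N. upper_zeros d d' N"
  let ?K = "core_set (d / 2) (rad1 / 2)"
  let ?U = "near_open (d / 4) (3 / 4 * rad1)"
  obtain N1 where N1: "\<And>N p. N1 \<le> N \<Longrightarrow> p \<in> inner_set (d / 2) (rad1 / 2) \<Longrightarrow> partition_function (beta_of p) N \<noteq> 0"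
    using partition_nonzero_inner[of "d / 2" "rad1 / 2"] dpos rad1 by auto
  obtain N2 where N2: "\<And>N p. N2 \<le> N \<Longrightarrow> p \<in> outer_set (d / 2) (rad1 / 2) \<Longrightarrow> partition_function (beta_of p) N \<noteq> 0"
    using partition_nonzero_outer[of "d / 2" "rad1 / 2"] dpos rad1 by auto
  obtain M N3 where "\<forall>N\<ge>N3. \<exists>g. g holomorphic_on ?U \<and> (\<forall>p\<in>?K. norm (g p) \<le> M \<and> norm (deriv g p) \<le> M) \<and>
     (\<forall>p\<in>?U. partition_function (beta_of p) N = 0 \<longleftrightarrow> exp (of_nat N * h_saddle p + g p) = - 1)"
    using partition_zeros_near[of "d / 4" "d / 2" "rad1 / 2" "3 / 4 * rad1"] dpos rad1 by auto
  then have "\<forall>N. \<exists>g. N3 \<le> N \<longrightarrow> g holomorphic_on ?U \<and> (\<forall>p\<in>?K. norm (g p) \<le> M \<and> norm (deriv g p) \<le> M) \<and>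
     (\<forall>p\<in>?U. partition_function (beta_of p) N = 0 \<longleftrightarrow> exp (of_nat N * h_saddle p + g p) = - 1)"
    by simp
  from choice[OF this] obtain g where g': "\<forall>N. N3 \<le> N \<longrightarrow> g N holomorphic_on ?U \<and> (\<forall>p\<in>?K. norm (g N p) \<le> M \<and> norm (deriv (g N) p) \<le> M) \<and>
     (\<forall>p\<in>?U. partition_function (beta_of p) N = 0 \<longleftrightarrow> exp (of_nat N * h_saddle p + g N p) = - 1)" ..
  have g: "\<And>N. N3 \<le> N \<Longrightarrow> g N holomorphic_on ?U"
    "\<And>N p. N3 \<le> N \<Longrightarrow> p \<in> ?K \<Longrightarrow> norm (g N p) \<le> M"
    "\<And>N p. N3 \<le> N \<Longrightarrow> p \<in> ?K \<Longrightarrow> norm (deriv (g N) p) \<le> M"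
    "\<And>N p. N3 \<le> N \<Longrightarrow> p \<in> ?U \<Longrightarrow> partition_function (beta_of p) N = 0 \<longleftrightarrow> exp (of_nat N * h_saddle p + g N p) = - 1"
    using g' by blast+
  have KU: "?K \<subseteq> ?U" using dpos rad1 by (intro core_subset_near) auto
  have Krad: "norm p < rad" "0 \<le> Re p" "0 \<le> Im p" "d / 2 \<le> norm p" "norm p \<le> rad1 / 2" if "p \<in> ?K" for p
    using that dpos rad1 complex_Re_le_cmod[of p] by (auto simp: core_set_def)
  \<comment> \<open>The last summand makes \<open>M / N <= d / 56\<close>, so that the correction by
    \<open>g / N\<close> consumes at most half of the lower bound \<open>d / 14\<close> for the
    rotated derivative of \<open>- h_saddle\<close>.\<close>
  define N0 where "N0 = N1 + N2 + N3 + 1 + nat \<lceil>56 * M / d\<rceil>"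
  have N0: "N1 \<le> N0" "N2 \<le> N0" "N3 \<le> N0" "1 \<le> N0" "56 * M / d \<le> real N0"
  proof -
    have "real (nat \<lceil>56 * M / d\<rceil>) \<le> real N0" unfolding N0_def by (simp only: of_nat_le_iff le_add2)
    then show "56 * M / d \<le> real N0" using real_nat_ceiling_ge[of "56 * M / d"] by linarith
  qed (simp_all add: N0_def)
  \<comment> \<open>Zeros are the points where \<open>T\<close> hits an odd multiple of
    \<open>\<i> * pi / N\<close>; \<open>T\<close> differs from \<open>- h_saddle\<close> by at most
    \<open>M / N\<close> and is still injective.\<close>
  define T where "T = (\<lambda>N p. - h_saddle p - g N p / of_nat N)"
  define node where "node = (\<lambda>N (k::int). pi * (2 * of_int k + 1) / real N)"
  have zero_iff: "partition_function (beta_of p) N = 0 \<longleftrightarrow> (\<exists>k. T N p = \<i> * of_real (node N k))"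
    if N: "N0 \<le> N" and p: "p \<in> ?K" for N p
  proof -
    have Np: "0 < real N" using N N0 by linarith
    have eq: "T N p = - (of_nat N * h_saddle p + g N p) / of_nat N"
      using Np by (simp add: T_def field_simps)
    have "partition_function (beta_of p) N = 0 \<longleftrightarrow> exp (of_nat N * h_saddle p + g N p) = - 1"
      using g(4)[of N p] N N0 p KU by auto
    also have "\<dots> \<longleftrightarrow> (\<exists>k::int. - (of_nat N * h_saddle p + g N p) = \<i> * of_real (pi * (2 * of_int k + 1)))"
    proof
      show "exp (of_nat N * h_saddle p + g N p) = - 1 \<Longrightarrow> \<exists>k::int. - (of_nat N * h_saddle p + g N p) = \<i> * of_real (pi * (2 * of_int k + 1))"
        by (rule exp_eq_minus_1)
      assume "\<exists>k::int. - (of_nat N * h_saddle p + g N p) = \<i> * of_real (pi * (2 * of_int k + 1))"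
      then obtain k :: int where "of_nat N * h_saddle p + g N p = - (\<i> * of_real (pi * (2 * of_int k + 1)))"
        by (metis minus_minus)
      then have "of_nat N * h_saddle p + g N p = \<i> * of_real pi + complex_of_real (real_of_int (2 * (- k - 1)) * pi) * \<i>"
        by (simp add: algebra_simps)
      then have "exp (of_nat N * h_saddle p + g N p) = exp (\<i> * of_real pi)" unfolding exp_eq by blast
      then show "exp (of_nat N * h_saddle p + g N p) = - 1" by simp
    qed
    also have "\<dots> \<longleftrightarrow> (\<exists>k. T N p = \<i> * of_real (node N k))"
      unfolding eq node_def using Np by (simp add: divide_eq_eq)
    finally show ?thesis .
  qed
  have Tderiv: "(T N has_field_derivative - (p * lcs'' p) - deriv (g N) p / of_nat N) (at p)"
    if "N0 \<le> N" "p \<in> ?K" for N p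
    unfolding T_def
    using that N0 KU holomorphic_derivI[OF g(1) near_open_props(1), of N p]
    by (intro DERIV_diff DERIV_minus h_saddle_deriv Krad DERIV_cdivide) auto
  have Texp: "d / 56 * norm (p - q) \<le> norm (T N p - T N q)" if N: "N0 \<le> N" and pq: "p \<in> ?K" "q \<in> ?K" for N p q
  proof -
    have Np: "0 < real N" using N N0 by linarith
    have MN: "M / real N \<le> d / 56"
    proof -
      have "56 * M / d \<le> real N" using N0(5) N by linarith
      then show ?thesis using dpos Np by (simp add: field_simps)
    qed
    have n: "norm (1 - \<i>) \<le> 2" by (rule order_trans[OF norm_triangle_ineq4]) simp
    have "d / 28 * norm (p - q) \<le> norm (1 - \<i>) * norm (T N p - T N q)"
    proof (rule expanding_if_Re_deriv_ge[OF core_set_props(2) pq Tderiv[OF N]])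
      fix x assume x: "x \<in> ?K"
      have "norm ((1 - \<i>) * (deriv (g N) x / of_nat N)) \<le> 2 * (M / real N)"
        unfolding norm_mult norm_divide norm_of_nat using n g(3)[of N x] N N0 x Np
        by (intro mult_mono divide_right_mono) auto
      then have "Re ((1 - \<i>) * (deriv (g N) x / of_nat N)) \<le> 2 * (M / real N)"
        using complex_Re_le_cmod order_trans by blast
      moreover have "norm x / 7 \<le> Re ((1 - \<i>) * (- (x * lcs'' x)))"
        using Re_h_saddle_deriv_ge[of x] Krad[OF x] by blast
      moreover have "Re ((1 - \<i>) * (- (x * lcs'' x) - deriv (g N) x / of_nat N))
        = Re ((1 - \<i>) * (- (x * lcs'' x))) - Re ((1 - \<i>) * (deriv (g N) x / of_nat N))"
        by (simp only: right_diff_distrib minus_complex.sel)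
      ultimately show "d / 28 \<le> Re ((1 - \<i>) * (- (x * lcs'' x) - deriv (g N) x / of_nat N))"
        using Krad(4)[OF x] MN by linarith
    qed
    also have "\<dots> \<le> 2 * norm (T N p - T N q)" using n by (intro mult_right_mono) auto
    finally show ?thesis by simp
  qed
  have Tinj: "p = q" if "N0 \<le> N" "p \<in> ?K" "q \<in> ?K" "T N p = T N q" for N p q
  proof -
    have "d / 56 * norm (p - q) \<le> 0" using Texp[OF that(1-3)] that(4) by simp
    then show ?thesis using dpos by (simp add: mult_le_0_iff)
  qed
  have Tnear: "norm (T N p + h_saddle p) \<le> M / real N" if "N0 \<le> N" "p \<in> ?K" for N p
    using g(2)[of N p] that N0 by (simp add: T_def norm_divide divide_right_mono)
  have node_inj: "k = l" if "N0 \<le> N" "node N k = node N l" for N k l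
    using that N0 by (auto simp: node_def)
  have zK: "pinv \<beta> \<in> ?K" "core_cone (pinv \<beta>)" "beta_of (pinv \<beta>) = \<beta>" if N: "N0 \<le> N" and b: "\<beta> \<in> ?Z N" for N \<beta>
  proof -
    have b': "d \<le> norm (\<beta> - 1)" "norm (\<beta> - 1) < \<delta>" "0 < Im (pinv \<beta>)" "partition_function \<beta> N = 0"
      using b d'\<delta> by (auto simp: upper_zeros_def)
    show be: "beta_of (pinv \<beta>) = \<beta>" by (rule pinv(2)[OF b'(2)])
    have "pinv \<beta> \<notin> inner_set (d / 2) (rad1 / 2)" "pinv \<beta> \<notin> outer_set (d / 2) (rad1 / 2)"
      using N1[of N "pinv \<beta>"] N2[of N "pinv \<beta>"] b'(4) be N N0 by auto
    from pinv_core[OF dpos b'(1-3) this] show "pinv \<beta> \<in> ?K" "core_cone (pinv \<beta>)" .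
  qed
  \<comment> \<open>The index of the node hit by a zero. Injectivity of \<open>T\<close> means that
    a node belongs to at most one zero.\<close>
  define idx where "idx = (\<lambda>N \<beta>. SOME k. T N (pinv \<beta>) = \<i> * of_real (node N k))"
  have idx: "T N (pinv \<beta>) = \<i> * of_real (node N (idx N \<beta>))" if N: "N0 \<le> N" and b: "\<beta> \<in> ?Z N" for N \<beta>
  proof -
    have "partition_function (beta_of (pinv \<beta>)) N = 0" using zK(3)[OF N b] b by (auto simp: upper_zeros_def)
    then have "\<exists>k. T N (pinv \<beta>) = \<i> * of_real (node N k)" using zero_iff[OF N zK(1)[OF N b]] by simp
    then show ?thesis unfolding idx_def by (rule someI_ex)
  qed
  have idx_inj: "\<beta> = \<beta>'" if N: "N0 \<le> N" and b: "\<beta> \<in> ?Z N" "\<beta>' \<in> ?Z N" "idx N \<beta> = idx N \<beta>'" for N \<beta> \<beta>'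
  proof -
    have "T N (pinv \<beta>) = T N (pinv \<beta>')" using idx[OF N b(1)] idx[OF N b(2)] b(3) by simp
    then have "pinv \<beta> = pinv \<beta>'" using Tinj[OF N zK(1)[OF N b(1)] zK(1)[OF N b(2)]] by blast
    then show ?thesis using zK(3)[OF N b(1)] zK(3)[OF N b(2)] by metis
  qed
  \<comment> \<open>\<open>node N k\<close> is the midpoint of the cell from
    \<open>2 * pi * k / N\<close> to \<open>2 * pi * (k + 1) / N\<close>; half-open cells make the
    index of \<open>y\<close> unique.\<close>
  define cell where "cell = (\<lambda>N (y::real). \<lfloor>real N * y / (2 * pi)\<rfloor>)"
  have cell_node: "\<bar>node N (cell N y) - y\<bar> \<le> pi / real N" if "N0 \<le> N" for N y
  proof -
    have Np: "0 < real N" using that N0 by linarith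
    have c: "of_int (cell N y) \<le> real N * y / (2 * pi)" "real N * y / (2 * pi) < of_int (cell N y) + 1"
      unfolding cell_def by linarith+
    have "2 * pi * of_int (cell N y) \<le> real N * y" "real N * y < 2 * pi * of_int (cell N y) + 2 * pi"
      using c pi_gt_zero by (simp_all add: field_simps)
    then have "\<bar>pi * (2 * of_int (cell N y) + 1) - real N * y\<bar> \<le> pi" by (simp add: abs_le_iff algebra_simps)
    then have "\<bar>pi * (2 * of_int (cell N y) + 1) - real N * y\<bar> / real N \<le> pi / real N" using Np by (intro divide_right_mono) auto
    moreover have "node N (cell N y) - y = (pi * (2 * of_int (cell N y) + 1) - real N * y) / real N"
      using Np by (simp add: node_def field_simps)
    ultimately show ?thesis using Np by simp
  qed
  define G where "G = (\<lambda>N y. \<Sum>\<beta>\<in>?Z N. f \<beta> * indicator {2 * pi * of_int (idx N \<beta>) / real N ..< 2 * pi * (of_int (idx N \<beta>) + 1) / real N} y)"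
  have G_eq: "G N y = (\<Sum>\<beta>\<in>{\<beta> \<in> ?Z N. idx N \<beta> = cell N y}. f \<beta>)" if N: "N0 \<le> N" for N y
  proof -
    have Np: "0 < real N" using N N0 by linarith
    have "y \<in> {2 * pi * of_int k / real N ..< 2 * pi * (of_int k + 1) / real N} \<longleftrightarrow> k = cell N y" for k :: int
    proof -
      have "k = cell N y \<longleftrightarrow> of_int k \<le> real N * y / (2 * pi) \<and> real N * y / (2 * pi) < of_int k + 1"
        unfolding cell_def by (metis floor_eq_iff)
      then show ?thesis using Np pi_gt_zero by (simp add: field_simps)
    qed
    then have "G N y = (\<Sum>\<beta>\<in>?Z N. if idx N \<beta> = cell N y then f \<beta> else 0)"
      unfolding G_def indicator_def by (intro sum.cong refl) (simp del: atLeastLessThan_iff)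
    also have "\<dots> = (\<Sum>\<beta>\<in>{\<beta> \<in> ?Z N. idx N \<beta> = cell N y}. f \<beta>)"
      by (rule sum.inter_filter[symmetric, OF finite_upper_zeros])
    finally show ?thesis .
  qed
  have G_zero: "G N y = 0" if "N0 \<le> N" "\<And>\<beta>. \<beta> \<in> ?Z N \<Longrightarrow> idx N \<beta> \<noteq> cell N y" for N y
    using that by (simp add: G_eq) (metis (mono_tags, lifting) empty_Collect_eq sum.empty)
  have G_one: "G N y = f \<beta>" if "N0 \<le> N" "\<beta> \<in> ?Z N" "idx N \<beta> = cell N y" for N y \<beta>
  proof -
    have "{\<beta> \<in> ?Z N. idx N \<beta> = cell N y} = {\<beta>}" using idx_inj[OF that(1)] that(2,3) by auto
    then show ?thesis using that(1) by (simp add: G_eq)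
  qed
  have G_int: "(\<integral>y. G N y \<partial>lborel) = 2 * pi * ((\<Sum>\<beta>\<in>?Z N. f \<beta>) / real N)" if N: "N0 \<le> N" for N
  proof -
    have Np: "0 < real N" using N N0 by linarith
    have le: "2 * pi * of_int k / real N \<le> 2 * pi * (of_int k + 1) / real N" for k :: int
      using Np by (intro divide_right_mono) auto
    have "(\<integral>y. G N y \<partial>lborel) = (\<Sum>\<beta>\<in>?Z N. \<integral>y. f \<beta> * indicator {2 * pi * of_int (idx N \<beta>) / real N ..< 2 * pi * (of_int (idx N \<beta>) + 1) / real N} y \<partial>lborel)"
      unfolding G_def by (intro Bochner_Integration.integral_sum integrable_mult_right integrable_real_indicator) (use le in auto)
    also have "\<dots> = (\<Sum>\<beta>\<in>?Z N. f \<beta> * (2 * pi / real N))"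
    proof (intro sum.cong refl)
      fix \<beta>
      show "(\<integral>y. f \<beta> * indicator {2 * pi * of_int (idx N \<beta>) / real N ..< 2 * pi * (of_int (idx N \<beta>) + 1) / real N} y \<partial>lborel) = f \<beta> * (2 * pi / real N)"
        using le[of "idx N \<beta>"] by (simp add: add_divide_distrib[symmetric] diff_divide_distrib[symmetric] algebra_simps)
    qed
    also have "\<dots> = 2 * pi * ((\<Sum>\<beta>\<in>?Z N. f \<beta>) / real N)"
      unfolding sum_distrib_right[symmetric] by simp
    finally show ?thesis .
  qed
  \<comment> \<open>At a zero \<open>norm T <= 1 + |M|\<close>, so its node is that close to
    \<open>0\<close>, and its cell extends at most \<open>pi\<close> further: all step functions
    vanish off \<open>{-L..L}\<close>.\<close>
  define L where "L = 1 + \<bar>M\<bar> + pi"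
  have B0: "0 \<le> B" using f(2)[of 0] by linarith
  have G_bound: "norm (G N y) \<le> B * indicator {-L..L} y" if N: "N0 \<le> N" for N y
  proof (cases "\<exists>\<beta>\<in>?Z N. idx N \<beta> = cell N y")
    case False
    then have "G N y = 0" using G_zero[OF N] by blast
    then show ?thesis using B0 by simp
  next
    case True
    then obtain \<beta> where b: "\<beta> \<in> ?Z N" "idx N \<beta> = cell N y" by blast
    have Np: "1 \<le> real N" using N N0 by linarith
    note K = zK(1)[OF N b(1)]
    have "norm (h_saddle (pinv \<beta>)) \<le> norm (pinv \<beta>) ^ 2 / 6" by (rule norm_h_saddle_le[OF Krad(1)[OF K]])
    also have "norm (pinv \<beta>) ^ 2 \<le> 1" using Krad(5)[OF K] rad1 by (intro power_le_one) auto
    then have "norm (pinv \<beta>) ^ 2 / 6 \<le> 1" by simp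
    finally have h1: "norm (h_saddle (pinv \<beta>)) \<le> 1" .
    have "norm (T N (pinv \<beta>)) \<le> norm (T N (pinv \<beta>) + h_saddle (pinv \<beta>)) + norm (h_saddle (pinv \<beta>))"
      by (metis add_diff_cancel_right' norm_triangle_ineq4)
    also have "\<dots> \<le> \<bar>M\<bar> + 1"
    proof (intro add_mono h1 order_trans[OF Tnear[OF N K]])
      have "M / real N \<le> \<bar>M\<bar> / real N" using Np by (intro divide_right_mono) auto
      also have "\<dots> \<le> \<bar>M\<bar> / 1" using Np by (intro divide_left_mono) auto
      finally show "M / real N \<le> \<bar>M\<bar>" by simp
    qed
    finally have "\<bar>node N (cell N y)\<bar> \<le> \<bar>M\<bar> + 1" using idx[OF N b(1)] b(2) by (simp add: norm_mult)
    moreover have "pi / real N \<le> pi / 1" using Np by (intro divide_left_mono) auto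
    ultimately have "y \<in> {-L..L}" using cell_node[OF N, of y] unfolding L_def abs_le_iff by auto
    then show ?thesis using G_one[OF N b] f(2)[of \<beta>] by simp
  qed
  \<comment> \<open>For large \<open>N\<close> exactly one zero has a cell containing
    \<open>y\<close>, and it is close to the point of the arc with action \<open>y\<close>, so the
    step function takes the value of \<open>f\<close> there.\<close>
  have hit: "(\<lambda>N. G N y) \<longlonglongrightarrow> f (Phi y)" if y: "action e1 < y" "y < action e2" for y
  proof -
    obtain \<epsilon> where \<epsilon>: "e1 \<le> \<epsilon>" "\<epsilon> \<le> e2" "action \<epsilon> = y"
      using action_surj[of e1 e2 y] e e' y by auto
    have ne: "e1 < \<epsilon>" "\<epsilon> < e2" using \<epsilon> y by (auto simp: less_le)
    have \<epsilon>4: "0 \<le> \<epsilon>" "\<epsilon> \<le> \<delta> / 4" "0 < \<epsilon>" using \<epsilon> e by auto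
    have Phi: "Phi y = arc \<epsilon>" using action_inv_action[OF \<epsilon>4(1,2)] \<epsilon>(3) by (simp add: Phi_def)
    define p0 where "p0 = pinv (arc \<epsilon>)"
    have p0: "beta_of p0 = arc \<epsilon>" "norm p0 < rad1 / 10" using pinv[OF arc_in[OF \<epsilon>4(1,2)]] by (auto simp: p0_def)
    have h0: "h_saddle p0 = - \<i> * of_real y" using h_saddle_arc[OF \<epsilon>4(1,2)] \<epsilon>(3) by (simp add: p0_def)
    have m0: "d < norm (beta_of p0 - 1)" "norm (beta_of p0 - 1) < d'"
      using modulus_mono[of e1 \<epsilon>] modulus_mono[of \<epsilon> e2] ne e' \<epsilon>4 \<delta> by (auto simp: p0(1) d_def d'_def modulus_def)
    note cc = arc_core[OF \<epsilon>4(3,2), folded p0_def]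
    have p0big: "2 * d \<le> norm p0"
      using norm_beta_of_bounds(1)[of p0] p0(2) rad1 m0(1) norm_ge_zero[of p0] by linarith
    have p0re: "d / 2 < Re p0"
      using cmod_le[of p0] cc p0big dpos by (auto simp: core_cone_def)
    show ?thesis
      unfolding tendsto_iff
    proof (intro allI impI)
      fix s :: real assume s: "0 < s"
      have cb: "isCont beta_of p0"
        using holomorphic_on_imp_continuous_on[OF beta_of_holomorphic] p0(2) rad1 by (simp add: continuous_on_eq_continuous_at)
      have cf: "isCont (\<lambda>p. f (beta_of p)) p0"
        using f(1) by (intro isCont_o2[OF cb]) (simp add: continuous_on_eq_continuous_at)
      have "\<forall>\<^sub>F p in nhds p0. d / 2 < Re p \<and> Re p < 2 * Im p \<and> 2 * Im p < 5 * Re p \<and> norm p < rad1 / 10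
          \<and> d < norm (beta_of p - 1) \<and> norm (beta_of p - 1) < d' \<and> dist (f (beta_of p)) (f (beta_of p0)) < s"
      proof (intro eventually_conj)
        have tn: "(F \<longlongrightarrow> F p0) (nhds p0)" if "isCont F p0" for F :: "complex \<Rightarrow> real"
          using that by (simp add: isCont_def tendsto_nhds_iff)
        note lt = order_tendstoD[OF tn]
        show "\<forall>\<^sub>F p in nhds p0. d / 2 < Re p" by (rule lt(1)) (use p0re in \<open>auto intro!: continuous_intros\<close>)
        have "\<forall>\<^sub>F p in nhds p0. 0 < 2 * Im p - Re p" by (rule lt(1)) (use cc in \<open>auto intro!: continuous_intros\<close>)
        then show "\<forall>\<^sub>F p in nhds p0. Re p < 2 * Im p" by simp
        have "\<forall>\<^sub>F p in nhds p0. 0 < 5 * Re p - 2 * Im p" by (rule lt(1)) (use cc in \<open>auto intro!: continuous_intros\<close>)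
        then show "\<forall>\<^sub>F p in nhds p0. 2 * Im p < 5 * Re p" by simp
        show "\<forall>\<^sub>F p in nhds p0. norm p < rad1 / 10" by (rule lt(2)) (use p0 in \<open>auto intro!: continuous_intros\<close>)
        show "\<forall>\<^sub>F p in nhds p0. d < norm (beta_of p - 1)" by (rule lt(1)) (use m0 cb in \<open>auto intro!: continuous_intros\<close>)
        show "\<forall>\<^sub>F p in nhds p0. norm (beta_of p - 1) < d'" by (rule lt(2)) (use m0 cb in \<open>auto intro!: continuous_intros\<close>)
        show "\<forall>\<^sub>F p in nhds p0. dist (f (beta_of p)) (f (beta_of p0)) < s" by (rule lt(2)) (use s cf in \<open>auto intro!: continuous_intros\<close>)
      qed
      then obtain r0 where r0: "r0 > 0" "\<And>p. dist p p0 < r0 \<Longrightarrow> d / 2 < Re p \<and> Re p < 2 * Im p \<and> 2 * Im p < 5 * Re p \<and> norm p < rad1 / 10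
          \<and> d < norm (beta_of p - 1) \<and> norm (beta_of p - 1) < d' \<and> dist (f (beta_of p)) (f (beta_of p0)) < s"
        unfolding eventually_nhds_metric by blast
      define r where "r = r0 / 2"
      have r: "0 < r" "\<And>p. p \<in> cball p0 r \<Longrightarrow> dist p p0 < r0" using r0(1) by (auto simp: r_def dist_commute)
      have inK: "p \<in> ?K" if "p \<in> cball p0 r" for p
        using r0(2)[OF r(2)[OF that]] rad1 by (auto simp: core_set_def)
      have "(\<lambda>N. 2 * (\<bar>M\<bar> + pi) / real N) \<longlonglongrightarrow> 0" by real_asymp
      then have "\<forall>\<^sub>F N in sequentially. 2 * (\<bar>M\<bar> + pi) / real N < d / 56 * r"
        using dpos r by (intro order_tendstoD(2)) auto
      then show "\<forall>\<^sub>F N in sequentially. dist (G N y) (f (Phi y)) < s"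
        using eventually_ge_at_top[of N0]
      proof eventually_elim
        case (elim N)
        then have N: "N0 \<le> N" and small: "2 * (\<bar>M\<bar> + pi) / real N < d / 56 * r" by auto
        have Np: "0 < real N" using N N0 by linarith
        define F where "F = (\<lambda>p. T N p - \<i> * of_real (node N (cell N y)))"
        have F0: "norm (F p0) \<le> (\<bar>M\<bar> + pi) / real N"
        proof -
          have p0K: "p0 \<in> ?K" using inK[of p0] r by auto
          have "F p0 = (T N p0 + h_saddle p0) - \<i> * of_real (node N (cell N y) - y)"
            by (simp add: F_def h0 algebra_simps)
          also have "norm \<dots> \<le> M / real N + pi / real N"
            by (intro order_trans[OF norm_triangle_ineq4] add_mono Tnear[OF N p0K])
              (use cell_node[OF N, of y] in \<open>simp only: norm_mult norm_of_real norm_ii mult_1\<close>)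
          also have "\<dots> \<le> (\<bar>M\<bar> + pi) / real N" using Np by (simp add: add_divide_distrib divide_right_mono)
          finally show ?thesis .
        qed
        have Fhol: "F holomorphic_on ball p0 r" "continuous_on (cball p0 r) F"
        proof -
          have FD: "(F has_field_derivative - (p * lcs'' p) - deriv (g N) p / of_nat N) (at p)" if "p \<in> cball p0 r" for p
            unfolding F_def using Tderiv[OF N inK[OF that]] by (auto intro!: derivative_eq_intros)
          show "F holomorphic_on ball p0 r"
            unfolding holomorphic_on_open[OF open_ball] using FD by (meson ball_subset_cball subsetD)
          show "continuous_on (cball p0 r) F"
            by (rule continuous_at_imp_continuous_on) (use FD DERIV_isCont in blast)
        qed
        \<comment> \<open>Minimum modulus principle: \<open>F\<close> is \<open>O(1 / N)\<close> at
          \<open>p0\<close>, while the expansion of \<open>T\<close> bounds it below on the circle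
          of fixed radius \<open>r\<close>, so \<open>F\<close> has a zero inside.\<close>
        obtain p1 where p1: "p1 \<in> ball p0 r" "F p1 = 0"
        proof (rule holomorphic_contract_to_zero[OF Fhol(2,1) r(1)])
          fix z assume z: "norm (p0 - z) = r"
          then have zK: "z \<in> ?K" "p0 \<in> ?K" using r by (auto intro!: inK simp: dist_norm)
          have "d / 56 * r \<le> norm (T N p0 - T N z)" using Texp[OF N zK(2,1)] z by simp
          also have "T N p0 - T N z = F p0 - F z" by (simp add: F_def)
          also have "norm \<dots> \<le> norm (F p0) + norm (F z)" by (rule norm_triangle_ineq4)
          finally show "norm (F p0) < norm (F z)" using F0 small unfolding times_divide_eq_right[symmetric] by linarith
        qed blast
        have p1c: "p1 \<in> cball p0 r" using p1 by auto
        define \<beta> where "\<beta> = beta_of p1"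
        note P = r0(2)[OF r(2)[OF p1c]]
        have pb: "pinv \<beta> = p1" unfolding \<beta>_def using P d'\<delta> by (intro pinv_unique) auto
        have T1: "T N p1 = \<i> * of_real (node N (cell N y))" using p1(2) by (simp add: F_def)
        then have "partition_function \<beta> N = 0" unfolding \<beta>_def using zero_iff[OF N inK[OF p1c]] by blast
        then have bZ: "\<beta> \<in> ?Z N" using P pb dpos unfolding upper_zeros_def \<beta>_def by auto
        have "\<i> * complex_of_real (node N (idx N \<beta>)) = \<i> * of_real (node N (cell N y))"
          using idx[OF N bZ] T1 pb by simp
        then have "node N (idx N \<beta>) = node N (cell N y)" by simp
        then have "idx N \<beta> = cell N y" by (rule node_inj[OF N])
        then have "G N y = f \<beta>" by (rule G_one[OF N bZ])
        then show ?case using P by (simp add: Phi p0(1)[symmetric] \<beta>_def)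
      qed
    qed
  qed
  \<comment> \<open>A solution of \<open>- h_saddle p = \<i> * y\<close> in \<open>K\<close> would
    be a point of the arc between \<open>e1\<close> and \<open>e2\<close> with action
    \<open>y\<close>, and there is none. So \<open>\<i> * y\<close> has positive distance from a
    compact set, and for large \<open>N\<close> no zero has a cell containing
    \<open>y\<close>.\<close>
  have miss: "(\<lambda>N. G N y) \<longlonglongrightarrow> 0" if y: "y < action e1 \<or> action e2 < y" for y
  proof -
    define K where "K = {p \<in> ?K. d \<le> norm (beta_of p - 1) \<and> norm (beta_of p - 1) \<le> d'} \<inter> cball 0 (rad1 / 10)"
    have cb: "continuous_on ?K beta_of"
      using Krad(1) by (intro continuous_on_subset[OF holomorphic_on_imp_continuous_on[OF beta_of_holomorphic]]) auto
    have "compact K"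
    proof -
      have "K = (?K \<inter> (\<lambda>p. norm (beta_of p - 1)) -` {d..d'}) \<inter> cball 0 (rad1 / 10)" by (auto simp: K_def)
      moreover have "closed (?K \<inter> (\<lambda>p. norm (beta_of p - 1)) -` {d..d'})"
        by (intro continuous_closed_preimage continuous_intros cb compact_imp_closed core_set_props closed_atLeastAtMost)
      ultimately have "closed K" by auto
      then show ?thesis by (rule compact_closed_bounded) (auto simp: K_def)
    qed
    then have cK: "compact ((\<lambda>p. - h_saddle p) ` K)"
      using Krad(1) by (intro compact_continuous_image continuous_intros
          continuous_on_subset[OF holomorphic_on_imp_continuous_on[OF h_saddle_holomorphic]]) (auto simp: K_def)
    have nK: "\<i> * of_real y \<notin> (\<lambda>p. - h_saddle p) ` K"
    proof
      assume "\<i> * of_real y \<in> (\<lambda>p. - h_saddle p) ` K"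
      then obtain p where p: "p \<in> K" "\<i> * of_real y = - h_saddle p" by auto
      define \<beta> where "\<beta> = beta_of p"
      have hp: "h_saddle p = - \<i> * of_real y" using p(2) by (simp add: minus_equation_iff)
      have pK: "p \<in> ?K" "d \<le> norm (\<beta> - 1)" "norm (\<beta> - 1) \<le> d'" "norm p \<le> rad1 / 10" using p(1) by (auto simp: K_def \<beta>_def)
      have bd: "norm (\<beta> - 1) < \<delta>" using pK d'\<delta> by simp
      have "beta_of (pinv \<beta>) = beta_of p" using pinv(2)[OF bd] by (simp add: \<beta>_def)
      then have pb: "pinv \<beta> = p" using inj_onD[OF beta_of_inj, of "pinv \<beta>" p] pinv_rad[OF bd] Krad(1)[OF pK(1)] by simp
      have "core_cone p" using pK(1) dpos by (auto simp: core_set_def core_cone_def)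
      note ac = arc_char[OF bd, unfolded pb, OF this]
      define \<epsilon> where "\<epsilon> = Re \<beta> - 1"
      have \<epsilon>: "0 < \<epsilon>" "\<epsilon> < \<delta>" "\<beta> = arc \<epsilon>" using ac hp by (auto simp: \<epsilon>_def)
      have "modulus e1 \<le> modulus \<epsilon>" "modulus \<epsilon> \<le> modulus e2" using pK \<epsilon> by (auto simp: modulus_def d_def d'_def)
      then have ee: "e1 \<le> \<epsilon>" "\<epsilon> \<le> e2" using \<epsilon> e' by (auto simp: modulus_le_iff)
      have "action \<epsilon> = y" using hp pb \<epsilon>(3) by (simp add: action_def)
      moreover have "action e1 \<le> action \<epsilon>" "action \<epsilon> \<le> action e2" using ee e' \<epsilon> by (auto simp: action_le_iff)
      ultimately show False using y by auto
    qed
    obtain \<mu> where \<mu>: "\<mu> > 0" "\<forall>x\<in>(\<lambda>p. - h_saddle p) ` K. \<mu> \<le> dist (\<i> * of_real y) x"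
      using separate_point_closed[OF compact_imp_closed[OF cK] nK] by (elim exE conjE)
    have "(\<lambda>N. (\<bar>M\<bar> + pi) / real N) \<longlonglongrightarrow> 0" by real_asymp
    then have "\<forall>\<^sub>F N in sequentially. (\<bar>M\<bar> + pi) / real N < \<mu>" using \<mu>(1) by (intro order_tendstoD(2)) auto
    then have "\<forall>\<^sub>F N in sequentially. G N y = 0"
      using eventually_ge_at_top[of N0]
    proof eventually_elim
      case (elim N)
      then have N: "N0 \<le> N" and small: "(\<bar>M\<bar> + pi) / real N < \<mu>" by auto
      have Np: "0 < real N" using N N0 by linarith
      show "G N y = 0"
      proof (rule G_zero[OF N], rule notI)
        fix \<beta> assume b: "\<beta> \<in> ?Z N" "idx N \<beta> = cell N y"
        define p where "p = pinv \<beta>"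
        have bd: "norm (\<beta> - 1) < \<delta>" using b d'\<delta> by (auto simp: upper_zeros_def)
        have pK: "p \<in> ?K" "beta_of p = \<beta>" using zK[OF N b(1)] by (auto simp: p_def)
        have "p \<in> K" using pK b(1) pinv(1)[OF bd] by (auto simp: K_def upper_zeros_def p_def)
        then have "\<mu> \<le> dist (\<i> * of_real y) (- h_saddle p)" by (intro \<mu>(2)[rule_format] imageI)
        moreover have eq: "\<i> * of_real y - - h_saddle p = (T N p + h_saddle p) - \<i> * of_real (node N (cell N y) - y)"
          using idx[OF N b(1)] b(2) by (simp add: p_def algebra_simps)
        have "dist (\<i> * of_real y) (- h_saddle p) \<le> M / real N + pi / real N"
          unfolding dist_norm eq
        proof (rule order_trans[OF norm_triangle_ineq4], rule add_mono)
          show "norm (T N p + h_saddle p) \<le> M / real N" by (rule Tnear[OF N pK(1)])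
          show "norm (\<i> * complex_of_real (node N (cell N y) - y)) \<le> pi / real N"
            using cell_node[OF N, of y] by (simp only: norm_mult norm_of_real norm_ii mult_1)
        qed
        moreover have "M / real N + pi / real N \<le> (\<bar>M\<bar> + pi) / real N"
          using Np by (simp add: add_divide_distrib divide_right_mono)
        ultimately show False using small by linarith
      qed
    qed
    then show ?thesis by (rule tendsto_eventually)
  qed
  have "(\<lambda>n. \<integral>y. G (n + N0) y \<partial>lborel) \<longlonglongrightarrow> (\<integral>y. indicator {action e1..action e2} y * f (Phi y) \<partial>lborel)"
  proof (rule integral_dominated_convergence[where w = "\<lambda>y. B * indicator {-L..L} y"])
    show "integrable lborel (\<lambda>y. B * indicator {-L..L} y)"
      by (intro integrable_mult_right integrable_real_indicator) (auto simp: emeasure_lborel_Icc_eq)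
    show "(\<lambda>y. G (n + N0) y) \<in> borel_measurable lborel" for n unfolding G_def by measurable
    show "AE y in lborel. norm (G (n + N0) y) \<le> B * indicator {-L..L} y" for n
      by (rule AE_I2) (rule G_bound, simp)
    have "continuous_on {action e1..action e2} (\<lambda>y. f (Phi y))"
    proof -
      have sub: "{action e1..action e2} \<subseteq> {0..action (\<delta> / 4)}"
        using action_mono[of 0 e1] action_mono[of e2 "\<delta> / 4"] e e' by auto
      have "continuous_on {action e1..action e2} Phi"
        unfolding Phi_def
      proof (rule continuous_on_compose2[OF arc_cont continuous_on_subset[OF action_inv_cont sub]])
        show "action_inv ` {action e1..action e2} \<subseteq> {0..\<delta>}"
        proof
          fix x assume "x \<in> action_inv ` {action e1..action e2}"
          then obtain y where y: "x = action_inv y" "action e1 \<le> y" "y \<le> action e2" by auto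
          then obtain \<epsilon> where "e1 \<le> \<epsilon>" "\<epsilon> \<le> e2" "action \<epsilon> = y" using action_surj[of e1 e2 y] e e' by auto
          then show "x \<in> {0..\<delta>}" using y action_inv_action[of \<epsilon>] e e' by auto
        qed
      qed
      then show ?thesis by (rule continuous_on_compose2[OF f(1)]) auto
    qed
    then have "(\<lambda>y. indicator {action e1..action e2} y *\<^sub>R f (Phi y)) \<in> borel_measurable borel"
      by (rule borel_measurable_continuous_on_indicator[rotated]) simp
    then show "(\<lambda>y. indicator {action e1..action e2} y * f (Phi y)) \<in> borel_measurable lborel" by simp
    \<comment> \<open>For these two values the corresponding zeros may fall on either side of the
      boundary of the annulus; they form a null set.\<close>
    have "AE y in lborel. y \<noteq> action e1" "AE y in lborel. y \<noteq> action e2" by (rule AE_lborel_singleton)+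
    then show "AE y in lborel. (\<lambda>n. G (n + N0) y) \<longlonglongrightarrow> indicator {action e1..action e2} y * f (Phi y)"
    proof eventually_elim
      case (elim y)
      show ?case
      proof (cases "action e1 < y \<and> y < action e2")
        case True
        then show ?thesis using LIMSEQ_ignore_initial_segment[OF hit[of y], of N0] by simp
      next
        case False
        then have "y < action e1 \<or> action e2 < y" using elim by auto
        then show ?thesis using LIMSEQ_ignore_initial_segment[OF miss[of y], of N0] by auto
      qed
    qed
  qed
  moreover have "(\<integral>y. G (n + N0) y \<partial>lborel) = 2 * pi * ((\<Sum>\<beta>\<in>?Z (n + N0). f \<beta>) / real (n + N0))" for n
    by (rule G_int) simp
  ultimately have "(\<lambda>n. 2 * pi * ((\<Sum>\<beta>\<in>?Z (n + N0). f \<beta>) / real (n + N0))) \<longlonglongrightarrow> (\<integral>y. indicator {action e1..action e2} y * f (Phi y) \<partial>lborel)"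
    by (simp only:)
  from tendsto_mult_left[OF this, of "1 / (2 * pi)"]
  have "(\<lambda>n. (\<Sum>\<beta>\<in>?Z (n + N0). f \<beta>) / real (n + N0)) \<longlonglongrightarrow> 1 / (2 * pi) * (\<integral>y. indicator {action e1..action e2} y * f (Phi y) \<partial>lborel)"
    by simp
  then show ?thesis unfolding d_def d'_def by (rule LIMSEQ_offset)
qed

end

section \<open>Zeros near the critical point\<close>

text \<open>Each zero is divided out once; as they are distinct, the others remain zeros of the
  quotient. Multiplicities are ignored, as in \<open>zero_measure\<close>.\<close>

lemma holomorphic_factor_zeros:
  assumes "finite A" "f holomorphic_on UNIV" "\<And>a. a \<in> A \<Longrightarrow> f a = 0"
  shows "\<exists>g. g holomorphic_on UNIV \<and> (\<forall>z. f z = (\<Prod>a\<in>A. z - a) * g z)"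
  using assms
proof (induction A)
  case empty
  then show ?case by auto
next
  case (insert a A)
  then obtain g where g: "g holomorphic_on UNIV" "\<And>z. f z = (\<Prod>a\<in>A. z - a) * g z" by auto
  have "(\<Prod>b\<in>A. a - b) \<noteq> 0" using insert by (auto simp: prod_zero_iff)
  then have ga: "g a = 0" using g(2)[of a] insert.prems by auto
  define k where "k = (\<lambda>z. if z = a then deriv g a else (g z - g a) / (z - a))"
  have "k holomorphic_on UNIV" unfolding k_def by (rule pole_lemma_open[OF g(1) open_UNIV])
  moreover have "f z = (\<Prod>a\<in>insert a A. z - a) * k z" for z
    using insert.hyps g(2)[of z] ga by (simp add: k_def)
  ultimately show ?case by blast
qed

text \<open>Jensen's inequality in elementary form: each linear factor is at least
  \<open>2 * r\<close> on the circle of radius \<open>3 * r\<close> and at most \<open>r\<close> at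
  the centre. With the maximum principle for the quotient, each zero gains a factor
  \<open>2\<close>.\<close>

lemma card_zeros_le:
  fixes f :: "complex \<Rightarrow> complex"
  assumes f: "f holomorphic_on UNIV" and r: "0 < r"
    and A: "finite A" "A \<subseteq> cball z0 r" "\<And>a. a \<in> A \<Longrightarrow> f a = 0"
    and B: "\<And>z. norm (z - z0) \<le> 3 * r \<Longrightarrow> norm (f z) \<le> B"
  shows "norm (f z0) * 2 ^ card A \<le> B"
proof -
  obtain g where g: "g holomorphic_on UNIV" "\<And>z. f z = (\<Prod>a\<in>A. z - a) * g z"
    using holomorphic_factor_zeros[OF A(1) f A(3)] by blast
  have "norm (g z0) \<le> B / (2 * r) ^ card A"
  proof (rule maximum_modulus_frontier[of g "cball z0 (3 * r)"])
    show "g holomorphic_on interior (cball z0 (3 * r))" using g(1) by (rule holomorphic_on_subset) simp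
    show "continuous_on (closure (cball z0 (3 * r))) g"
      using holomorphic_on_imp_continuous_on[OF g(1)] by (rule continuous_on_subset) simp
    fix z assume "z \<in> frontier (cball z0 (3 * r))"
    then have z: "norm (z - z0) = 3 * r" using r by (auto simp: dist_norm norm_minus_commute)
    have "(2 * r) ^ card A = (\<Prod>a\<in>A. 2 * r)" by simp
    also have "\<dots> \<le> (\<Prod>a\<in>A. norm (z - a))"
    proof (intro prod_mono conjI)
      fix a assume "a \<in> A"
      then have "norm (a - z0) \<le> r" using A by (auto simp: dist_norm norm_minus_commute)
      moreover have "norm (z - z0) \<le> norm (z - a) + norm (a - z0)" using norm_triangle_ineq[of "z - a" "a - z0"] by simp
      ultimately show "2 * r \<le> norm (z - a)" using z by linarith
    qed (use r in auto)
    finally have "(2 * r) ^ card A * norm (g z) \<le> norm (f z)"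
      unfolding g(2) norm_mult prod_norm[symmetric] by (intro mult_right_mono) auto
    also have "\<dots> \<le> B" using z by (intro B) auto
    finally show "norm (g z) \<le> B / (2 * r) ^ card A" using r by (simp add: field_simps)
  qed (use r in auto)
  moreover have "(\<Prod>a\<in>A. norm (z0 - a)) \<le> r ^ card A"
  proof -
    have "(\<Prod>a\<in>A. norm (z0 - a)) \<le> (\<Prod>a\<in>A. r)"
      using A by (intro prod_mono) (auto simp: dist_norm)
    then show ?thesis by simp
  qed
  ultimately have "norm (f z0) \<le> r ^ card A * (B / (2 * r) ^ card A)"
    unfolding g(2)[of z0] norm_mult prod_norm[symmetric] using r by (intro mult_mono) auto
  then show ?thesis using r by (simp add: power_mult_distrib field_simps)
qed

text \<open>Exponential growth of rate \<open>3 * r * N / 2\<close> on the larger disc allows at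
  most that many doublings, up to the factor \<open>ln 2\<close>. The bound is linear in
  \<open>r\<close>, so the mass near \<open>1\<close> is small uniformly in
  \<open>N\<close>.\<close>

lemma card_partition_zeros_le:
  assumes r: "0 < r"
  shows "real (card {\<beta>. norm (\<beta> - 1) \<le> r \<and> partition_function \<beta> N = 0}) \<le> 3 * r * real N"
proof -
  let ?A = "{\<beta>. norm (\<beta> - 1) \<le> r \<and> partition_function \<beta> N = 0}"
  have "norm (partition_function 1 N) * 2 ^ card ?A \<le> exp (3 * r * real N / 2) * norm (partition_function 1 N)"
  proof (rule card_zeros_le[OF partition_function_holomorphic r finite_partition_zeros])
    show "?A \<subseteq> cball 1 r" by (auto simp: dist_norm norm_minus_commute)
    show "norm (partition_function z N) \<le> exp (3 * r * real N / 2) * norm (partition_function 1 N)"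
      if "norm (z - 1) \<le> 3 * r" for z
      using norm_partition_function_le[OF that] r by simp
  qed auto
  then have "2 ^ card ?A * norm (partition_function 1 N) \<le> exp (3 * r * real N / 2) * norm (partition_function 1 N)"
    by (simp only: mult.commute)
  moreover have "0 < norm (partition_function 1 N)" using partition_function_real_pos[of 1 N] by simp
  ultimately have "2 ^ card ?A \<le> exp (3 * r * real N / 2)" by (rule mult_right_le_imp_le)
  then have "ln (2 ^ card ?A) \<le> ln (exp (3 * r * real N / 2))" by (intro ln_mono) auto
  then have "ln (2 ^ card ?A) \<le> 3 * r * real N / 2" by simp
  then have "real (card ?A) * ln 2 \<le> 3 * r * real N / 2" by (simp add: ln_realpow)
  moreover have "real (card ?A) * (1 / 2) \<le> real (card ?A) * ln 2" using ln2_ge_two_thirds by (intro mult_left_mono) auto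
  ultimately show ?thesis by simp
qed

lemma zero_measure_integral:
  fixes f :: "complex \<Rightarrow> real"
  assumes "finite (zeros_near c' N)" "f \<in> borel_measurable borel"
  shows "integral\<^sup>L (zero_measure c' N) f = (\<Sum>\<beta>\<in>zeros_near c' N. f \<beta>) / real N"
proof -
  let ?D = "distr (count_space (zeros_near c' N)) borel (\<lambda>\<beta>. \<beta>)"
  have "zero_measure c' N = density ?D (\<lambda>_. ennreal (1 / real N))"
    by (rule measure_eqI) (auto simp: zero_measure_def emeasure_density_const)
  then have "integral\<^sup>L (zero_measure c' N) f = (\<integral>z. (1 / real N) *\<^sub>R f z \<partial>?D)"
    using assms(2) by (simp only:) (subst integral_density, auto)
  also have "\<dots> = (\<integral>z. (1 / real N) *\<^sub>R f z \<partial>count_space (zeros_near c' N))"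
    using assms(2) by (subst integral_distr) auto
  also have "\<dots> = (\<Sum>\<beta>\<in>zeros_near c' N. f \<beta>) / real N"
    using assms(1) by (simp add: lebesgue_integral_count_space_finite sum_divide_distrib)
  finally show ?thesis .
qed

context critical_arc
begin

lemma pinv_cnj: "norm (\<beta> - 1) < \<delta> \<Longrightarrow> pinv (cnj \<beta>) = cnj (pinv \<beta>)"
proof -
  assume b: "norm (\<beta> - 1) < \<delta>"
  have "cnj \<beta> - 1 = cnj (\<beta> - 1)" by simp
  then have b': "norm (cnj \<beta> - 1) < \<delta>" using b by (simp only: complex_mod_cnj)
  have "pinv (beta_of (cnj (pinv \<beta>))) = cnj (pinv \<beta>)"
    using pinv[OF b] b' by (intro pinv_unique) (auto simp: beta_of_cnj)
  then show ?thesis using pinv(2)[OF b] by (simp add: beta_of_cnj)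
qed

lemma Phi_cont: "0 \<le> e \<Longrightarrow> e \<le> \<delta> / 4 \<Longrightarrow> continuous_on {0..action e} Phi"
proof -
  assume e: "0 \<le> e" "e \<le> \<delta> / 4"
  have sub: "{0..action e} \<subseteq> {0..action (\<delta> / 4)}"
    using action_le_iff[of e "\<delta> / 4"] e \<delta> by auto
  show ?thesis
    unfolding Phi_def
  proof (rule continuous_on_compose2[OF arc_cont continuous_on_subset[OF action_inv_cont sub]])
    show "action_inv ` {0..action e} \<subseteq> {0..\<delta>}"
    proof
      fix x assume "x \<in> action_inv ` {0..action e}"
      then obtain y where y: "x = action_inv y" "0 \<le> y" "y \<le> action e" by auto
      obtain \<epsilon> where "0 \<le> \<epsilon>" "\<epsilon> \<le> e" "action \<epsilon> = y" using action_surj[of 0 e y] e y by auto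
      then show "x \<in> {0..\<delta>}" using y action_inv_action[of \<epsilon>] e \<delta> by auto
    qed
  qed
qed

lemma Phi_action: "0 \<le> \<epsilon> \<Longrightarrow> \<epsilon> \<le> \<delta> / 4 \<Longrightarrow> Phi (action \<epsilon>) = arc \<epsilon>"
  by (simp add: Phi_def action_inv_action)

text \<open>The inner radius of the annulus is sent to \<open>0\<close>: the discarded zeros and the
  discarded part of the integral are small uniformly in \<open>N\<close>. The lower half plane is
  covered by applying the result for the upper one to \<open>f\<close> composed with
  \<open>cnj\<close>.\<close>

lemma zeros_limit:
  fixes f :: "complex \<Rightarrow> real"
  assumes es: "0 < es" "es < \<delta> / 4" and f: "continuous_on UNIV f" "\<And>z. \<bar>f z\<bar> \<le> B"
  shows "(\<lambda>N. (\<Sum>\<beta>\<in>zeros_near (modulus es) N. f \<beta>) / real N)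
     \<longlonglongrightarrow> 1 / (2 * pi) * (\<integral>y. indicator {0..action es} y * (f (Phi y) + f (cnj (Phi y))) \<partial>lborel)"
proof -
  have B0: "0 \<le> B" using f(2)[of 0] by linarith
  let ?Y = "action es"
  have Y: "0 < ?Y" using action_pos es by simp
  have es': "0 \<le> es" "es \<le> \<delta>" "es \<le> \<delta> / 4" using es \<delta> by auto
  define F where "F = (\<lambda>y. f (Phi y) + f (cnj (Phi y)))"
  have fc: "continuous_on UNIV (\<lambda>z. f (cnj z))" by (intro continuous_on_compose2[OF f(1)] continuous_intros) auto
  have cont: "continuous_on {0..?Y} (\<lambda>y. f (Phi y))" "continuous_on {0..?Y} (\<lambda>y. f (cnj (Phi y)))"
    using Phi_cont[OF es'(1,3)] by (auto intro!: continuous_on_compose2[OF f(1)] continuous_intros)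
  have int: "integrable lborel (\<lambda>y. indicator {a..b} y * f (Phi y))" "integrable lborel (\<lambda>y. indicator {a..b} y * f (cnj (Phi y)))"
    if "0 \<le> a" "b \<le> ?Y" for a b
    using borel_integrable_atLeastAtMost'[OF continuous_on_subset[OF cont(1)], of a b]
      borel_integrable_atLeastAtMost'[OF continuous_on_subset[OF cont(2)], of a b] that
    by (auto simp: set_integrable_def)
  have intF: "integrable lborel (\<lambda>y. indicator {a..b} y * F y)" if "0 \<le> a" "b \<le> ?Y" for a b
    using Bochner_Integration.integrable_add[OF int[OF that]] by (simp add: F_def distrib_left)
  have Fb: "\<bar>F y\<bar> \<le> 2 * B" for y
    using f(2)[of "Phi y"] f(2)[of "cnj (Phi y)"] unfolding F_def by linarith
  show ?thesis
    unfolding tendsto_iff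
  proof (intro allI impI)
    fix s :: real assume s: "0 < s"
    \<comment> \<open>The two summands bound what the cut at \<open>e\<close> discards: the zeros,
      by Jensen's inequality, and the integral over \<open>{0..action e}\<close> of a function
      bounded by \<open>2 * B\<close>.\<close>
    have ev: "\<forall>\<^sub>F e in at_right 0. 3 * B * modulus e + B * action e / pi < s / 2 \<and> 0 < e \<and> e < es"
    proof -
      have "(modulus \<longlongrightarrow> modulus 0) (at_right 0)" "(action \<longlongrightarrow> action 0) (at_right 0)"
        using continuous_on_Icc_at_rightD[OF modulus_cont] continuous_on_Icc_at_rightD[OF action_cont] \<delta> by auto
      then have "((\<lambda>e. 3 * B * modulus e + B * action e / pi) \<longlongrightarrow> 3 * B * modulus 0 + B * action 0 / pi) (at_right 0)"
        by (intro tendsto_intros) auto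
      then have "\<forall>\<^sub>F e in at_right 0. 3 * B * modulus e + B * action e / pi < s / 2"
        using s by (intro order_tendstoD(2)) auto
      moreover have "\<forall>\<^sub>F e in at_right 0. 0 < e \<and> e < es"
        using es eventually_at_right_real[of 0 es] by (auto elim!: eventually_mono)
      ultimately show ?thesis by eventually_elim auto
    qed
    obtain e1 where e1: "3 * B * modulus e1 + B * action e1 / pi < s / 2" "0 < e1" "e1 < es"
      using eventually_happens[OF ev] by auto
    have e1': "0 \<le> e1" "e1 \<le> \<delta>" "e1 \<le> \<delta> / 4" using e1 es by auto
    have m1: "0 < modulus e1" using modulus_bounds(1)[OF e1'(1,2)] e1 by linarith
    have ms: "modulus es < \<delta>" using arc_in[OF es'(1,3)] by (simp add: modulus_def)
    have m1s: "modulus e1 < modulus es" using modulus_mono[of e1 es] e1 es' by simp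
    have a1: "0 \<le> action e1" "action e1 \<le> ?Y" using action_mono[of 0 e1] action_mono[of e1 es] e1 es e1' by auto
    let ?U = "\<lambda>N. upper_zeros (modulus e1) (modulus es) N"
    let ?I = "\<lambda>y. indicator {action e1..?Y} y"
    have l1: "(\<lambda>N. (\<Sum>\<beta>\<in>?U N. f \<beta>) / real N) \<longlonglongrightarrow> 1 / (2 * pi) * (\<integral>y. ?I y * f (Phi y) \<partial>lborel)"
      by (rule upper_zeros_limit[OF e1(2,3) es(2) f])
    have l2: "(\<lambda>N. (\<Sum>\<beta>\<in>?U N. f (cnj \<beta>)) / real N) \<longlonglongrightarrow> 1 / (2 * pi) * (\<integral>y. ?I y * f (cnj (Phi y)) \<partial>lborel)"
      by (rule upper_zeros_limit[OF e1(2,3) es(2) fc f(2)])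
    have sumI: "(\<integral>y. ?I y * F y \<partial>lborel) = (\<integral>y. ?I y * f (Phi y) \<partial>lborel) + (\<integral>y. ?I y * f (cnj (Phi y)) \<partial>lborel)"
      using Bochner_Integration.integral_add[OF int[OF a1(1) order_refl]] by (simp add: F_def distrib_left)
    have l3: "(\<lambda>N. (\<Sum>\<beta>\<in>?U N. f \<beta>) / real N + (\<Sum>\<beta>\<in>?U N. f (cnj \<beta>)) / real N)
       \<longlonglongrightarrow> 1 / (2 * pi) * (\<integral>y. ?I y * F y \<partial>lborel)"
      using tendsto_add[OF l1 l2] unfolding sumI distrib_left .
    have diff: "\<bar>1 / (2 * pi) * (\<integral>y. ?I y * F y \<partial>lborel) - 1 / (2 * pi) * (\<integral>y. indicator {0..?Y} y * F y \<partial>lborel)\<bar> \<le> B * action e1 / pi"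
    proof -
      have d1: "(\<integral>y. ?I y * F y \<partial>lborel) - (\<integral>y. indicator {0..?Y} y * F y \<partial>lborel) = (\<integral>y. ?I y * F y - indicator {0..?Y} y * F y \<partial>lborel)"
        using intF[of "action e1" ?Y] intF[of 0 ?Y] a1 by simp
      have d2: "\<bar>\<integral>y. ?I y * F y - indicator {0..?Y} y * F y \<partial>lborel\<bar> \<le> (\<integral>y. 2 * B * indicator {0..action e1} y \<partial>lborel)"
        unfolding real_norm_def[symmetric]
      proof (rule order_trans[OF Bochner_Integration.integral_norm_bound Bochner_Integration.integral_mono])
        show "integrable lborel (\<lambda>y. norm (?I y * F y - indicator {0..?Y} y * F y))"
          using intF[of "action e1" ?Y] intF[of 0 ?Y] a1
          by (intro integrable_norm Bochner_Integration.integrable_diff) auto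
        show "integrable lborel (\<lambda>y. 2 * B * indicator {0..action e1} y)"
          by (intro integrable_mult_right integrable_real_indicator) (auto simp: emeasure_lborel_Icc_eq)
        show "norm (?I y * F y - indicator {0..?Y} y * F y) \<le> 2 * B * indicator {0..action e1} y" for y
          using Fb[of y] a1 B0 by (auto simp: indicator_def)
      qed
      have d3: "(\<integral>y. 2 * B * indicator {0..action e1} y \<partial>lborel) = 2 * B * action e1" using a1 by simp
      have *: "\<bar>(\<integral>y. ?I y * F y \<partial>lborel) - (\<integral>y. indicator {0..?Y} y * F y \<partial>lborel)\<bar> \<le> 2 * B * action e1"
        unfolding d1 using d2 unfolding d3 .
      have "\<bar>1 / (2 * pi) * (\<integral>y. ?I y * F y \<partial>lborel) - 1 / (2 * pi) * (\<integral>y. indicator {0..?Y} y * F y \<partial>lborel)\<bar>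
          = 1 / (2 * pi) * \<bar>(\<integral>y. ?I y * F y \<partial>lborel) - (\<integral>y. indicator {0..?Y} y * F y \<partial>lborel)\<bar>"
        unfolding right_diff_distrib[symmetric] abs_mult by simp
      also have "\<dots> \<le> 1 / (2 * pi) * (2 * B * action e1)" by (rule mult_left_mono[OF *]) simp
      finally show ?thesis by simp
    qed
    have split: "\<bar>(\<Sum>\<beta>\<in>zeros_near (modulus es) N. f \<beta>) / real N - ((\<Sum>\<beta>\<in>?U N. f \<beta>) / real N + (\<Sum>\<beta>\<in>?U N. f (cnj \<beta>)) / real N)\<bar> \<le> 3 * B * modulus e1"
      if N: "0 < N" for N
    proof -
      define S where "S = {\<beta>. norm (\<beta> - 1) < modulus e1 \<and> partition_function \<beta> N = 0}"
      have fS: "finite S" by (rule finite_subset[OF _ finite_partition_zeros[of "modulus e1" N]]) (auto simp: S_def)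
      have nc: "norm (cnj \<beta> - 1) = norm (\<beta> - 1)" for \<beta> by (metis complex_cnj_diff complex_cnj_one complex_mod_cnj)
      have low: "cnj ` ?U N = {\<beta>. modulus e1 \<le> norm (\<beta> - 1) \<and> norm (\<beta> - 1) \<le> modulus es \<and> Im (pinv \<beta>) < 0 \<and> partition_function \<beta> N = 0}" (is "_ = ?L")
      proof
        show "cnj ` ?U N \<subseteq> ?L"
          using ms pinv_cnj by (auto simp: upper_zeros_def nc partition_function_cnj)
        show "?L \<subseteq> cnj ` ?U N"
        proof
          fix \<beta> assume b: "\<beta> \<in> ?L"
          then have "cnj \<beta> \<in> ?U N" using ms pinv_cnj[of \<beta>] by (auto simp: upper_zeros_def nc partition_function_cnj)
          then have "cnj (cnj \<beta>) \<in> cnj ` ?U N" by (rule imageI)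
          then show "\<beta> \<in> cnj ` ?U N" by simp
        qed
      qed
      \<comment> \<open>A zero with real \<open>pinv \<beta>\<close> would itself be real, where the
        partition function is a sum of positive terms.\<close>
      have real: "Im (pinv \<beta>) \<noteq> 0" if "norm (\<beta> - 1) \<le> modulus es" "partition_function \<beta> N = 0" for \<beta>
      proof
        assume "Im (pinv \<beta>) = 0"
        then have "cnj (pinv \<beta>) = pinv \<beta>" by (simp add: complex_eq_iff)
        then have "cnj \<beta> = \<beta>" using beta_of_cnj[of "pinv \<beta>"] pinv(2)[of \<beta>] that ms by simp
        then have "Im \<beta> = 0" by (simp add: complex_eq_iff)
        then show False using partition_function_real_pos that by blast
      qed
      have Z: "zeros_near (modulus es) N = S \<union> (?U N \<union> cnj ` ?U N)"
        unfolding low using m1s real by (auto simp: zeros_near_def S_def upper_zeros_def not_less) (metis order_le_less)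
      have "(\<Sum>\<beta>\<in>zeros_near (modulus es) N. f \<beta>) = (\<Sum>\<beta>\<in>S. f \<beta>) + ((\<Sum>\<beta>\<in>?U N. f \<beta>) + (\<Sum>\<beta>\<in>cnj ` ?U N. f \<beta>))"
        unfolding Z
      proof (subst sum.union_disjoint)
        show "S \<inter> (?U N \<union> cnj ` ?U N) = {}" unfolding low by (auto simp: S_def upper_zeros_def)
        show "sum f S + sum f (?U N \<union> cnj ` ?U N) = sum f S + (sum f (?U N) + sum f (cnj ` ?U N))"
          by (subst sum.union_disjoint[OF finite_upper_zeros finite_imageI[OF finite_upper_zeros]])
            (unfold low, auto simp: upper_zeros_def)
      qed (use fS finite_upper_zeros in auto)
      moreover have "(\<Sum>\<beta>\<in>cnj ` ?U N. f \<beta>) = (\<Sum>\<beta>\<in>?U N. f (cnj \<beta>))"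
        by (subst sum.reindex) (auto intro: inj_onI simp: o_def)
      ultimately have s1: "(\<Sum>\<beta>\<in>zeros_near (modulus es) N. f \<beta>) / real N - ((\<Sum>\<beta>\<in>?U N. f \<beta>) / real N + (\<Sum>\<beta>\<in>?U N. f (cnj \<beta>)) / real N)
         = (\<Sum>\<beta>\<in>S. f \<beta>) / real N" by (simp add: add_divide_distrib)
      have "\<bar>(\<Sum>\<beta>\<in>S. f \<beta>) / real N\<bar> \<le> (B * real (card S)) / real N"
      proof -
        have "\<bar>\<Sum>\<beta>\<in>S. f \<beta>\<bar> \<le> (\<Sum>\<beta>\<in>S. B)" using f(2) by (intro order_trans[OF sum_abs] sum_mono) auto
        then show ?thesis by (simp add: divide_right_mono mult.commute)
      qed
      also have "\<dots> \<le> (B * (3 * modulus e1 * real N)) / real N"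
      proof (intro divide_right_mono mult_left_mono)
        have "card S \<le> card {\<beta>. norm (\<beta> - 1) \<le> modulus e1 \<and> partition_function \<beta> N = 0}"
          by (intro card_mono finite_partition_zeros) (auto simp: S_def)
        then show "real (card S) \<le> 3 * modulus e1 * real N"
          using card_partition_zeros_le[OF m1, of N] by linarith
      qed (use B0 in auto)
      also have "\<dots> = 3 * B * modulus e1" using N by simp
      finally show ?thesis unfolding s1 .
    qed
    have "\<forall>\<^sub>F N in sequentially. dist ((\<Sum>\<beta>\<in>?U N. f \<beta>) / real N + (\<Sum>\<beta>\<in>?U N. f (cnj \<beta>)) / real N) (1 / (2 * pi) * (\<integral>y. ?I y * F y \<partial>lborel)) < s / 2"
      using tendstoD[OF l3, of "s / 2"] s by simp
    then show "\<forall>\<^sub>F N in sequentially. dist ((\<Sum>\<beta>\<in>zeros_near (modulus es) N. f \<beta>) / real N)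
        (1 / (2 * pi) * (\<integral>y. indicator {0..action es} y * (f (Phi y) + f (cnj (Phi y))) \<partial>lborel)) < s"
      using eventually_gt_at_top[of 0]
    proof eventually_elim
      case (elim N)
      show ?case
        using elim(1) split[OF elim(2)] diff e1(1) unfolding dist_real_def F_def by linarith
    qed
  qed
qed

end

section \<open>Limit measure\<close>

context critical_arc
begin

text \<open>Clamping the parameter extends \<open>Phi\<close> to a continuous function on the whole
  line, from which measurability of \<open>Psi\<close> follows.\<close>

definition clamped :: "real \<Rightarrow> real \<Rightarrow> complex" where
  "clamped es y = Phi (min (max y 0) (action es))"
text \<open>Negative parameters run through the conjugate arc, so that complex conjugation
  corresponds to the reflection of the line, which preserves Lebesgue measure.\<close>

definition Psi :: "real \<Rightarrow> real \<Rightarrow> complex" where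
  "Psi es y = (if 0 \<le> y then clamped es y else cnj (clamped es (- y)))"
definition arc_measure :: "real \<Rightarrow> complex measure" where
  "arc_measure es = distr (density lborel (\<lambda>y. ennreal (indicator {- action es..action es} y / (2 * pi)))) borel (Psi es)"

context
  fixes es :: real
  assumes es: "0 < es" "es < \<delta> / 4"
begin

lemma es_le: "0 \<le> es" "es \<le> \<delta>" "es \<le> \<delta> / 4" "0 < action es"
  using es \<delta> action_pos by auto

lemma Phi_obtain:
  assumes "0 \<le> y" "y \<le> action es"
  obtains \<epsilon> where "0 \<le> \<epsilon>" "\<epsilon> \<le> es" "action \<epsilon> = y" "Phi y = arc \<epsilon>"
proof -
  obtain \<epsilon> where "0 \<le> \<epsilon>" "\<epsilon> \<le> es" "action \<epsilon> = y" using action_surj[of 0 es y] assms es_le by auto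
  then show ?thesis using that[of \<epsilon>] Phi_action[of \<epsilon>] es_le by auto
qed

lemma Psi_measurable [measurable]: "Psi es \<in> borel_measurable borel"
proof -
  have "continuous_on UNIV (clamped es)"
    unfolding clamped_def using es_le
    by (intro continuous_on_compose2[OF Phi_cont[OF es_le(1,3)]] continuous_intros) auto
  then have [measurable]: "clamped es \<in> borel_measurable borel" by (rule borel_measurable_continuous_onI)
  have [measurable]: "cnj \<in> borel_measurable borel"
    by (intro borel_measurable_continuous_onI continuous_intros)
  show ?thesis unfolding Psi_def[abs_def] by measurable
qed

lemma Psi_pos: "0 \<le> y \<Longrightarrow> y \<le> action es \<Longrightarrow> Psi es y = Phi y"
  and Psi_neg: "y < 0 \<Longrightarrow> - action es \<le> y \<Longrightarrow> Psi es y = cnj (Phi (- y))"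
  by (simp_all add: Psi_def clamped_def min_def max_def)

lemma Psi_uminus: "Psi es (- y) = cnj (Psi es y)"
proof (cases "y = 0")
  case True
  have "Phi 0 = 1" using Phi_action[of 0] \<delta> by simp
  then show ?thesis using True es_le by (simp add: Psi_def clamped_def)
qed (auto simp: Psi_def)

lemma sets_arc_measure [simp]: "sets (arc_measure es) = sets borel"
  by (simp add: arc_measure_def)

lemma emeasure_arc_measure:
  assumes A: "A \<in> sets borel"
  shows "emeasure (arc_measure es) A = ennreal (1 / (2 * pi)) * emeasure lborel ({- action es..action es} \<inter> Psi es -` A)"
proof -
  have P: "Psi es -` A \<in> sets borel" using measurable_sets[OF Psi_measurable A] by simp
  let ?g = "\<lambda>y. ennreal (indicator {- action es..action es} y / (2 * pi))"
  have "emeasure (arc_measure es) A = emeasure (density lborel ?g) (Psi es -` A)"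
    unfolding arc_measure_def using A by (subst emeasure_distr) auto
  also have "\<dots> = (\<integral>\<^sup>+ y. ?g y * indicator (Psi es -` A) y \<partial>lborel)"
    using P by (intro emeasure_density) auto
  also have "\<dots> = (\<integral>\<^sup>+ y. ennreal (1 / (2 * pi)) * indicator ({- action es..action es} \<inter> Psi es -` A) y \<partial>lborel)"
    by (intro nn_integral_cong) (auto simp: indicator_def)
  also have "\<dots> = ennreal (1 / (2 * pi)) * emeasure lborel ({- action es..action es} \<inter> Psi es -` A)"
    using P by (intro nn_integral_cmult_indicator) auto
  finally show ?thesis .
qed

lemma finite_arc_measure: "finite_measure (arc_measure es)"
proof (rule finite_measureI)
  have "space (arc_measure es) = UNIV" by (simp add: arc_measure_def)
  then show "emeasure (arc_measure es) (space (arc_measure es)) \<noteq> \<infinity>"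
    using es_le by (simp add: emeasure_arc_measure emeasure_lborel_Icc_eq ennreal_mult_eq_top_iff)
qed

lemma arc_measure_integral:
  fixes f :: "complex \<Rightarrow> real"
  assumes f: "continuous_on UNIV f"
  shows "integral\<^sup>L (arc_measure es) f =
    1 / (2 * pi) * (\<integral>y. indicator {0..action es} y * (f (Phi y) + f (cnj (Phi y))) \<partial>lborel)"
proof -
  let ?Y = "action es"
  have fm [measurable]: "f \<in> borel_measurable borel" using f by (rule borel_measurable_continuous_onI)
  define g1 where "g1 = (\<lambda>y. indicator {0..?Y} y * f (Phi y))"
  define g2 where "g2 = (\<lambda>y. indicator {0..?Y} y * f (cnj (Phi y)))"
  have int: "integrable lborel g1" "integrable lborel g2"
  proof -
    have "continuous_on {0..?Y} (\<lambda>y. f (Phi y))" "continuous_on {0..?Y} (\<lambda>y. f (cnj (Phi y)))"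
      using Phi_cont[OF es_le(1,3)] by (auto intro!: continuous_on_compose2[OF f] continuous_intros)
    from this[THEN borel_integrable_atLeastAtMost'] show "integrable lborel g1" "integrable lborel g2"
      by (auto simp: set_integrable_def g1_def g2_def)
  qed
  have int2: "integrable lborel (\<lambda>y. g2 (- y))" "(\<integral>y. g2 (- y) \<partial>lborel) = (\<integral>y. g2 y \<partial>lborel)"
    using lborel_integrable_real_affine[OF int(2), of "-1" 0] lborel_integral_real_affine[of "-1" g2 0] by simp_all
  have "integral\<^sup>L (arc_measure es) f = (\<integral>y. (indicator {- ?Y..?Y} y / (2 * pi)) *\<^sub>R f (Psi es y) \<partial>lborel)"
    unfolding arc_measure_def by (subst integral_distr) (auto simp: integral_density)
  also have "\<dots> = (\<integral>y. 1 / (2 * pi) * (g1 y + g2 (- y)) \<partial>lborel)"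
  proof (rule integral_cong_AE)
    show "(\<lambda>y. 1 / (2 * pi) * (g1 y + g2 (- y))) \<in> borel_measurable lborel"
      using int(1) int2(1) by (intro borel_measurable_times borel_measurable_add borel_measurable_integrable) auto
    \<comment> \<open>At \<open>y = 0\<close> both \<open>g1 y\<close> and \<open>g2 (- y)\<close>
      contribute, while the left side has only one term.\<close>
    have "AE y in lborel. y \<noteq> (0::real)" by (rule AE_lborel_singleton)
    then show "AE y in lborel. (indicator {- ?Y..?Y} y / (2 * pi)) *\<^sub>R f (Psi es y) = 1 / (2 * pi) * (g1 y + g2 (- y))"
    proof eventually_elim
      case (elim y)
      then show ?case
        using Psi_pos[of y] Psi_neg[of y] by (cases "0 < y") (auto simp: g1_def g2_def indicator_def)
    qed
  qed measurable
  also have "\<dots> = 1 / (2 * pi) * ((\<integral>y. g1 y \<partial>lborel) + (\<integral>y. g2 y \<partial>lborel))"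
    using int int2 by simp
  also have "(\<integral>y. g1 y \<partial>lborel) + (\<integral>y. g2 y \<partial>lborel) = (\<integral>y. g1 y + g2 y \<partial>lborel)"
    using int by simp
  also have "\<dots> = (\<integral>y. indicator {0..?Y} y * (f (Phi y) + f (cnj (Phi y))) \<partial>lborel)"
    by (simp add: g1_def g2_def distrib_left)
  finally show ?thesis .
qed

lemma modulus_es_less: "modulus es < \<delta>"
  using arc_in[OF es_le(1,3)] by (simp add: modulus_def)

lemma modulus_cnj: "norm (cnj (arc \<epsilon>) - 1) = modulus \<epsilon>"
  unfolding modulus_def by (metis complex_cnj_diff complex_cnj_one complex_mod_cnj)

text \<open>The distance from \<open>1\<close> increases strictly along the arc, so lying in the
  disc of radius \<open>modulus es\<close> means \<open>\<epsilon> <= es\<close>.\<close>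

lemma Gamma_near_eq:
  assumes c: "\<delta> \<le> c"
  shows "Gamma_near c R0 (modulus es) = arc ` {0..es} \<union> cnj ` arc ` {0..es}"
proof (intro equalityI subsetI)
  fix z assume "z \<in> Gamma_near c R0 (modulus es)"
  then obtain \<epsilon> R where z: "z = Complex (1 + \<epsilon>) R" "0 \<le> \<epsilon>" "\<epsilon> \<le> c" "R = R0 \<epsilon> \<or> R = - R0 \<epsilon>" "norm (z - 1) \<le> modulus es"
    by (auto simp: Gamma_near_def Gamma_curve_def)
  have "\<epsilon> \<le> norm (z - 1)" using complex_Re_le_cmod[of "z - 1"] z(1) by simp
  then have e\<delta>: "\<epsilon> \<le> \<delta>" using z(5) modulus_es_less by linarith
  have zz: "z = arc \<epsilon> \<or> z = cnj (arc \<epsilon>)" using z(1,4) by (auto simp: complex_eq_iff)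
  then have "norm (z - 1) = modulus \<epsilon>" using modulus_cnj by (auto simp: modulus_def)
  then have "\<epsilon> \<le> es" using z(2,5) e\<delta> es_le modulus_le_iff[of \<epsilon> es] by simp
  then show "z \<in> arc ` {0..es} \<union> cnj ` arc ` {0..es}" using zz z(2) by auto
next
  fix z assume "z \<in> arc ` {0..es} \<union> cnj ` arc ` {0..es}"
  then obtain \<epsilon> where e: "0 \<le> \<epsilon>" "\<epsilon> \<le> es" "z = arc \<epsilon> \<or> z = cnj (arc \<epsilon>)" by auto
  have "norm (z - 1) = modulus \<epsilon>" using e(3) modulus_cnj by (auto simp: modulus_def)
  also have "\<dots> \<le> modulus es" using e es_le modulus_le_iff[of \<epsilon> es] by simp
  finally have n: "norm (z - 1) \<le> modulus es" .
  have "z = Complex (1 + \<epsilon>) (R0 \<epsilon>) \<or> z = Complex (1 + \<epsilon>) (- R0 \<epsilon>)" using e(3) by (auto simp: complex_eq_iff)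
  moreover have "\<epsilon> \<le> c" using e es_le c by linarith
  ultimately show "z \<in> Gamma_near c R0 (modulus es)"
    using n e(1) unfolding Gamma_near_def Gamma_curve_def by blast
qed

lemma arc_in_Gamma_near:
  assumes "0 \<le> \<epsilon>" "arc \<epsilon> \<in> Gamma_near c R0 (modulus es)"
  shows "\<epsilon> \<le> es"
proof -
  have n: "modulus \<epsilon> \<le> modulus es" using assms(2) by (simp add: Gamma_near_def modulus_def)
  have "\<epsilon> \<le> modulus \<epsilon>" using complex_Re_le_cmod[of "arc \<epsilon> - 1"] by (simp add: modulus_def)
  then have "\<epsilon> \<le> \<delta>" using n modulus_es_less by linarith
  then show ?thesis using n assms(1) es_le modulus_le_iff[of \<epsilon> es] by simp
qed

lemma arc_segment_borel: "0 \<le> a \<Longrightarrow> b \<le> es \<Longrightarrow> arc ` {a..b} \<in> sets borel"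
  using es_le by (intro borel_closed compact_imp_closed compact_continuous_image continuous_on_subset[OF arc_cont]) auto

context
  fixes c :: real and u :: "complex \<Rightarrow> complex"
  assumes c: "\<delta> \<le> c" and hu: "\<And>\<beta>. norm (\<beta> - 1) < \<delta> \<Longrightarrow> h \<beta> (u \<beta>) = h_saddle (pinv \<beta>)"
begin

lemma Im_h_arc: "0 \<le> \<epsilon> \<Longrightarrow> \<epsilon> \<le> es \<Longrightarrow> Im (h (upper_arc R0 \<epsilon>) (u (upper_arc R0 \<epsilon>))) = - action \<epsilon>"
  using hu[OF arc_in[of \<epsilon>]] h_saddle_arc[of \<epsilon>] es_le by (simp add: arc_def)

text \<open>The preimage of an arc segment under \<open>Psi\<close> is the interval between the
  actions of its end points, which gives its mass. Symmetry is the reflection invariance of Lebesgue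
  measure.\<close>

lemma arc_measure_is_zero_limit: "is_zero_limit u c R0 (modulus es) (arc_measure es)"
  unfolding is_zero_limit_def
proof (intro conjI allI impI)
  show "sets (arc_measure es) = sets borel" by simp
  show "finite_measure (arc_measure es)" by (rule finite_arc_measure)
  show "emeasure (arc_measure es) (- Gamma_near c R0 (modulus es)) = 0"
  proof (cases "- Gamma_near c R0 (modulus es) \<in> sets borel")
    case True
    have "{- action es..action es} \<inter> Psi es -` (- Gamma_near c R0 (modulus es)) = {}"
    proof (rule ccontr)
      assume "\<not> ?thesis"
      then obtain y where y: "- action es \<le> y" "y \<le> action es" "Psi es y \<notin> Gamma_near c R0 (modulus es)" by auto
      have "Psi es y \<in> arc ` {0..es} \<union> cnj ` arc ` {0..es}"
      proof (cases "0 \<le> y")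
        case True
        then obtain \<epsilon> where "0 \<le> \<epsilon>" "\<epsilon> \<le> es" "Phi y = arc \<epsilon>" using Phi_obtain y(2) by metis
        then show ?thesis using Psi_pos[OF True y(2)] by auto
      next
        case False
        then obtain \<epsilon> where "0 \<le> \<epsilon>" "\<epsilon> \<le> es" "Phi (- y) = arc \<epsilon>" using Phi_obtain[of "- y"] y(1) by auto
        then show ?thesis using Psi_neg[of y] False y(1) by auto
      qed
      then show False using y(3) Gamma_near_eq[OF c] by simp
    qed
    then show ?thesis using emeasure_arc_measure[OF True] by simp
  next
    case False
    then show ?thesis by (intro emeasure_notin_sets) simp
  qed
next
  fix \<epsilon>1 \<epsilon>2 :: real
  assume a: "0 \<le> \<epsilon>1 \<and> \<epsilon>1 < \<epsilon>2 \<and> upper_arc R0 \<epsilon>1 \<in> Gamma_near c R0 (modulus es) \<and> upper_arc R0 \<epsilon>2 \<in> Gamma_near c R0 (modulus es)"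
  then have e2: "\<epsilon>2 \<le> es" using arc_in_Gamma_near[of \<epsilon>2 c] by (simp add: arc_def)
  have e1: "0 \<le> \<epsilon>1" "\<epsilon>1 < \<epsilon>2" using a by auto
  have act: "0 \<le> action \<epsilon>1" "action \<epsilon>1 < action \<epsilon>2" "action \<epsilon>2 \<le> action es"
    using action_le_iff[of 0 \<epsilon>1] action_mono[of \<epsilon>1 \<epsilon>2] action_le_iff[of \<epsilon>2 es] e1 e2 es_le by auto
  have "{- action es..action es} \<inter> Psi es -` (arc ` {\<epsilon>1..\<epsilon>2}) = {action \<epsilon>1..action \<epsilon>2}"
  proof (intro equalityI subsetI)
    fix y assume "y \<in> {- action es..action es} \<inter> Psi es -` (arc ` {\<epsilon>1..\<epsilon>2})"
    then obtain \<epsilon> where y: "- action es \<le> y" "y \<le> action es" and e: "\<epsilon>1 \<le> \<epsilon>" "\<epsilon> \<le> \<epsilon>2" "Psi es y = arc \<epsilon>" by auto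
    have e\<delta>: "0 \<le> \<epsilon>" "\<epsilon> \<le> \<delta>" "\<epsilon> \<le> \<delta> / 4" using e e1 e2 es_le by auto
    show "y \<in> {action \<epsilon>1..action \<epsilon>2}"
    proof (cases "0 \<le> y")
      case True
      then obtain \<epsilon>' where e': "0 \<le> \<epsilon>'" "\<epsilon>' \<le> es" "action \<epsilon>' = y" "Phi y = arc \<epsilon>'" using Phi_obtain[OF True y(2)] by blast
      then have "arc \<epsilon>' = arc \<epsilon>" using e(3) Psi_pos[OF True y(2)] by simp
      then have "\<epsilon>' = \<epsilon>" using arc_sel(1) by (metis add_left_cancel)
      then show ?thesis using e' e e1 e2 e\<delta> es_le action_le_iff[of \<epsilon>1 \<epsilon>] action_le_iff[of \<epsilon> \<epsilon>2] by auto
    next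
      \<comment> \<open>A negative parameter gives a point with negative imaginary part, while
        \<open>R0\<close> is nonnegative along the upper arc.\<close>
      case False
      then obtain \<epsilon>' where e': "0 \<le> \<epsilon>'" "\<epsilon>' \<le> es" "action \<epsilon>' = - y" "Phi (- y) = arc \<epsilon>'"
        using Phi_obtain[of "- y"] y(1) by auto
      have "\<epsilon>' \<noteq> 0" using e'(3) False by auto
      then have "0 < R0 \<epsilon>'" using R0_bounds[of \<epsilon>'] e' es_le by auto
      moreover have "cnj (arc \<epsilon>') = arc \<epsilon>" using e(3) Psi_neg[of y] False y(1) e'(4) by simp
      then have "- R0 \<epsilon>' = R0 \<epsilon>" by (metis arc_sel(2) cnj.sel(2))
      ultimately have False using R0_bounds[of \<epsilon>] e\<delta> by auto
      then show ?thesis ..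
    qed
  next
    fix y assume y: "y \<in> {action \<epsilon>1..action \<epsilon>2}"
    then obtain \<epsilon> where e: "\<epsilon>1 \<le> \<epsilon>" "\<epsilon> \<le> \<epsilon>2" "action \<epsilon> = y" using action_surj[of \<epsilon>1 \<epsilon>2 y] e1 e2 es_le by auto
    have "Psi es y = arc \<epsilon>"
      using Psi_pos[of y] Phi_action[of \<epsilon>] y act e e1 e2 es_le by auto
    then show "y \<in> {- action es..action es} \<inter> Psi es -` (arc ` {\<epsilon>1..\<epsilon>2})" using y act e by auto
  qed
  then have "emeasure (arc_measure es) (arc ` {\<epsilon>1..\<epsilon>2}) = ennreal (1 / (2 * pi)) * ennreal (action \<epsilon>2 - action \<epsilon>1)"
    using emeasure_arc_measure[OF arc_segment_borel[OF e1(1) e2]] act by simp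
  then have m: "measure (arc_measure es) (arc ` {\<epsilon>1..\<epsilon>2}) = 1 / (2 * pi) * (action \<epsilon>2 - action \<epsilon>1)"
    using act by (simp add: measure_def enn2real_mult)
  have i: "Im (h (upper_arc R0 \<epsilon>2) (u (upper_arc R0 \<epsilon>2))) = - action \<epsilon>2" "Im (h (upper_arc R0 \<epsilon>1) (u (upper_arc R0 \<epsilon>1))) = - action \<epsilon>1"
    using e1 e2 by (auto intro!: Im_h_arc)
  have im: "upper_arc R0 ` {\<epsilon>1..\<epsilon>2} = arc ` {\<epsilon>1..\<epsilon>2}" by (simp add: arc_def)
  show "measure (arc_measure es) (upper_arc R0 ` {\<epsilon>1..\<epsilon>2}) =
    1 / (2 * pi) * \<bar>Im (h (upper_arc R0 \<epsilon>2) (u (upper_arc R0 \<epsilon>2))) - Im (h (upper_arc R0 \<epsilon>1) (u (upper_arc R0 \<epsilon>1)))\<bar>"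
    unfolding i im m using act by simp
next
  show "distr (arc_measure es) borel cnj = arc_measure es"
  proof (rule measure_eqI)
    fix A assume "A \<in> sets (distr (arc_measure es) borel cnj)"
    then have A: "A \<in> sets borel" by simp
    have cm: "cnj \<in> borel_measurable borel" by (intro borel_measurable_continuous_onI continuous_intros)
    have cA: "cnj -` A \<in> sets borel" using measurable_sets[OF cm A] by simp
    have "emeasure (distr (arc_measure es) borel cnj) A = emeasure (arc_measure es) (cnj -` A)"
      using A cm by (subst emeasure_distr) (auto simp: arc_measure_def)
    also have "\<dots> = ennreal (1 / (2 * pi)) * emeasure lborel ({- action es..action es} \<inter> Psi es -` (cnj -` A))"
      by (rule emeasure_arc_measure[OF cA])
    also have "{- action es..action es} \<inter> Psi es -` (cnj -` A) = uminus -` ({- action es..action es} \<inter> Psi es -` A)"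
      by (auto simp: Psi_uminus)
    also have "emeasure lborel (uminus -` ({- action es..action es} \<inter> Psi es -` A)) = emeasure (distr lborel borel uminus) ({- action es..action es} \<inter> Psi es -` A)"
      using measurable_sets[OF Psi_measurable A] by (subst emeasure_distr) auto
    also have "\<dots> = emeasure lborel ({- action es..action es} \<inter> Psi es -` A)" by (simp only: lborel_distr_uminus)
    finally show "emeasure (distr (arc_measure es) borel cnj) A = emeasure (arc_measure es) A"
      using emeasure_arc_measure[OF A] by simp
  qed simp
qed

section \<open>Uniqueness of the limit measure\<close>

lemma zero_limit_arc_mass:
  assumes L: "is_zero_limit u c R0 (modulus es) \<mu>" and x: "0 \<le> x" "x \<le> es"
  shows "measure \<mu> (arc ` {0..x}) = action x / (2 * pi)"
proof -
  have s: "sets \<mu> = sets borel" and fin: "finite_measure \<mu>" using L by (auto simp: is_zero_limit_def)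
  interpret finite_measure \<mu> by (rule fin)
  have pos: "measure \<mu> (arc ` {0..x}) = action x / (2 * pi)" if x: "0 < x" "x \<le> es" for x
  proof -
    have "arc 0 \<in> Gamma_near c R0 (modulus es)" "arc x \<in> Gamma_near c R0 (modulus es)"
      unfolding Gamma_near_eq[OF c] using x by (intro UnI1 imageI; simp)+
    then have "measure \<mu> (upper_arc R0 ` {0..x}) =
       1 / (2 * pi) * \<bar>Im (h (upper_arc R0 x) (u (upper_arc R0 x))) - Im (h (upper_arc R0 0) (u (upper_arc R0 0)))\<bar>"
      using L x unfolding is_zero_limit_def arc_def by blast
    then show ?thesis using Im_h_arc[of x] Im_h_arc[of 0] x es_le action_pos[of x]
      by (simp add: arc_def)
  qed
  show ?thesis
  proof (cases "x = 0")
    \<comment> \<open>The definition prescribes the mass only for segments of positive length; that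
      of the point \<open>1\<close> is squeezed by the masses of shrinking segments.\<close>
    case True
    have "measure \<mu> {1} \<le> 0"
    proof (rule tendsto_lowerbound)
      have "(action \<longlongrightarrow> action 0) (at_right 0)"
        using continuous_on_Icc_at_rightD[OF action_cont] \<delta> by auto
      then have "((\<lambda>x. action x / (2 * pi)) \<longlongrightarrow> action 0 / (2 * pi)) (at_right 0)" by (intro tendsto_intros) auto
      then show "((\<lambda>x. action x / (2 * pi)) \<longlongrightarrow> 0) (at_right 0)" by simp
      show "\<forall>\<^sub>F x in at_right 0. measure \<mu> {1} \<le> action x / (2 * pi)"
      proof (rule eventually_mono[OF eventually_at_right_real[OF es(1)]])
        fix x assume x: "x \<in> {0<..<es}"
        have "arc 0 \<in> arc ` {0..x}" using x by (intro imageI) auto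
        then have "measure \<mu> {1} \<le> measure \<mu> (arc ` {0..x})"
          using x arc_segment_borel[of 0 x] s by (intro finite_measure_mono) auto
        then show "measure \<mu> {1} \<le> action x / (2 * pi)" using pos[of x] x by simp
      qed
    qed simp
    then have "measure \<mu> {1} = 0" using measure_nonneg[of \<mu> "{1}"] by linarith
    then show ?thesis using True by simp
  next
    case False
    then show ?thesis using pos x by simp
  qed
qed

text \<open>The restriction to the upper arc, transported to the real line by
  \<open>\<epsilon> = Re z - 1\<close>: there a finite measure is determined by its distribution
  function, which the segment condition prescribes.\<close>

definition shadow :: "complex measure \<Rightarrow> real measure" where
  "shadow \<mu> = distr (density \<mu> (indicator (arc ` {0..es}))) borel (\<lambda>z. Re z - 1)"

lemma shadow_props:
  assumes L: "is_zero_limit u c R0 (modulus es) \<mu>"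
  shows "finite_borel_measure (shadow \<mu>)"
    "B \<in> sets borel \<Longrightarrow> emeasure (shadow \<mu>) B = emeasure \<mu> (arc ` ({0..es} \<inter> B))"
    "cdf (shadow \<mu>) x = (if x < 0 then 0 else action (min x es) / (2 * pi))"
proof -
  have s: "sets \<mu> = sets borel" and fin: "finite_measure \<mu>" using L by (auto simp: is_zero_limit_def)
  have sp: "space \<mu> = UNIV" using sets_eq_imp_space_eq[OF s] by simp
  interpret finite_measure \<mu> by (rule fin)
  let ?G = "arc ` {0..es}"
  have G: "?G \<in> sets \<mu>" using arc_segment_borel[of 0 es] s by simp
  have rm: "(\<lambda>z. Re z - 1) \<in> borel_measurable borel" by (intro borel_measurable_continuous_onI continuous_intros)
  have rm': "(\<lambda>z. Re z - 1) \<in> borel_measurable \<mu>" using rm measurable_cong_sets[OF s refl] by blast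
  show em: "emeasure (shadow \<mu>) B = emeasure \<mu> (arc ` ({0..es} \<inter> B))" if B: "B \<in> sets borel" for B
  proof -
    have V: "(\<lambda>z. Re z - 1) -` B \<in> sets \<mu>" using measurable_sets[OF rm' B] sp by simp
    have "emeasure (shadow \<mu>) B = emeasure (density \<mu> (indicator ?G)) ((\<lambda>z. Re z - 1) -` B)"
      unfolding shadow_def using B rm' sp by (subst emeasure_distr) auto
    also have "\<dots> = (\<integral>\<^sup>+ z. indicator ?G z * indicator ((\<lambda>z. Re z - 1) -` B) z \<partial>\<mu>)"
      using V G by (intro emeasure_density) auto
    also have "\<dots> = (\<integral>\<^sup>+ z. indicator (?G \<inter> (\<lambda>z. Re z - 1) -` B) z \<partial>\<mu>)"
      by (intro nn_integral_cong) (auto simp: indicator_def)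
    also have "\<dots> = emeasure \<mu> (?G \<inter> (\<lambda>z. Re z - 1) -` B)" using V G by (intro nn_integral_indicator) auto
    also have "?G \<inter> (\<lambda>z. Re z - 1) -` B = arc ` ({0..es} \<inter> B)" by auto
    finally show ?thesis .
  qed
  show fbm: "finite_borel_measure (shadow \<mu>)"
  proof (intro finite_borel_measure.intro finite_borel_measure_axioms.intro finite_measureI)
    have "emeasure (shadow \<mu>) UNIV \<noteq> \<infinity>" by (subst em) simp_all
    then show "emeasure (shadow \<mu>) (space (shadow \<mu>)) \<noteq> \<infinity>" by (simp add: shadow_def)
    show "sets (shadow \<mu>) = sets borel" by (simp add: shadow_def)
  qed
  show "cdf (shadow \<mu>) x = (if x < 0 then 0 else action (min x es) / (2 * pi))"
  proof -
    have "cdf (shadow \<mu>) x = measure \<mu> (arc ` ({0..es} \<inter> {..x}))"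
      unfolding cdf_def measure_def using em[of "{..x}"] by simp
    moreover have "{0..es} \<inter> {..x} = (if x < 0 then {} else {0..min x es})" by auto
    ultimately show ?thesis using zero_limit_arc_mass[OF L, of "min x es"] es_le by (auto simp: min_def split: if_splits)
  qed
qed

text \<open>The measure lives on the two arcs, symmetry carries the lower one to the upper one, and
  their only common point \<open>1\<close> has no mass. Hence the shadow determines the
  measure.\<close>

lemma zero_limit_decomp:
  assumes L: "is_zero_limit u c R0 (modulus es) \<mu>" and A: "A \<in> sets borel"
  shows "emeasure \<mu> A = emeasure (shadow \<mu>) {x\<in>{0..es}. arc x \<in> A} + emeasure (shadow \<mu>) {x\<in>{0..es}. arc x \<in> cnj -` A}"
proof -
  have s: "sets \<mu> = sets borel" and fin: "finite_measure \<mu>" and null: "emeasure \<mu> (- Gamma_near c R0 (modulus es)) = 0"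
    and sym: "distr \<mu> borel cnj = \<mu>" using L by (auto simp: is_zero_limit_def)
  have sp: "space \<mu> = UNIV" using sets_eq_imp_space_eq[OF s] by simp
  interpret finite_measure \<mu> by (rule fin)
  let ?G = "arc ` {0..es}"
  have cm: "cnj \<in> borel_measurable borel" by (intro borel_measurable_continuous_onI continuous_intros)
  have cm': "cnj \<in> borel_measurable \<mu>" using cm measurable_cong_sets[OF s refl] by blast
  have G: "?G \<in> sets borel" using arc_segment_borel[of 0 es] by simp
  have cG: "cnj ` ?G = cnj -` ?G"
  proof (intro equalityI subsetI)
    fix z assume "z \<in> cnj -` ?G"
    then have "cnj (cnj z) \<in> cnj ` ?G" by (intro imageI) simp
    then show "z \<in> cnj ` ?G" by simp
  qed auto
  have cGb: "cnj -` ?G \<in> sets borel" using measurable_sets[OF cm G] by simp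
  have Ab: "A \<in> sets \<mu>" "?G \<in> sets \<mu>" "cnj -` ?G \<in> sets \<mu>" using A G cGb s by auto
  have cAb: "cnj -` A \<in> sets borel" using measurable_sets[OF cm A] by simp
  have "emeasure \<mu> {1} = ennreal (measure \<mu> (arc ` {0..0}))" by (simp add: emeasure_eq_measure)
  also have "\<dots> = 0" using zero_limit_arc_mass[OF L, of 0] es_le by simp
  finally have one: "{1} \<in> null_sets \<mu>" by (auto simp: null_sets_def s)
  have N: "- Gamma_near c R0 (modulus es) \<in> null_sets \<mu>"
    using null G cGb s unfolding Gamma_near_eq[OF c] cG by (auto simp: null_sets_def)
  have "emeasure \<mu> A = emeasure \<mu> (A - (- Gamma_near c R0 (modulus es)))"
    by (rule emeasure_Diff_null_set[symmetric, OF N Ab(1)])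
  also have "A - (- Gamma_near c R0 (modulus es)) = (A \<inter> ?G) \<union> ((A \<inter> cnj -` ?G) - {1})"
  proof -
    have "1 \<in> ?G" using es_le by (intro image_eqI[of _ _ 0]) auto
    then show ?thesis unfolding Gamma_near_eq[OF c] cG by auto
  qed
  also have "emeasure \<mu> \<dots> = emeasure \<mu> (A \<inter> ?G) + emeasure \<mu> ((A \<inter> cnj -` ?G) - {1})"
  proof (rule plus_emeasure[symmetric])
    have "z = 1" if "z \<in> ?G" "cnj z \<in> ?G" for z
    proof -
      obtain x y where xy: "0 \<le> x" "x \<le> es" "z = arc x" "0 \<le> y" "y \<le> es" "cnj z = arc y" using \<open>z \<in> ?G\<close> \<open>cnj z \<in> ?G\<close> by auto
      then have "- R0 x = R0 y" by (metis arc_sel(2) cnj.sel(2))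
      then have "x = 0" using R0_bounds[of x] R0_bounds[of y] xy es_le by auto
      then show ?thesis using xy by simp
    qed
    then show "A \<inter> ?G \<inter> (A \<inter> cnj -` ?G - {1}) = {}" by blast
  qed (use Ab one in \<open>auto simp: null_sets_def\<close>)
  also have "emeasure \<mu> ((A \<inter> cnj -` ?G) - {1}) = emeasure \<mu> (A \<inter> cnj -` ?G)"
    by (rule emeasure_Diff_null_set[OF one]) (use Ab in auto)
  also have "\<dots> = emeasure (distr \<mu> borel cnj) (A \<inter> cnj -` ?G)" by (simp only: sym)
  also have "\<dots> = emeasure \<mu> (cnj -` (A \<inter> cnj -` ?G))"
    using A cGb cm' sp by (subst emeasure_distr) auto
  also have "cnj -` (A \<inter> cnj -` ?G) = cnj -` A \<inter> ?G" by auto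
  finally have *: "emeasure \<mu> A = emeasure \<mu> (A \<inter> ?G) + emeasure \<mu> (cnj -` A \<inter> ?G)" .
  have sh: "emeasure \<mu> (D \<inter> ?G) = emeasure (shadow \<mu>) {x\<in>{0..es}. arc x \<in> D}" if D: "D \<in> sets borel" for D
  proof -
    have cont: "continuous_on UNIV (\<lambda>x. arc (min (max x 0) es))"
      using es_le by (intro continuous_on_compose2[OF arc_cont] continuous_intros) auto
    have "(\<lambda>x. arc (min (max x 0) es)) -` D \<in> sets borel"
      using measurable_sets[OF borel_measurable_continuous_onI[OF cont] D] by simp
    moreover have "{x\<in>{0..es}. arc x \<in> D} = {0..es} \<inter> (\<lambda>x. arc (min (max x 0) es)) -` D"
      by (auto simp: min_def max_def)
    ultimately have "{x\<in>{0..es}. arc x \<in> D} \<in> sets borel" by auto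
    from shadow_props(2)[OF L this] show ?thesis by (auto intro!: arg_cong[where f = "emeasure \<mu>"])
  qed
  show ?thesis unfolding * sh[OF A] sh[OF cAb] ..
qed

lemma zero_limit_unique:
  assumes L: "is_zero_limit u c R0 (modulus es) \<mu>1" "is_zero_limit u c R0 (modulus es) \<mu>2"
  shows "\<mu>1 = \<mu>2"
proof -
  have "shadow \<mu>1 = shadow \<mu>2"
    by (rule cdf_unique'[OF shadow_props(1)[OF L(1)] shadow_props(1)[OF L(2)]])
      (auto simp: fun_eq_iff shadow_props(3)[OF L(1)] shadow_props(3)[OF L(2)])
  then show ?thesis
    using zero_limit_decomp[OF L(1)] zero_limit_decomp[OF L(2)] L by (intro measure_eqI) (auto simp: is_zero_limit_def)
qed

lemma zero_limit_weakly_converges: "weakly_converges (\<lambda>N. zero_measure (modulus es) N) (arc_measure es)"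
  unfolding weakly_converges_def
proof (intro allI impI)
  fix f :: "complex \<Rightarrow> real" assume f: "continuous_on UNIV f \<and> bounded (range f)"
  then obtain B where B: "\<And>z. \<bar>f z\<bar> \<le> B" unfolding bounded_iff by auto
  have fin: "finite (zeros_near (modulus es) N)" for N
    using finite_partition_zeros[of "modulus es" N] by (simp add: zeros_near_def)
  have "integral\<^sup>L (zero_measure (modulus es) N) f = (\<Sum>\<beta>\<in>zeros_near (modulus es) N. f \<beta>) / real N" for N
    using f by (intro zero_measure_integral fin borel_measurable_continuous_onI) auto
  then show "(\<lambda>N. integral\<^sup>L (zero_measure (modulus es) N) f) \<longlonglongrightarrow> integral\<^sup>L (arc_measure es) f"
    using zeros_limit[OF es, of f B] f B arc_measure_integral[of f] by simp
qed

end

end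

end

theorem corollary1p6:
  fixes c0 c :: real and u :: "complex \<Rightarrow> complex" and R0 :: "real \<Rightarrow> real"
  assumes "0 < c0" and "saddle_points c0 u"
    and "0 < c" and "critical_curve u c R0"
  shows "\<exists>c1>0. \<forall>c'. 0 < c' \<and> c' \<le> c1 \<longrightarrow>
           (\<exists>!\<mu>. is_zero_limit u c R0 c' \<mu>) \<and>
           (\<forall>\<mu>. is_zero_limit u c R0 c' \<mu> \<longrightarrow> weakly_converges (\<lambda>N. zero_measure c' N) \<mu>)"
proof -
  obtain \<delta> pinv where ca: "critical_arc \<delta> pinv R0" and c: "\<delta> \<le> c"
    and hu: "\<And>\<beta>. norm (\<beta> - 1) < \<delta> \<Longrightarrow> h \<beta> (u \<beta>) = h_saddle (pinv \<beta>)"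
    using critical_arc_exists[OF assms] by blast
  interpret critical_arc \<delta> pinv R0 by (rule ca)
  show ?thesis
  proof (intro exI[of _ "\<delta> / 8"] conjI allI impI)
    show "0 < \<delta> / 8" using \<delta> by simp
    fix c' assume c': "0 < c' \<and> c' \<le> \<delta> / 8"
    \<comment> \<open>The radius \<open>c'\<close> is converted into a parameter \<open>es\<close>
      by the intermediate value theorem; as \<open>modulus \<epsilon> >= \<epsilon>\<close>, the
      parameters up to \<open>\<delta> / 8\<close> reach every radius up to
      \<open>\<delta> / 8\<close>.\<close>
    have "\<delta> / 8 \<le> modulus (\<delta> / 8)" using modulus_bounds(1)[of "\<delta> / 8"] \<delta> by simp
    then obtain es where e: "0 \<le> es" "es \<le> \<delta> / 8" "modulus es = c'"
      using IVT'[of modulus 0 c' "\<delta> / 8"] c' \<delta> continuous_on_subset[OF modulus_cont, of "{0..\<delta> / 8}"] by auto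
    have "es \<noteq> 0" using e(3) c' by auto
    then have es: "0 < es" "es < \<delta> / 4" using e \<delta> by auto
    have lim: "is_zero_limit u c R0 c' (arc_measure es)"
      using arc_measure_is_zero_limit[OF es c hu] e(3) by simp
    have uniq: "\<mu>1 = \<mu>2" if "is_zero_limit u c R0 c' \<mu>1" "is_zero_limit u c R0 c' \<mu>2" for \<mu>1 \<mu>2
      using zero_limit_unique[OF es c hu] that e(3) by simp
    have conv: "weakly_converges (\<lambda>N. zero_measure c' N) (arc_measure es)"
      using zero_limit_weakly_converges[OF es c hu] e(3) by simp
    show "\<exists>!\<mu>. is_zero_limit u c R0 c' \<mu>" using lim uniq by blast
    show "weakly_converges (\<lambda>N. zero_measure c' N) \<mu>" if "is_zero_limit u c R0 c' \<mu>" for \<mu>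
      using conv uniq[OF that lim] by simp
  qed
qed

end
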